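(* Let $n\ge1$ and let $\mathcal C$ be an $n$-Frobenius category. The composition operator $\circ$ is associative: for $M,N,K,L\in\mathcal C$ with fixed unit conflations $\delta_N\in\operatorname{Ext}^n(N,\Omega^nN)$, $\delta_K\in\operatorname{Ext}^n(K,\Omega^nK)$, and for all $\bar\alpha\in\operatorname{Ext}^n(M,\Omega^nN)/\mathcal P$, $\bar\beta\in\operatorname{Ext}^n(N,\Omega^nK)/\mathcal P$ and $\bar\gamma\in\operatorname{Ext}^n(K,\Omega^nL)/\mathcal P$, $$(\bar\gamma\circ\bar\beta)\circ\bar\alpha=\bar\gamma\circ(\bar\beta\circ\bar\alpha).$$
   Context: Let $\mathcal A$ be an abelian category and $\mathcal C$ a full additive extension-closed subcategory with the inherited exact structure: conflations are short exact sequences of $\mathcal A$ with all terms in $\mathcal C$ (first map an inflation, second a deflation). $\operatorname{Ext}^t(A,B)=\operatorname{Ext}^t_{\mathcal C}(A,B)$ ($t\ge1$) is the abelian group (Baer sum) of equivalence classes of exact sequences $B\to X_{t-1}\to\cdots\to X_0\to A$ spliced from $t$ conflations. $g\gamma$, $\gamma h$ denote push-out along $g$ and pull-back along $h$. $P\in\mathcal C$ is $n$-projective (resp. $n$-injective) if $\operatorname{Ext}^i(P,Y)=0$ (resp. $\operatorname{Ext}^i(Y,P)=0$) for all $i>n$, $Y\in\mathcal C$. $\mathcal C$ is $n$-Frobenius if every object has a deflation from an $n$-projective and an inflation into an $n$-injective, and $n$-projectives and $n$-injectives coincide. $\mathcal P(X,Y)\subseteq\operatorname{Ext}^n(X,Y)$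 is the subgroup of elements $\eta h$ with $h:X\to P$, $P$ $n$-projective, $\eta\in\operatorname{Ext}^n(P,Y)$; bars denote classes modulo $\mathcal P$. A unit conflation of length $n$ is of the form $B\to P_{n-1}\to\cdots\to P_0\to A$ with all $P_i$ $n$-projective; $B$ is then an $n$-th syzygy $\Omega^nA$ of $A$; $\mathcal U^n(B)$ denotes the class of unit conflations of length $n$ beginning with $B$. A right unit factorization of $\gamma\in\operatorname{Ext}^n(M,\Omega^nN)$ is an equality $\gamma=\delta f$ with $\delta\in\mathcal U^n(\Omega^nN)$ and $f$ a morphism; these always exist. $\Sigma$ is the class of quasi-invertible morphisms: those $f:A\to B$ such that $\operatorname{Ext}^{n+1}(X,A)\to\operatorname{Ext}^{n+1}(X,B)$, $\gamma\mapsto f\gamma$, is an isomorphism for all $X\in\mathcal C$ (equivalently, the analogous condition with pull-backs). For $\delta,\delta'\in\mathcal U^n(B)$, a co-angled pair $[\delta a,\delta'b]$ consists of deflations $a,b\in\Sigma$ from a common object to the right end terms of $\delta,\delta'$ respectively, such that $\delta a=\delta'b$ is again in $\mathcal U^n(B)$; such pairs always exist. For $b:X\to X'$ in $\Sigma$ and $\gamma\in\operatorname{Ext}^n(X,Y)$, $\gamma b^{-1}$ denotes an element $\gamma'\in\operatorname{Ext}^n(X',Y)$ with $\gamma-\gamma'b\in\mathcal P$; it exists and is unique modulo $\mathcal P$. Composition: with a fixed unit conflation $\delta_N\in\operatorname{Ext}^n(N,\Omega^nN)$, for $\beta\in\operatorname{Ext}^n(N,\Omega^nK)$ and $\gamma\in\operatorname{Ext}^n(M,\Omega^nN)$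 put $\bar\beta\circ\bar\gamma:=\overline{((\beta a_1)b_1^{-1})f}\in\operatorname{Ext}^n(M,\Omega^nK)/\mathcal P$, where $\gamma=\delta f$ is a right unit factorization and $[\delta_Na_1,\delta b_1]$ is a co-angled pair; this is well-defined. *)

theory Defs
  imports "HOL-Algebra.Coset"
begin

section \<open>Abelian categories\<close>

record ('o, 'm) additive_data =
  Obj   :: "'o set"
  Arr   :: "'m set"
  src   :: "'m \<Rightarrow> 'o"
  tgt   :: "'m \<Rightarrow> 'o"
  idm   :: "'o \<Rightarrow> 'm"
  comp  :: "'m \<Rightarrow> 'm \<Rightarrow> 'm"  (infixl \<open>\<cdot>\<index>\<close> 70)  \<comment> \<open>\<open>g \<cdot> f\<close> is \<open>g\<close> after \<open>f\<close>\<close>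
  hzero :: "'o \<Rightarrow> 'o \<Rightarrow> 'm"
  hadd  :: "'m \<Rightarrow> 'm \<Rightarrow> 'm"  (infixl \<open>\<boxplus>\<index>\<close> 65)

definition Hom :: "('o, 'm) additive_data \<Rightarrow> 'o \<Rightarrow> 'o \<Rightarrow> 'm set" where
  "Hom A X Y = {f \<in> Arr A. src A f = X \<and> tgt A f = Y}"

definition hom_group :: "('o, 'm) additive_data \<Rightarrow> 'o \<Rightarrow> 'o \<Rightarrow> 'm monoid" where
  "hom_group A X Y = \<lparr>carrier = Hom A X Y, mult = hadd A, one = hzero A X Y\<rparr>"

definition is_zero_object :: "('o, 'm) additive_data \<Rightarrow> 'o \<Rightarrow> bool" where
  "is_zero_object A Z \<longleftrightarrow> Z \<in> Obj A \<and>
     (\<forall>X\<in>Obj A. (\<exists>!f. f \<in> Hom A X Z) \<and> (\<exists>!f. f \<in> Hom A Z X))"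

definition is_biproduct ::
  "('o, 'm) additive_data \<Rightarrow> 'o \<Rightarrow> 'o \<Rightarrow> 'o \<Rightarrow> 'm \<Rightarrow> 'm \<Rightarrow> 'm \<Rightarrow> 'm \<Rightarrow> bool" where
  "is_biproduct A X Y S i j p q \<longleftrightarrow>
     S \<in> Obj A \<and>
     i \<in> Hom A X S \<and> j \<in> Hom A Y S \<and> p \<in> Hom A S X \<and> q \<in> Hom A S Y \<and>
     p \<cdot>\<^bsub>A\<^esub> i = idm A X \<and> q \<cdot>\<^bsub>A\<^esub> j = idm A Y \<and>
     q \<cdot>\<^bsub>A\<^esub> i = hzero A X Y \<and> p \<cdot>\<^bsub>A\<^esub> j = hzero A Y X \<and>
     (i \<cdot>\<^bsub>A\<^esub> p) \<boxplus>\<^bsub>A\<^esub> (j \<cdot>\<^bsub>A\<^esub> q) = idm A S"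

definition is_kernel :: "('o, 'm) additive_data \<Rightarrow> 'm \<Rightarrow> 'm \<Rightarrow> bool" where
  "is_kernel A k f \<longleftrightarrow>
     k \<in> Arr A \<and> f \<in> Arr A \<and> tgt A k = src A f \<and>
     f \<cdot>\<^bsub>A\<^esub> k = hzero A (src A k) (tgt A f) \<and>
     (\<forall>h\<in>Arr A. tgt A h = src A f \<and> f \<cdot>\<^bsub>A\<^esub> h = hzero A (src A h) (tgt A f) \<longrightarrow>
        (\<exists>!u. u \<in> Hom A (src A h) (src A k) \<and> k \<cdot>\<^bsub>A\<^esub> u = h))"

definition is_cokernel :: "('o, 'm) additive_data \<Rightarrow> 'm \<Rightarrow> 'm \<Rightarrow> bool" where
  "is_cokernel A c f \<longleftrightarrow>
     c \<in> Arr A \<and> f \<in> Arr A \<and> src A c = tgt A f \<and>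
     c \<cdot>\<^bsub>A\<^esub> f = hzero A (src A f) (tgt A c) \<and>
     (\<forall>h\<in>Arr A. src A h = tgt A f \<and> h \<cdot>\<^bsub>A\<^esub> f = hzero A (src A f) (tgt A h) \<longrightarrow>
        (\<exists>!u. u \<in> Hom A (tgt A c) (tgt A h) \<and> u \<cdot>\<^bsub>A\<^esub> c = h))"

definition is_mono :: "('o, 'm) additive_data \<Rightarrow> 'm \<Rightarrow> bool" where
  "is_mono A f \<longleftrightarrow> f \<in> Arr A \<and>
     (\<forall>W\<in>Obj A. \<forall>g\<in>Hom A W (src A f). \<forall>h\<in>Hom A W (src A f). f \<cdot>\<^bsub>A\<^esub> g = f \<cdot>\<^bsub>A\<^esub> h \<longrightarrow> g = h)"

definition is_epi :: "('o, 'm) additive_data \<Rightarrow> 'm \<Rightarrow> bool" where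
  "is_epi A f \<longleftrightarrow> f \<in> Arr A \<and>
     (\<forall>W\<in>Obj A. \<forall>g\<in>Hom A (tgt A f) W. \<forall>h\<in>Hom A (tgt A f) W. g \<cdot>\<^bsub>A\<^esub> f = h \<cdot>\<^bsub>A\<^esub> f \<longrightarrow> g = h)"

locale abelian_category =
  fixes A :: "('o, 'm) additive_data" (structure)
  assumes src_in: "f \<in> Arr A \<Longrightarrow> src A f \<in> Obj A"
    and tgt_in: "f \<in> Arr A \<Longrightarrow> tgt A f \<in> Obj A"
    and id_in: "X \<in> Obj A \<Longrightarrow> idm A X \<in> Hom A X X"
    and comp_in: "f \<in> Hom A X Y \<Longrightarrow> g \<in> Hom A Y Z \<Longrightarrow> g \<cdot> f \<in> Hom A X Z"
    and comp_id: "f \<in> Hom A X Y \<Longrightarrow> f \<cdot> idm A X = f"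
    and id_comp: "f \<in> Hom A X Y \<Longrightarrow> idm A Y \<cdot> f = f"
    and comp_assoc:
      "f \<in> Hom A W X \<Longrightarrow> g \<in> Hom A X Y \<Longrightarrow> h \<in> Hom A Y Z \<Longrightarrow> h \<cdot> (g \<cdot> f) = (h \<cdot> g) \<cdot> f"
    and hom_comm_group: "X \<in> Obj A \<Longrightarrow> Y \<in> Obj A \<Longrightarrow> comm_group (hom_group A X Y)"
    and comp_add_right:
      "f \<in> Hom A X Y \<Longrightarrow> f' \<in> Hom A X Y \<Longrightarrow> g \<in> Hom A Y Z \<Longrightarrow> g \<cdot> (f \<boxplus> f') = (g \<cdot> f) \<boxplus> (g \<cdot> f')"
    and comp_add_left:
      "f \<in> Hom A X Y \<Longrightarrow> g \<in> Hom A Y Z \<Longrightarrow> g' \<in> Hom A Y Z \<Longrightarrow> (g \<boxplus> g') \<cdot> f = (g \<cdot> f) \<boxplus> (g' \<cdot> f)"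
    and ex_zero_object: "\<exists>Z. is_zero_object A Z"
    and ex_biproduct:
      "X \<in> Obj A \<Longrightarrow> Y \<in> Obj A \<Longrightarrow> \<exists>S i j p q. is_biproduct A X Y S i j p q"
    and ex_kernel: "f \<in> Arr A \<Longrightarrow> \<exists>k. is_kernel A k f"
    and ex_cokernel: "f \<in> Arr A \<Longrightarrow> \<exists>c. is_cokernel A c f"
    and mono_normal: "is_mono A f \<Longrightarrow> \<exists>g. is_kernel A f g"
    and epi_normal: "is_epi A f \<Longrightarrow> \<exists>g. is_cokernel A f g"

section \<open>Extension-closed subcategories and their conflations\<close>

definition short_exact :: "('o, 'm) additive_data \<Rightarrow> 'm \<Rightarrow> 'm \<Rightarrow> bool" where
  "short_exact A i p \<longleftrightarrow> is_kernel A i p \<and> is_cokernel A p i"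

text \<open>A full subcategory is given by its set \<open>C\<close> of objects. Closure under isomorphism follows
  from the two closure conditions.\<close>

locale extension_closed_subcategory = abelian_category A
  for A :: "('o, 'm) additive_data" (structure) +
  fixes C :: "'o set"
  assumes sub_Obj: "C \<subseteq> Obj A"
    and zero_in_sub: "\<exists>Z\<in>C. is_zero_object A Z"
    and biproduct_in_sub: "X \<in> C \<Longrightarrow> Y \<in> C \<Longrightarrow> \<exists>S\<in>C. \<exists>i j p q. is_biproduct A X Y S i j p q"
    and extension_in_sub: "short_exact A i p \<Longrightarrow> src A i \<in> C \<Longrightarrow> tgt A p \<in> C \<Longrightarrow> tgt A i \<in> C"

definition conflation :: "('o, 'm) additive_data \<Rightarrow> 'o set \<Rightarrow> 'm \<Rightarrow> 'm \<Rightarrow> bool" where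
  "conflation A C i p \<longleftrightarrow> short_exact A i p \<and> src A i \<in> C \<and> tgt A i \<in> C \<and> tgt A p \<in> C"

definition inflation :: "('o, 'm) additive_data \<Rightarrow> 'o set \<Rightarrow> 'm \<Rightarrow> bool" where
  "inflation A C i \<longleftrightarrow> (\<exists>p. conflation A C i p)"

definition deflation :: "('o, 'm) additive_data \<Rightarrow> 'o set \<Rightarrow> 'm \<Rightarrow> bool" where
  "deflation A C p \<longleftrightarrow> (\<exists>i. conflation A C i p)"

section \<open>Yoneda extension groups\<close>

text \<open>An exact sequence \<open>B \<rightarrow> X\<^sub>t\<^sub>-\<^sub>1 \<rightarrow> \<dots> \<rightarrow> X\<^sub>0 \<rightarrow> A\<close> spliced from \<open>t\<close> conflations
  \<open>K\<^sub>j\<^sub>+\<^sub>1 \<rightarrow> X\<^sub>j \<rightarrow> K\<^sub>j\<close> (\<open>K\<^sub>t = B\<close>, \<open>K\<^sub>0 = A\<close>) is represented by the list of these conflations,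
  starting at \<open>B\<close>; so entry \<open>k\<close> of the list has middle term \<open>X\<^sub>t\<^sub>-\<^sub>1\<^sub>-\<^sub>k\<close>. The choice of the
  objects \<open>K\<^sub>j\<close> becomes irrelevant after passing to equivalence classes.\<close>

type_synonym 'm exseq = "('m \<times> 'm) list"

definition exseqs :: "('o, 'm) additive_data \<Rightarrow> 'o set \<Rightarrow> 'm exseq set" where
  "exseqs A C = {E. E \<noteq> [] \<and> (\<forall>(i, p)\<in>set E. conflation A C i p) \<and>
     (\<forall>k. Suc k < length E \<longrightarrow> tgt A (snd (E ! k)) = src A (fst (E ! Suc k)))}"

definition left_end :: "('o, 'm) additive_data \<Rightarrow> 'm exseq \<Rightarrow> 'o" where
  "left_end A E = src A (fst (hd E))"

definition right_end :: "('o, 'm) additive_data \<Rightarrow> 'm exseq \<Rightarrow> 'o" where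
  "right_end A E = tgt A (snd (last E))"

text \<open>Morphisms of exact sequences that are the identity on both end terms; \<open>u\<close> are the
  components on the middle terms and \<open>v\<close> the induced maps between the splicing objects.\<close>

definition exseq_morphism ::
  "('o, 'm) additive_data \<Rightarrow> 'o set \<Rightarrow> 'm exseq \<Rightarrow> 'm exseq \<Rightarrow> bool" where
  "exseq_morphism A C E F \<longleftrightarrow>
     E \<in> exseqs A C \<and> F \<in> exseqs A C \<and> length E = length F \<and>
     left_end A E = left_end A F \<and> right_end A E = right_end A F \<and>
     (\<exists>u v. v 0 = idm A (left_end A E) \<and> v (length E) = idm A (right_end A E) \<and>
        (\<forall>k<length E. case (E ! k, F ! k) of ((i, p), (i', p')) \<Rightarrow>
           v k \<in> Hom A (src A i) (src A i') \<and>
           u k \<in> Hom A (tgt A i) (tgt A i') \<and>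
           v (Suc k) \<in> Hom A (tgt A p) (tgt A p') \<and>
           u k \<cdot>\<^bsub>A\<^esub> i = i' \<cdot>\<^bsub>A\<^esub> v k \<and>
           v (Suc k) \<cdot>\<^bsub>A\<^esub> p = p' \<cdot>\<^bsub>A\<^esub> u k))"

definition exseq_equiv :: "('o, 'm) additive_data \<Rightarrow> 'o set \<Rightarrow> ('m exseq \<times> 'm exseq) set" where
  "exseq_equiv A C = {(E, F). E \<in> exseqs A C \<and> F \<in> exseqs A C \<and>
     equivclp (exseq_morphism A C) E F}"

definition ext_class :: "('o, 'm) additive_data \<Rightarrow> 'o set \<Rightarrow> 'm exseq \<Rightarrow> 'm exseq set" where
  "ext_class A C E = exseq_equiv A C `` {E}"

definition ext_set ::
  "('o, 'm) additive_data \<Rightarrow> 'o set \<Rightarrow> nat \<Rightarrow> 'o \<Rightarrow> 'o \<Rightarrow> 'm exseq set set" where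
  "ext_set A C t X Y =
     {E \<in> exseqs A C. length E = t \<and> right_end A E = X \<and> left_end A E = Y} // exseq_equiv A C"

definition is_pushout ::
  "('o, 'm) additive_data \<Rightarrow> 'm \<Rightarrow> 'm \<Rightarrow> 'm \<Rightarrow> 'm \<Rightarrow> bool" where
  "is_pushout A i g g' i' \<longleftrightarrow>
     i \<in> Arr A \<and> g \<in> Arr A \<and> src A i = src A g \<and>
     g' \<in> Hom A (tgt A i) (tgt A i') \<and> i' \<in> Hom A (tgt A g) (tgt A i') \<and>
     g' \<cdot>\<^bsub>A\<^esub> i = i' \<cdot>\<^bsub>A\<^esub> g \<and>
     (\<forall>W. \<forall>x\<in>Hom A (tgt A i) W. \<forall>y\<in>Hom A (tgt A g) W. x \<cdot>\<^bsub>A\<^esub> i = y \<cdot>\<^bsub>A\<^esub> g \<longrightarrow>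
        (\<exists>!w. w \<in> Hom A (tgt A i') W \<and> w \<cdot>\<^bsub>A\<^esub> g' = x \<and> w \<cdot>\<^bsub>A\<^esub> i' = y))"

definition is_pullback ::
  "('o, 'm) additive_data \<Rightarrow> 'm \<Rightarrow> 'm \<Rightarrow> 'm \<Rightarrow> 'm \<Rightarrow> bool" where
  "is_pullback A p h h' p' \<longleftrightarrow>
     p \<in> Arr A \<and> h \<in> Arr A \<and> tgt A p = tgt A h \<and>
     h' \<in> Hom A (src A p') (src A p) \<and> p' \<in> Hom A (src A p') (src A h) \<and>
     p \<cdot>\<^bsub>A\<^esub> h' = h \<cdot>\<^bsub>A\<^esub> p' \<and>
     (\<forall>W. \<forall>x\<in>Hom A W (src A p). \<forall>y\<in>Hom A W (src A h). p \<cdot>\<^bsub>A\<^esub> x = h \<cdot>\<^bsub>A\<^esub> y \<longrightarrow>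
        (\<exists>!w. w \<in> Hom A W (src A p') \<and> h' \<cdot>\<^bsub>A\<^esub> w = x \<and> p' \<cdot>\<^bsub>A\<^esub> w = y))"

text \<open>The push-out of an exact sequence only changes its first conflation, the pull-back only
  its last one.\<close>

definition pushout_seq ::
  "('o, 'm) additive_data \<Rightarrow> 'o set \<Rightarrow> 'm \<Rightarrow> 'm exseq \<Rightarrow> 'm exseq \<Rightarrow> bool" where
  "pushout_seq A C g E E' \<longleftrightarrow>
     (\<exists>i p i' p' g' Es. E = (i, p) # Es \<and> E' = (i', p') # Es \<and>
        is_pushout A i g g' i' \<and> conflation A C i' p' \<and> p' \<cdot>\<^bsub>A\<^esub> g' = p)"

definition pullback_seq ::
  "('o, 'm) additive_data \<Rightarrow> 'o set \<Rightarrow> 'm \<Rightarrow> 'm exseq \<Rightarrow> 'm exseq \<Rightarrow> bool" where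
  "pullback_seq A C h E E' \<longleftrightarrow>
     (\<exists>i p i' p' h' Es. E = Es @ [(i, p)] \<and> E' = Es @ [(i', p')] \<and>
        is_pullback A p h h' p' \<and> conflation A C i' p' \<and> h' \<cdot>\<^bsub>A\<^esub> i' = i)"

text \<open>Push-out, pull-back and Baer sum are lifted to equivalence classes by taking the union of
  the classes arising from all representatives (all these classes coincide).\<close>

definition ext_push ::
  "('o, 'm) additive_data \<Rightarrow> 'o set \<Rightarrow> 'm \<Rightarrow> 'm exseq set \<Rightarrow> 'm exseq set" where
  "ext_push A C g \<gamma> = (\<Union>E\<in>\<gamma>. \<Union>E'\<in>{E'. pushout_seq A C g E E'}. ext_class A C E')"

definition ext_pull ::
  "('o, 'm) additive_data \<Rightarrow> 'o set \<Rightarrow> 'm exseq set \<Rightarrow> 'm \<Rightarrow> 'm exseq set" where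
  "ext_pull A C \<gamma> h = (\<Union>E\<in>\<gamma>. \<Union>E'\<in>{E'. pullback_seq A C h E E'}. ext_class A C E')"

definition biprod ::
  "('o, 'm) additive_data \<Rightarrow> 'o \<Rightarrow> 'o \<Rightarrow> 'o \<times> 'm \<times> 'm \<times> 'm \<times> 'm" where
  "biprod A X Y = (SOME (S, i, j, p, q). is_biproduct A X Y S i j p q)"

definition arr_sum :: "('o, 'm) additive_data \<Rightarrow> 'm \<Rightarrow> 'm \<Rightarrow> 'm" where
  "arr_sum A f g =
     (let (S, i, j, p, q) = biprod A (src A f) (src A g);
          (S', i', j', p', q') = biprod A (tgt A f) (tgt A g)
      in (i' \<cdot>\<^bsub>A\<^esub> f \<cdot>\<^bsub>A\<^esub> p) \<boxplus>\<^bsub>A\<^esub> (j' \<cdot>\<^bsub>A\<^esub> g \<cdot>\<^bsub>A\<^esub> q))"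

definition diagonal :: "('o, 'm) additive_data \<Rightarrow> 'o \<Rightarrow> 'm" where
  "diagonal A X = (let (S, i, j, p, q) = biprod A X X in i \<boxplus>\<^bsub>A\<^esub> j)"

definition codiagonal :: "('o, 'm) additive_data \<Rightarrow> 'o \<Rightarrow> 'm" where
  "codiagonal A X = (let (S, i, j, p, q) = biprod A X X in p \<boxplus>\<^bsub>A\<^esub> q)"

definition exseq_sum :: "('o, 'm) additive_data \<Rightarrow> 'm exseq \<Rightarrow> 'm exseq \<Rightarrow> 'm exseq" where
  "exseq_sum A E F = map2 (\<lambda>(i, p) (i', p'). (arr_sum A i i', arr_sum A p p')) E F"

definition baer_sum ::
  "('o, 'm) additive_data \<Rightarrow> 'o set \<Rightarrow> 'o \<Rightarrow> 'o \<Rightarrow> 'm exseq set \<Rightarrow> 'm exseq set \<Rightarrow> 'm exseq set" where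
  "baer_sum A C X Y \<gamma> \<gamma>' =
     (\<Union>E\<in>\<gamma>. \<Union>F\<in>\<gamma>'.
        ext_push A C (codiagonal A Y)
          (ext_pull A C (ext_class A C (exseq_sum A E F)) (diagonal A X)))"

definition zero_obj :: "('o, 'm) additive_data \<Rightarrow> 'o" where
  "zero_obj A = (SOME Z. is_zero_object A Z)"

text \<open>The neutral element: \<open>Y \<rightarrow> Y \<oplus> X \<rightarrow> X\<close> for \<open>t = 1\<close>, and
  \<open>Y = Y \<rightarrow> 0 \<rightarrow> \<dots> \<rightarrow> 0 \<rightarrow> X = X\<close> for \<open>t \<ge> 2\<close>.\<close>

definition zero_exseq :: "('o, 'm) additive_data \<Rightarrow> nat \<Rightarrow> 'o \<Rightarrow> 'o \<Rightarrow> 'm exseq" where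
  "zero_exseq A t X Y =
     (if t \<le> 1 then (let (S, i, j, p, q) = biprod A Y X in [(i, q)])
      else (let Z = zero_obj A in
        [(idm A Y, hzero A Y Z)] @ replicate (t - 2) (idm A Z, idm A Z) @
        [(hzero A Z X, idm A X)]))"

definition Ext ::
  "('o, 'm) additive_data \<Rightarrow> 'o set \<Rightarrow> nat \<Rightarrow> 'o \<Rightarrow> 'o \<Rightarrow> 'm exseq set monoid" where
  "Ext A C t X Y = \<lparr>carrier = ext_set A C t X Y, mult = baer_sum A C X Y,
     one = ext_class A C (zero_exseq A t X Y)\<rparr>"

section \<open>\<open>n\<close>-Frobenius categories\<close>

definition n_projective :: "('o, 'm) additive_data \<Rightarrow> 'o set \<Rightarrow> nat \<Rightarrow> 'o \<Rightarrow> bool" where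
  "n_projective A C n P \<longleftrightarrow> P \<in> C \<and>
     (\<forall>i>n. \<forall>Y\<in>C. carrier (Ext A C i P Y) = {\<one>\<^bsub>Ext A C i P Y\<^esub>})"

definition n_injective :: "('o, 'm) additive_data \<Rightarrow> 'o set \<Rightarrow> nat \<Rightarrow> 'o \<Rightarrow> bool" where
  "n_injective A C n P \<longleftrightarrow> P \<in> C \<and>
     (\<forall>i>n. \<forall>Y\<in>C. carrier (Ext A C i Y P) = {\<one>\<^bsub>Ext A C i Y P\<^esub>})"

locale n_frobenius_category = extension_closed_subcategory A C
  for A :: "('o, 'm) additive_data" (structure) and C :: "'o set" +
  fixes n :: nat
  assumes enough_projectives:
      "X \<in> C \<Longrightarrow> \<exists>p. deflation A C p \<and> n_projective A C n (src A p) \<and> tgt A p = X"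
    and enough_injectives:
      "X \<in> C \<Longrightarrow> \<exists>i. inflation A C i \<and> n_injective A C n (tgt A i) \<and> src A i = X"
    and projective_iff_injective: "n_projective A C n P \<longleftrightarrow> n_injective A C n P"

definition proj_ext ::
  "('o, 'm) additive_data \<Rightarrow> 'o set \<Rightarrow> nat \<Rightarrow> 'o \<Rightarrow> 'o \<Rightarrow> 'm exseq set set" where
  "proj_ext A C n X Y =
     {ext_pull A C \<eta> h | \<eta> h P.
        n_projective A C n P \<and> h \<in> Hom A X P \<and> \<eta> \<in> carrier (Ext A C n P Y)}"

definition ext_bar ::
  "('o, 'm) additive_data \<Rightarrow> 'o set \<Rightarrow> nat \<Rightarrow> 'o \<Rightarrow> 'o \<Rightarrow> 'm exseq set \<Rightarrow> 'm exseq set set" where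
  "ext_bar A C n X Y \<gamma> = proj_ext A C n X Y #>\<^bsub>Ext A C n X Y\<^esub> \<gamma>"

definition ext_mod_proj ::
  "('o, 'm) additive_data \<Rightarrow> 'o set \<Rightarrow> nat \<Rightarrow> 'o \<Rightarrow> 'o \<Rightarrow> 'm exseq set set monoid" where
  "ext_mod_proj A C n X Y = Ext A C n X Y Mod proj_ext A C n X Y"

section \<open>Unit conflations, quasi-invertible morphisms and the composition\<close>

definition unit_conflation ::
  "('o, 'm) additive_data \<Rightarrow> 'o set \<Rightarrow> nat \<Rightarrow> 'm exseq \<Rightarrow> bool" where
  "unit_conflation A C n E \<longleftrightarrow> E \<in> exseqs A C \<and> length E = n \<and>
     (\<forall>(i, p)\<in>set E. n_projective A C n (tgt A i))"

text \<open>\<open>unit_ext A C n X B\<close> are the elements of \<open>Ext\<^sup>n(X, B)\<close> represented by a unit conflation;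
  the class \<open>\<U>\<^sup>n(B)\<close> is their union over all right end terms \<open>X\<close>.\<close>

definition unit_ext ::
  "('o, 'm) additive_data \<Rightarrow> 'o set \<Rightarrow> nat \<Rightarrow> 'o \<Rightarrow> 'o \<Rightarrow> 'm exseq set set" where
  "unit_ext A C n X B =
     {ext_class A C E | E. unit_conflation A C n E \<and> right_end A E = X \<and> left_end A E = B}"

definition is_syzygy :: "('o, 'm) additive_data \<Rightarrow> 'o set \<Rightarrow> nat \<Rightarrow> 'o \<Rightarrow> 'o \<Rightarrow> bool" where
  "is_syzygy A C n X B \<longleftrightarrow>
     (\<exists>E. unit_conflation A C n E \<and> right_end A E = X \<and> left_end A E = B)"

definition quasi_invertible :: "('o, 'm) additive_data \<Rightarrow> 'o set \<Rightarrow> nat \<Rightarrow> 'm \<Rightarrow> bool" where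
  "quasi_invertible A C n f \<longleftrightarrow> f \<in> Arr A \<and> src A f \<in> C \<and> tgt A f \<in> C \<and>
     (\<forall>X\<in>C. ext_push A C f \<in>
        iso (Ext A C (n + 1) X (src A f)) (Ext A C (n + 1) X (tgt A f)))"

definition right_unit_factorization ::
  "('o, 'm) additive_data \<Rightarrow> 'o set \<Rightarrow> nat \<Rightarrow> 'o \<Rightarrow> 'o \<Rightarrow> 'm exseq set \<Rightarrow> 'o \<Rightarrow> 'm exseq set \<Rightarrow> 'm \<Rightarrow> bool" where
  "right_unit_factorization A C n M B \<gamma> N' \<delta> f \<longleftrightarrow>
     \<delta> \<in> unit_ext A C n N' B \<and> f \<in> Hom A M N' \<and> \<gamma> = ext_pull A C \<delta> f"

text \<open>\<open>[\<delta>a, \<delta>'b]\<close> is a co-angled pair; \<open>X\<close>, \<open>X'\<close> are the right end terms of \<open>\<delta>\<close>, \<open>\<delta>'\<close> and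
  \<open>Z\<close> is the common source of \<open>a\<close> and \<open>b\<close>.\<close>

definition coangled_pair ::
  "('o, 'm) additive_data \<Rightarrow> 'o set \<Rightarrow> nat \<Rightarrow> 'o \<Rightarrow> 'o \<Rightarrow> 'o \<Rightarrow> 'o \<Rightarrow>
   'm exseq set \<Rightarrow> 'm exseq set \<Rightarrow> 'm \<Rightarrow> 'm \<Rightarrow> bool" where
  "coangled_pair A C n X X' B Z \<delta> \<delta>' a b \<longleftrightarrow>
     \<delta> \<in> unit_ext A C n X B \<and> \<delta>' \<in> unit_ext A C n X' B \<and>
     a \<in> Hom A Z X \<and> deflation A C a \<and> quasi_invertible A C n a \<and>
     b \<in> Hom A Z X' \<and> deflation A C b \<and> quasi_invertible A C n b \<and>
     ext_pull A C \<delta> a = ext_pull A C \<delta>' b \<and> ext_pull A C \<delta> a \<in> unit_ext A C n Z B"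

text \<open>\<open>\<gamma>'\<close> is a possible value of \<open>\<gamma> b\<inverse>\<close>, where \<open>\<gamma> \<in> Ext\<^sup>n(X, Y)\<close> and \<open>b : X \<rightarrow> X'\<close>.\<close>

definition is_pull_inverse ::
  "('o, 'm) additive_data \<Rightarrow> 'o set \<Rightarrow> nat \<Rightarrow> 'o \<Rightarrow> 'o \<Rightarrow> 'o \<Rightarrow>
   'm exseq set \<Rightarrow> 'm \<Rightarrow> 'm exseq set \<Rightarrow> bool" where
  "is_pull_inverse A C n X X' Y \<gamma> b \<gamma>' \<longleftrightarrow>
     \<gamma>' \<in> carrier (Ext A C n X' Y) \<and>
     \<gamma> \<otimes>\<^bsub>Ext A C n X Y\<^esub> inv\<^bsub>Ext A C n X Y\<^esub> (ext_pull A C \<gamma>' b) \<in> proj_ext A C n X Y"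

text \<open>\<open>ext_comp A C n M N B Y \<delta>\<^sub>N\<close> is the composition
  \<open>Ext\<^sup>n(N, Y)/\<P> \<times> Ext\<^sup>n(M, B)/\<P> \<rightarrow> Ext\<^sup>n(M, Y)/\<P>\<close> for the fixed \<open>\<delta>\<^sub>N \<in> Ext\<^sup>n(N, B)\<close>, \<open>B = \<Omega>\<^sup>nN\<close>.
  It is independent of the representatives of the two classes, of the right unit factorization,
  of the co-angled pair and of the chosen value of \<open>(\<beta>a)b\<inverse>\<close>, whence the definite description.\<close>

definition ext_comp ::
  "('o, 'm) additive_data \<Rightarrow> 'o set \<Rightarrow> nat \<Rightarrow> 'o \<Rightarrow> 'o \<Rightarrow> 'o \<Rightarrow> 'o \<Rightarrow> 'm exseq set \<Rightarrow>
   'm exseq set set \<Rightarrow> 'm exseq set set \<Rightarrow> 'm exseq set set" where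
  "ext_comp A C n M N B Y \<delta>\<^sub>N \<beta>' \<gamma>' =
     (THE r. \<exists>\<beta> \<gamma> N' \<delta> f Z a b \<epsilon>.
        \<beta> \<in> carrier (Ext A C n N Y) \<and> \<beta>' = ext_bar A C n N Y \<beta> \<and>
        \<gamma> \<in> carrier (Ext A C n M B) \<and> \<gamma>' = ext_bar A C n M B \<gamma> \<and>
        right_unit_factorization A C n M B \<gamma> N' \<delta> f \<and>
        coangled_pair A C n N N' B Z \<delta>\<^sub>N \<delta> a b \<and>
        is_pull_inverse A C n Z N' Y (ext_pull A C \<beta> a) b \<epsilon> \<and>
        r = ext_bar A C n M Y (ext_pull A C \<epsilon> f))"

end

(* Splicing with a unit conflation T of length n + 1 that ends in Y has kernel P(X, Y) on Ext^n(X, Y),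
   and every element T beta is of the form x delta_N with x in Ext^{n+1}(Omega^n N, -). Pulling back
   along a quasi-invertible deflation b is injective in high degrees, because the kernel of b is
   n-projective. Therefore T(beta o alpha) = x alpha characterises beta o alpha. If beta o alpha is
   computed as (beta a) b^{-1} f with alpha = delta f, both bracketings of gamma, beta, alpha become
   classes pulled back along f, and before this pull-back they agree because they agree after
   pulling back along b. The long exact sequences of Yoneda extensions that enter here are proved
   by induction on the degree; those in the first argument follow by passing to the opposite
   category. *)

theory Submission
  imports Defs
begin

section \<open>Additive calculus of arrows, and duality\<close>

section \<open>Arrows of an abelian category\<close>

text \<open>\<open>ext_comp\<close> is a definite description over nine choices, so a value
  independent of all of them has to be exhibited before associativity can be discussed. An equation
  T\<rho> = x\<gamma> does this, as it mentions none of the choices. The obstacle is that x is an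
  arbitrary class and not a unit conflation. If T\<gamma> = x \<open>\<delta>K\<close> and
  T(\<gamma> o \<beta>) = x\<beta> = x1 \<open>\<delta>N\<close>, then one bracketing is
  characterised by x1\<alpha> and the other by x(\<beta> o \<alpha>). Their equality cannot be read
  off from the equation for \<beta> o \<alpha>, which is formulated with a unit conflation T' ending
  at a different object. It is obtained on a concrete representative \<epsilon>f of \<beta> o
  \<alpha>, using that splicing with x annihilates P. A second obstacle lies in the notion of
  equality: classes of sequences agree when a zigzag of morphisms links them, and no single morphism
  need exist. Splitting of a zero extension and exactness at the right term are therefore expressed
  as properties of sequences that one morphism preserves in both directions.\<close>

lemma HomD:
  assumes "f \<in> Hom A X Y"
  shows "f \<in> Arr A" "src A f = X" "tgt A f = Y"
  using assms by (auto simp: Hom_def)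

lemma HomI: "f \<in> Arr A \<Longrightarrow> src A f = X \<Longrightarrow> tgt A f = Y \<Longrightarrow> f \<in> Hom A X Y"
  by (auto simp: Hom_def)

context abelian_category
begin

definition neg :: "'m \<Rightarrow> 'm" where
  "neg f = inv\<^bsub>hom_group A (src A f) (tgt A f)\<^esub> f"

lemma arr_obj [simp]: "f \<in> Arr A \<Longrightarrow> src A f \<in> Obj A" "f \<in> Arr A \<Longrightarrow> tgt A f \<in> Obj A"
  by (simp_all add: src_in tgt_in)

lemma idm_arr [simp]:
  assumes "X \<in> Obj A"
  shows "idm A X \<in> Arr A" "src A (idm A X) = X" "tgt A (idm A X) = X"
  using id_in[OF assms] by (auto simp: Hom_def)

lemma comp_arr [simp]:
  assumes "f \<in> Arr A" "g \<in> Arr A" "tgt A f = src A g"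
  shows "g \<cdot> f \<in> Arr A" "src A (g \<cdot> f) = src A f" "tgt A (g \<cdot> f) = tgt A g"
  using comp_in[of f "src A f" "tgt A f" g "tgt A g"] assms by (auto simp: Hom_def)

lemma comp_assoc_arr [simp]:
  assumes "f \<in> Arr A" "g \<in> Arr A" "h \<in> Arr A" "tgt A f = src A g" "tgt A g = src A h"
  shows "(h \<cdot> g) \<cdot> f = h \<cdot> (g \<cdot> f)"
  using comp_assoc[of f "src A f" "tgt A f" g "tgt A g" h "tgt A h"] assms by (auto simp: Hom_def)

lemma comp_idm [simp]: "f \<in> Arr A \<Longrightarrow> src A f = X \<Longrightarrow> f \<cdot> idm A X = f"
  using comp_id[of f X "tgt A f"] by (auto simp: Hom_def)

lemma idm_comp [simp]: "f \<in> Arr A \<Longrightarrow> tgt A f = X \<Longrightarrow> idm A X \<cdot> f = f"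
  using id_comp[of f "src A f" X] by (auto simp: Hom_def)

text \<open>\<open>comp_assoc_arr\<close> brackets all composites to the right, where an equation
  \<open>g \<cdot> f = h\<close> no longer matches; this is its form under a further factor
  x.\<close>

lemma reassoc:
  assumes "g \<cdot> f = h" "f \<in> Arr A" "g \<in> Arr A" "tgt A f = src A g" "x \<in> Arr A" "tgt A x = src A f"
  shows "g \<cdot> (f \<cdot> x) = h \<cdot> x"
  using comp_assoc_arr[of x f g] assms by simp

lemma hom_group_simps [simp]:
  "carrier (hom_group A X Y) = Hom A X Y" "mult (hom_group A X Y) = hadd A"
  "one (hom_group A X Y) = hzero A X Y"
  by (simp_all add: hom_group_def)

lemma hzero_arr [simp]:
  assumes "X \<in> Obj A" "Y \<in> Obj A"
  shows "hzero A X Y \<in> Arr A" "src A (hzero A X Y) = X" "tgt A (hzero A X Y) = Y"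
  using comm_groupE(2)[OF hom_comm_group[OF assms]] by (auto simp: Hom_def)

lemma hadd_arr [simp]:
  assumes "f \<in> Arr A" "g \<in> Arr A" "src A f = src A g" "tgt A f = tgt A g"
  shows "f \<boxplus> g \<in> Arr A" "src A (f \<boxplus> g) = src A g" "tgt A (f \<boxplus> g) = tgt A g"
  using comm_groupE(1)[OF hom_comm_group[of "src A g" "tgt A g"], of f g] assms
  by (auto simp: Hom_def)

lemma hadd_assoc [simp]:
  assumes "f \<in> Arr A" "g \<in> Arr A" "h \<in> Arr A" "src A f = src A g" "tgt A f = tgt A g"
    "src A g = src A h" "tgt A g = tgt A h"
  shows "(f \<boxplus> g) \<boxplus> h = f \<boxplus> (g \<boxplus> h)"
  using comm_groupE(3)[OF hom_comm_group[of "src A g" "tgt A g"], of f g h] assms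
  by (auto simp: Hom_def)

lemma hadd_comm:
  assumes "f \<in> Arr A" "g \<in> Arr A" "src A f = src A g" "tgt A f = tgt A g"
  shows "f \<boxplus> g = g \<boxplus> f"
  using comm_groupE(4)[OF hom_comm_group[of "src A g" "tgt A g"], of f g] assms
  by (auto simp: Hom_def)

lemma hzero_hadd [simp]:
  assumes "f \<in> Arr A" "src A f = X" "tgt A f = Y"
  shows "hzero A X Y \<boxplus> f = f" "f \<boxplus> hzero A X Y = f"
proof -
  show "hzero A X Y \<boxplus> f = f"
    using comm_groupE(5)[OF hom_comm_group[of X Y], of f] assms by (auto simp: Hom_def)
  then show "f \<boxplus> hzero A X Y = f"
    using hadd_comm[of f "hzero A X Y"] assms by auto
qed

lemma neg_arr [simp]:
  assumes "f \<in> Arr A"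
  shows "neg f \<in> Arr A" "src A (neg f) = src A f" "tgt A (neg f) = tgt A f"
proof -
  interpret G: comm_group "hom_group A (src A f) (tgt A f)" using assms by (simp add: hom_comm_group)
  have "neg f \<in> Hom A (src A f) (tgt A f)" using G.inv_closed[of f] assms by (simp add: neg_def Hom_def)
  then show "neg f \<in> Arr A" "src A (neg f) = src A f" "tgt A (neg f) = tgt A f" by (auto simp: Hom_def)
qed

lemma neg_hadd [simp]:
  assumes "f \<in> Arr A"
  shows "neg f \<boxplus> f = hzero A (src A f) (tgt A f)" "f \<boxplus> neg f = hzero A (src A f) (tgt A f)"
proof -
  interpret G: comm_group "hom_group A (src A f) (tgt A f)" using assms by (simp add: hom_comm_group)
  show "neg f \<boxplus> f = hzero A (src A f) (tgt A f)" "f \<boxplus> neg f = hzero A (src A f) (tgt A f)"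
    using G.l_inv[of f] G.r_inv[of f] assms by (simp_all add: neg_def Hom_def)
qed

lemma hadd_eq_zero:
  assumes "f \<in> Arr A" "g \<in> Arr A" "src A f = src A g" "tgt A f = tgt A g"
  shows "f \<boxplus> neg g = hzero A (src A g) (tgt A g) \<longleftrightarrow> f = g"
proof
  assume *: "f \<boxplus> neg g = hzero A (src A g) (tgt A g)"
  have "f = f \<boxplus> (neg g \<boxplus> g)" using assms by simp
  also have "\<dots> = (f \<boxplus> neg g) \<boxplus> g" using assms by (intro hadd_assoc[symmetric]) auto
  also have "\<dots> = g" using * assms by simp
  finally show "f = g" .
qed (use assms in simp)

lemma hadd_cancel:
  assumes "f \<boxplus> g = f" "f \<in> Arr A" "g \<in> Arr A" "src A f = src A g" "tgt A f = tgt A g"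
  shows "g = hzero A (src A f) (tgt A f)"
proof -
  have "g = (neg f \<boxplus> f) \<boxplus> g" using assms(2-) by simp
  also have "\<dots> = neg f \<boxplus> (f \<boxplus> g)" using assms(2-) by (intro hadd_assoc) auto
  finally show ?thesis using assms by simp
qed

lemma comp_hadd [simp]:
  assumes "f \<in> Arr A" "f' \<in> Arr A" "g \<in> Arr A" "src A f = src A f'" "tgt A f = tgt A f'"
    "tgt A f' = src A g"
  shows "g \<cdot> (f \<boxplus> f') = (g \<cdot> f) \<boxplus> (g \<cdot> f')"
  using comp_add_right[of f "src A f'" "tgt A f'" f' g "tgt A g"] assms by (auto simp: Hom_def)

lemma hadd_comp [simp]:
  assumes "f \<in> Arr A" "g \<in> Arr A" "g' \<in> Arr A" "src A g = src A g'" "tgt A g = tgt A g'"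
    "tgt A f = src A g'"
  shows "(g \<boxplus> g') \<cdot> f = (g \<cdot> f) \<boxplus> (g' \<cdot> f)"
  using comp_add_left[of f "src A f" "tgt A f" g "tgt A g'" g'] assms by (auto simp: Hom_def)

lemma comp_hzero [simp]:
  assumes "g \<in> Arr A" "Y = src A g" "X \<in> Obj A"
  shows "g \<cdot> hzero A X Y = hzero A X (tgt A g)"
proof -
  let ?z = "hzero A X Y"
  have "g \<cdot> ?z = g \<cdot> (?z \<boxplus> ?z)" using assms by simp
  also have "\<dots> = (g \<cdot> ?z) \<boxplus> (g \<cdot> ?z)" using assms by (intro comp_hadd) auto
  finally show ?thesis using hadd_cancel[of "g \<cdot> ?z" "g \<cdot> ?z"] assms by auto
qed

lemma hzero_comp [simp]:
  assumes "g \<in> Arr A" "X = tgt A g" "Y \<in> Obj A"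
  shows "hzero A X Y \<cdot> g = hzero A (src A g) Y"
proof -
  let ?z = "hzero A X Y"
  have "?z \<cdot> g = (?z \<boxplus> ?z) \<cdot> g" using assms by simp
  also have "\<dots> = (?z \<cdot> g) \<boxplus> (?z \<cdot> g)" using assms by (intro hadd_comp) auto
  finally show ?thesis using hadd_cancel[of "?z \<cdot> g" "?z \<cdot> g"] assms by auto
qed

lemma neg_unique:
  assumes "f \<boxplus> g = hzero A (src A g) (tgt A g)" "f \<in> Arr A" "g \<in> Arr A" "src A f = src A g" "tgt A f = tgt A g"
  shows "f = neg g"
proof -
  have "f = f \<boxplus> (g \<boxplus> neg g)" using assms(2-) by simp
  also have "\<dots> = (f \<boxplus> g) \<boxplus> neg g" using assms(2-) by (intro hadd_assoc[symmetric]) auto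
  also have "\<dots> = neg g" using assms by simp
  finally show ?thesis .
qed

lemma neg_hzero [simp]:
  "X \<in> Obj A \<Longrightarrow> Y \<in> Obj A \<Longrightarrow> neg (hzero A X Y) = hzero A X Y"
  using neg_unique[of "hzero A X Y" "hzero A X Y"] by simp

lemma neg_neg [simp]: "f \<in> Arr A \<Longrightarrow> neg (neg f) = f"
  by (rule neg_unique[symmetric]) simp_all

lemma comp_neg [simp]:
  assumes "f \<in> Arr A" "g \<in> Arr A" "tgt A f = src A g"
  shows "g \<cdot> neg f = neg (g \<cdot> f)" "neg g \<cdot> f = neg (g \<cdot> f)"
proof -
  have "(g \<cdot> neg f) \<boxplus> (g \<cdot> f) = g \<cdot> (neg f \<boxplus> f)" using assms by (intro comp_hadd[symmetric]) auto
  then show "g \<cdot> neg f = neg (g \<cdot> f)" using assms by (intro neg_unique) auto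
  have "(neg g \<cdot> f) \<boxplus> (g \<cdot> f) = (neg g \<boxplus> g) \<cdot> f" using assms by (intro hadd_comp[symmetric]) auto
  then show "neg g \<cdot> f = neg (g \<cdot> f)" using assms by (intro neg_unique) auto
qed

end

section \<open>The opposite category\<close>

definition op_cat :: "('o, 'm) additive_data \<Rightarrow> ('o, 'm) additive_data" where
  "op_cat A = \<lparr>Obj = Obj A, Arr = Arr A, src = tgt A, tgt = src A, idm = idm A,
     comp = (\<lambda>g f. f \<cdot>\<^bsub>A\<^esub> g), hzero = (\<lambda>X Y. hzero A Y X), hadd = hadd A\<rparr>"

lemma op_simps [simp]:
  "Obj (op_cat A) = Obj A" "Arr (op_cat A) = Arr A" "src (op_cat A) = tgt A"
  "tgt (op_cat A) = src A" "idm (op_cat A) = idm A" "g \<cdot>\<^bsub>op_cat A\<^esub> f = f \<cdot>\<^bsub>A\<^esub> g"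
  "hzero (op_cat A) X Y = hzero A Y X" "hadd (op_cat A) = hadd A"
  by (simp_all add: op_cat_def)

text \<open>Duality is involutive on the nose, so a lemma can be applied in \<open>op_cat A\<close>
  and read back by simplification, and one implication of a duality statement yields the
  other.\<close>

lemma op_op [simp]: "op_cat (op_cat A) = A"
  by (cases A) (simp add: op_cat_def)

lemma op_Hom [simp]: "Hom (op_cat A) X Y = Hom A Y X"
  by (auto simp: Hom_def)

lemma op_kernel [simp]: "is_kernel (op_cat A) k f = is_cokernel A k f"
  by (auto simp: is_kernel_def is_cokernel_def)

lemma op_cokernel [simp]: "is_cokernel (op_cat A) k f = is_kernel A k f"
  by (auto simp: is_kernel_def is_cokernel_def)

lemma op_mono [simp]: "is_mono (op_cat A) f = is_epi A f"
  by (auto simp: is_mono_def is_epi_def)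

lemma op_epi [simp]: "is_epi (op_cat A) f = is_mono A f"
  by (auto simp: is_mono_def is_epi_def)

lemma op_zero_object [simp]: "is_zero_object (op_cat A) Z = is_zero_object A Z"
  by (simp add: is_zero_object_def conj_commute)

lemma op_biproduct [simp]: "is_biproduct (op_cat A) X Y S i j p q = is_biproduct A X Y S p q i j"
  by (auto simp: is_biproduct_def)

lemma op_short_exact [simp]: "short_exact (op_cat A) p i = short_exact A i p"
  by (auto simp: short_exact_def)

lemma kernel_tgt: "is_kernel A k f \<Longrightarrow> tgt A k = src A f"
  by (simp add: is_kernel_def)

lemma op_conflation [simp]: "conflation (op_cat A) C p i = conflation A C i p"
  using kernel_tgt[of A i p] by (auto simp: conflation_def short_exact_def)

lemma op_pushout [simp]: "is_pushout (op_cat A) p h h' p' = is_pullback A p h h' p'"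
  by (auto simp: is_pullback_def is_pushout_def)

lemma op_hom_group [simp]: "hom_group (op_cat A) X Y = hom_group A Y X"
  by (simp add: hom_group_def)

lemma (in abelian_category) op_abelian: "abelian_category (op_cat A)"
proof (rule abelian_category.intro)
  fix f assume "f \<in> Arr (op_cat A)"
  then show "\<exists>k. is_kernel (op_cat A) k f" "\<exists>k. is_cokernel (op_cat A) k f"
    using ex_kernel ex_cokernel by auto
next
  fix X Y assume "X \<in> Obj (op_cat A)" "Y \<in> Obj (op_cat A)"
  then show "\<exists>S i j p q. is_biproduct (op_cat A) X Y S i j p q"
    using ex_biproduct[of X Y] by (simp) blast
next
  fix X Y assume "X \<in> Obj (op_cat A)" "Y \<in> Obj (op_cat A)"
  then show "comm_group (hom_group (op_cat A) X Y)" using hom_comm_group[of Y X] by simp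
next
  show "\<exists>Z. is_zero_object (op_cat A) Z" using ex_zero_object by simp
qed (use mono_normal epi_normal in \<open>auto simp: Hom_def\<close>)

lemma (in extension_closed_subcategory) op_ext_closed: "extension_closed_subcategory (op_cat A) C"
proof -
  interpret O: abelian_category "op_cat A" by (rule op_abelian)
  show ?thesis
  proof
    fix X Y assume "X \<in> C" "Y \<in> C"
    then show "\<exists>S\<in>C. \<exists>i j p q. is_biproduct (op_cat A) X Y S i j p q"
      using biproduct_in_sub[of X Y] by simp blast
  next
    fix i p assume "short_exact (op_cat A) i p" "src (op_cat A) i \<in> C" "tgt (op_cat A) p \<in> C"
    then show "tgt (op_cat A) i \<in> C"
      using extension_in_sub[of p i] kernel_tgt[of A p i] by (auto simp: short_exact_def)
  next
    show "\<exists>Z\<in>C. is_zero_object (op_cat A) Z" using zero_in_sub by simp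
  qed (use sub_Obj in simp)
qed

section \<open>Short exact sequences, biproducts, push-outs and the 3x3 lemma in an abelian
  category\<close>

section \<open>Kernels, cokernels, short exact sequences\<close>

context abelian_category
begin

lemma monoE: "is_mono A f \<Longrightarrow> f \<in> Arr A" by (simp add: is_mono_def)

lemma mono_cancel:
  assumes "is_mono A f" "u \<in> Arr A" "v \<in> Arr A" "src A u = src A v" "tgt A u = src A f"
    "tgt A v = src A f" "f \<cdot> u = f \<cdot> v"
  shows "u = v"
proof -
  have "src A v \<in> Obj A" using assms by simp
  then show ?thesis using assms unfolding is_mono_def by (metis HomI)
qed

lemma mono_zero:
  assumes "is_mono A f" "u \<in> Arr A" "tgt A u = src A f" "f \<cdot> u = hzero A (src A u) (tgt A f)"
  shows "u = hzero A (src A u) (src A f)"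
  using mono_cancel[OF assms(1), of u "hzero A (src A u) (src A f)"] assms monoE[OF assms(1)] by simp

text \<open>Two arrows with equal composites differ by an arrow that f annihilates, so a zero test
  is enough.\<close>

lemma monoI:
  assumes f: "f \<in> Arr A"
    and "\<And>u. u \<in> Arr A \<Longrightarrow> tgt A u = src A f \<Longrightarrow> f \<cdot> u = hzero A (src A u) (tgt A f) \<Longrightarrow>
      u = hzero A (src A u) (src A f)"
  shows "is_mono A f"
  unfolding is_mono_def
proof (intro conjI ballI impI)
  fix W u v assume "W \<in> Obj A" and u: "u \<in> Hom A W (src A f)" and v: "v \<in> Hom A W (src A f)"
    and eq: "f \<cdot> u = f \<cdot> v"
  note uv = HomD[OF u] HomD[OF v]
  have "f \<cdot> (u \<boxplus> neg v) = (f \<cdot> v) \<boxplus> neg (f \<cdot> v)" using uv f eq by simp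
  also have "\<dots> = hzero A W (tgt A f)" using uv f by simp
  finally have "u \<boxplus> neg v = hzero A W (src A f)" using assms(2)[of "u \<boxplus> neg v"] uv f by simp
  then show "u = v" using hadd_eq_zero[of u v] uv f by simp
qed (fact f)

lemma epi_cancel:
  assumes "is_epi A f" "u \<in> Arr A" "v \<in> Arr A" "tgt A u = tgt A v" "src A u = tgt A f"
    "src A v = tgt A f" "u \<cdot> f = v \<cdot> f"
  shows "u = v"
  using abelian_category.mono_cancel[OF op_abelian, of f u v] assms by simp

lemma epi_zero:
  assumes "is_epi A f" "u \<in> Arr A" "src A u = tgt A f" "u \<cdot> f = hzero A (src A f) (tgt A u)"
  shows "u = hzero A (tgt A f) (tgt A u)"
  using abelian_category.mono_zero[OF op_abelian, of f u] assms by simp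

lemma epiI:
  assumes "f \<in> Arr A"
    and "\<And>u. u \<in> Arr A \<Longrightarrow> src A u = tgt A f \<Longrightarrow> u \<cdot> f = hzero A (src A f) (tgt A u) \<Longrightarrow>
      u = hzero A (tgt A f) (tgt A u)"
  shows "is_epi A f"
  using abelian_category.monoI[OF op_abelian, of f] assms by simp

lemma kernelD:
  assumes "is_kernel A k f"
  shows "k \<in> Arr A" "f \<in> Arr A" "tgt A k = src A f" "f \<cdot> k = hzero A (src A k) (tgt A f)"
  using assms by (simp_all add: is_kernel_def)

lemma kernel_lift:
  assumes "is_kernel A k f" "h \<in> Arr A" "tgt A h = src A f" "f \<cdot> h = hzero A (src A h) (tgt A f)"
  obtains u where "u \<in> Arr A" "src A u = src A h" "tgt A u = src A k" "k \<cdot> u = h"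
  using assms unfolding is_kernel_def Hom_def by blast

lemma kernel_mono:
  assumes "is_kernel A k f" shows "is_mono A k"
  unfolding is_mono_def
proof (intro conjI ballI impI)
  note k = kernelD[OF assms]
  show "k \<in> Arr A" by fact
  fix W u v assume u: "u \<in> Hom A W (src A k)" and v: "v \<in> Hom A W (src A k)" and eq: "k \<cdot> u = k \<cdot> v"
  note uv = HomD[OF u] HomD[OF v]
  have "f \<cdot> (k \<cdot> u) = hzero A W (tgt A f)" using uv k reassoc[OF k(4), of u] by simp
  then have "\<exists>!w. w \<in> Hom A (src A (k \<cdot> u)) (src A k) \<and> k \<cdot> w = k \<cdot> u"
    using assms uv k unfolding is_kernel_def by (metis comp_arr)
  then show "u = v" using u v eq uv k by (metis comp_arr(2))
qed

lemma kernelI: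
  assumes k: "is_mono A k" and f: "f \<in> Arr A" "tgt A k = src A f" "f \<cdot> k = hzero A (src A k) (tgt A f)"
    and lift: "\<And>h. h \<in> Arr A \<Longrightarrow> tgt A h = src A f \<Longrightarrow> f \<cdot> h = hzero A (src A h) (tgt A f) \<Longrightarrow>
      \<exists>u\<in>Arr A. src A u = src A h \<and> tgt A u = src A k \<and> k \<cdot> u = h"
  shows "is_kernel A k f"
  unfolding is_kernel_def
proof (intro conjI ballI impI)
  fix h assume "h \<in> Arr A" "tgt A h = src A f \<and> f \<cdot> h = hzero A (src A h) (tgt A f)"
  then obtain u where u: "u \<in> Arr A" "src A u = src A h" "tgt A u = src A k" "k \<cdot> u = h"
    using lift by blast
  show "\<exists>!u. u \<in> Hom A (src A h) (src A k) \<and> k \<cdot> u = h"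
  proof (rule ex1I[of _ u])
    fix v assume "v \<in> Hom A (src A h) (src A k) \<and> k \<cdot> v = h"
    then show "v = u" using mono_cancel[OF k, of v u] u by (auto simp: Hom_def)
  qed (use u in \<open>auto simp: Hom_def\<close>)
qed (use assms monoE[OF k] in auto)

lemma cokernelD:
  assumes "is_cokernel A c f"
  shows "c \<in> Arr A" "f \<in> Arr A" "src A c = tgt A f" "c \<cdot> f = hzero A (src A f) (tgt A c)"
  using assms by (simp_all add: is_cokernel_def)

lemma cokernel_ext:
  assumes "is_cokernel A c f" "h \<in> Arr A" "src A h = tgt A f" "h \<cdot> f = hzero A (src A f) (tgt A h)"
  obtains u where "u \<in> Arr A" "src A u = tgt A c" "tgt A u = tgt A h" "u \<cdot> c = h"
  using abelian_category.kernel_lift[OF op_abelian, of c f h] assms by auto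

lemma cokernel_epi: "is_cokernel A c f \<Longrightarrow> is_epi A c"
  using abelian_category.kernel_mono[OF op_abelian, of c f] by simp

lemma cokernelI:
  assumes "is_epi A c" "f \<in> Arr A" "src A c = tgt A f" "c \<cdot> f = hzero A (src A f) (tgt A c)"
    and "\<And>h. h \<in> Arr A \<Longrightarrow> src A h = tgt A f \<Longrightarrow> h \<cdot> f = hzero A (src A f) (tgt A h) \<Longrightarrow>
      \<exists>u\<in>Arr A. src A u = tgt A c \<and> tgt A u = tgt A h \<and> u \<cdot> c = h"
  shows "is_cokernel A c f"
  using abelian_category.kernelI[OF op_abelian, of c f] assms(1-4) assms(5)
  by (simp add: conj_commute conj_left_commute)

text \<open>The mono i is a kernel of some g. As g factors through the cokernel p, everything killed
  by p is killed by g and lifts to i.\<close>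

lemma mono_kernel_of_cokernel:
  assumes "is_mono A i" "is_cokernel A p i"
  shows "is_kernel A i p"
proof (rule kernelI)
  note p = cokernelD[OF assms(2)]
  show "is_mono A i" "p \<in> Arr A" "tgt A i = src A p" "p \<cdot> i = hzero A (src A i) (tgt A p)"
    using assms p by auto
  fix h assume h: "h \<in> Arr A" "tgt A h = src A p" "p \<cdot> h = hzero A (src A h) (tgt A p)"
  obtain g where g: "is_kernel A i g" using mono_normal assms by blast
  note gD = kernelD[OF g]
  obtain u where u: "u \<in> Arr A" "src A u = tgt A p" "tgt A u = tgt A g" "u \<cdot> p = g"
    using cokernel_ext[OF assms(2), of g] gD by auto
  have "g \<cdot> h = u \<cdot> (p \<cdot> h)" using reassoc[OF u(4), of h] u h p by simp
  also have "\<dots> = hzero A (src A h) (tgt A g)" using h u by simp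
  finally obtain w where "w \<in> Arr A" "src A w = src A h" "tgt A w = src A i" "i \<cdot> w = h"
    using kernel_lift[OF g, of h] h p gD by auto
  then show "\<exists>u\<in>Arr A. src A u = src A h \<and> tgt A u = src A i \<and> i \<cdot> u = h" by blast
qed

lemma epi_cokernel_of_kernel: "is_epi A p \<Longrightarrow> is_kernel A i p \<Longrightarrow> is_cokernel A p i"
  using abelian_category.mono_kernel_of_cokernel[OF op_abelian, of p i] by simp

lemma short_exactD:
  assumes "short_exact A i p"
  shows "i \<in> Arr A" "p \<in> Arr A" "tgt A i = src A p" "p \<cdot> i = hzero A (src A i) (tgt A p)"
    "is_mono A i" "is_epi A p" "is_kernel A i p" "is_cokernel A p i"
  using assms kernelD[of i p] kernel_mono cokernel_epi by (auto simp: short_exact_def)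

lemma short_exact_lift:
  assumes "short_exact A i p" "h \<in> Arr A" "tgt A h = src A p" "p \<cdot> h = hzero A (src A h) (tgt A p)"
  obtains u where "u \<in> Arr A" "src A u = src A h" "tgt A u = src A i" "i \<cdot> u = h"
  using kernel_lift assms short_exactD(7) by metis

lemma short_exact_ext:
  assumes "short_exact A i p" "h \<in> Arr A" "src A h = tgt A i" "h \<cdot> i = hzero A (src A i) (tgt A h)"
  obtains u where "u \<in> Arr A" "src A u = tgt A p" "tgt A u = tgt A h" "u \<cdot> p = h"
  using cokernel_ext assms short_exactD(8) by metis

lemma short_exactI1: "is_mono A i \<Longrightarrow> is_cokernel A p i \<Longrightarrow> short_exact A i p"
  using mono_kernel_of_cokernel by (simp add: short_exact_def)

lemma short_exactI2: "is_epi A p \<Longrightarrow> is_kernel A i p \<Longrightarrow> short_exact A i p"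
  using epi_cokernel_of_kernel by (simp add: short_exact_def)

lemma epi_factor: 
  assumes "is_epi A (p \<cdot> g)" "p \<in> Arr A" "g \<in> Arr A" "tgt A g = src A p"
  shows "is_epi A p"
proof (rule epiI)
  fix u assume u: "u \<in> Arr A" "src A u = tgt A p" "u \<cdot> p = hzero A (src A p) (tgt A u)"
  have "u \<cdot> (p \<cdot> g) = hzero A (src A (p \<cdot> g)) (tgt A u)" using reassoc[OF u(3), of g] u assms by simp
  then show "u = hzero A (tgt A p) (tgt A u)" using epi_zero[OF assms(1), of u] u assms by simp
qed fact

lemma mono_factor: 
  assumes "is_mono A (g \<cdot> i)" "i \<in> Arr A" "g \<in> Arr A" "tgt A i = src A g"
  shows "is_mono A i"
  using abelian_category.epi_factor[OF op_abelian, of i g] assms by simp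

lemma mono_comp:
  assumes "is_mono A i" "is_mono A j" "tgt A i = src A j"
  shows "is_mono A (j \<cdot> i)"
proof (rule monoI)
  note ij = monoE[OF assms(1)] monoE[OF assms(2)]
  show "j \<cdot> i \<in> Arr A" using ij assms by simp
  fix u assume u: "u \<in> Arr A" "tgt A u = src A (j \<cdot> i)" "j \<cdot> i \<cdot> u = hzero A (src A u) (tgt A (j \<cdot> i))"
  then have "i \<cdot> u = hzero A (src A u) (tgt A i)" using mono_zero[OF assms(2), of "i \<cdot> u"] ij assms by simp
  then show "u = hzero A (src A u) (src A (j \<cdot> i))" using mono_zero[OF assms(1), of "u"] ij assms u by simp
qed

lemma epi_comp:
  assumes "is_epi A i" "is_epi A j" "tgt A i = src A j"
  shows "is_epi A (j \<cdot> i)"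
  using abelian_category.mono_comp[OF op_abelian, of j i] assms by simp

lemma idm_mono: "X \<in> Obj A \<Longrightarrow> is_mono A (idm A X)"
  by (auto intro!: monoI)

lemma idm_epi: "X \<in> Obj A \<Longrightarrow> is_epi A (idm A X)"
  by (auto intro!: epiI)

text \<open>A mono t is a kernel of some f, and f vanishes because t is epi; hence the identity
  lifts along t.\<close>

lemma mono_epi_iso:
  assumes "is_mono A t" "is_epi A t"
  obtains s where "s \<in> Arr A" "src A s = tgt A t" "tgt A s = src A t" "t \<cdot> s = idm A (tgt A t)"
    "s \<cdot> t = idm A (src A t)"
proof -
  note t = monoE[OF assms(1)]
  obtain f where f: "is_kernel A t f" using mono_normal assms by blast
  note fD = kernelD[OF f]
  have "f = hzero A (tgt A t) (tgt A f)" using epi_zero[OF assms(2), of f] fD by simp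
  then have "f \<cdot> idm A (tgt A t) = hzero A (tgt A t) (tgt A f)" using fD by simp
  then obtain s where s: "s \<in> Arr A" "src A s = tgt A t" "tgt A s = src A t" "t \<cdot> s = idm A (tgt A t)"
    using kernel_lift[OF f, of "idm A (tgt A t)"] fD t by auto
  have "t \<cdot> (s \<cdot> t) = t \<cdot> idm A (src A t)" using reassoc[OF s(4), of t] s t by simp
  then have "s \<cdot> t = idm A (src A t)" using mono_cancel[OF assms(1), of "s \<cdot> t" "idm A (src A t)"] s t by simp
  with s show ?thesis using that by blast
qed

text \<open>The idempotent 1 - ir kills i and descends along p; what it descends to is the section.
  Splittings are later moved forward along morphisms as sections and backward as
  retractions.\<close>

lemma retraction_section:
  assumes "short_exact A i p" "r \<in> Arr A" "src A r = tgt A i" "tgt A r = src A i" "r \<cdot> i = idm A (src A i)"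
  obtains s where "s \<in> Arr A" "src A s = tgt A p" "tgt A s = src A p" "p \<cdot> s = idm A (tgt A p)"
    "s \<cdot> p = idm A (tgt A i) \<boxplus> neg (i \<cdot> r)"
proof -
  note ip = short_exactD[OF assms(1)]
  let ?e = "idm A (tgt A i) \<boxplus> neg (i \<cdot> r)"
  have e: "?e \<in> Arr A" "src A ?e = tgt A i" "tgt A ?e = tgt A i" using assms ip by auto
  have "?e \<cdot> i = hzero A (src A i) (tgt A i)" using assms ip by simp
  then obtain s where s: "s \<in> Arr A" "src A s = tgt A p" "tgt A s = src A p" "s \<cdot> p = ?e"
    using short_exact_ext[OF assms(1), of ?e] e ip by auto
  have "(p \<cdot> s) \<cdot> p = p \<cdot> ?e" using s ip by simp
  also have "\<dots> = p" using assms(2-) ip reassoc[OF ip(4), of r] by simp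
  finally have "p \<cdot> s = idm A (tgt A p)" using epi_cancel[OF ip(6), of "p \<cdot> s" "idm A (tgt A p)"] s ip by simp
  with s show ?thesis using that by blast
qed

lemma section_retraction:
  assumes "short_exact A i p" "s \<in> Arr A" "src A s = tgt A p" "tgt A s = src A p" "p \<cdot> s = idm A (tgt A p)"
  obtains r where "r \<in> Arr A" "src A r = tgt A i" "tgt A r = src A i" "r \<cdot> i = idm A (src A i)"
  using abelian_category.retraction_section[OF op_abelian, of p i s] assms short_exactD(3)[OF assms(1)]
  by simp metis

subsection \<open>Biproducts\<close>

lemma biproductD:
  assumes "is_biproduct A X Y S i j p q"
  shows "S \<in> Obj A" "X \<in> Obj A" "Y \<in> Obj A"
    "i \<in> Arr A" "src A i = X" "tgt A i = S" "j \<in> Arr A" "src A j = Y" "tgt A j = S"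
    "p \<in> Arr A" "src A p = S" "tgt A p = X" "q \<in> Arr A" "src A q = S" "tgt A q = Y"
    "p \<cdot> i = idm A X" "q \<cdot> j = idm A Y" "q \<cdot> i = hzero A X Y" "p \<cdot> j = hzero A Y X"
    "(i \<cdot> p) \<boxplus> (j \<cdot> q) = idm A S"
  using assms arr_obj[of p] arr_obj[of q] by (auto simp: is_biproduct_def Hom_def)

lemma biproduct_split:
  assumes "is_biproduct A X Y S i j p q" "x \<in> Arr A" "tgt A x = S"
  shows "x = (i \<cdot> (p \<cdot> x)) \<boxplus> (j \<cdot> (q \<cdot> x))"
proof -
  note b = biproductD[OF assms(1)]
  have "x = ((i \<cdot> p) \<boxplus> (j \<cdot> q)) \<cdot> x" using b assms(2,3) by simp
  also have "\<dots> = (i \<cdot> (p \<cdot> x)) \<boxplus> (j \<cdot> (q \<cdot> x))" using b(1-19) assms(2,3) by simp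
  finally show ?thesis .
qed

lemma biproduct_split':
  assumes "is_biproduct A X Y S i j p q" "x \<in> Arr A" "src A x = S"
  shows "x = (x \<cdot> i \<cdot> p) \<boxplus> (x \<cdot> j \<cdot> q)"
  using abelian_category.biproduct_split[OF op_abelian, of X Y S p q i j x] assms
    biproductD[OF assms(1)] by simp

lemma biproduct_eqI:
  assumes "is_biproduct A X Y S i j p q" "x \<in> Arr A" "y \<in> Arr A" "tgt A x = S" "tgt A y = S"
    "p \<cdot> x = p \<cdot> y" "q \<cdot> x = q \<cdot> y"
  shows "x = y"
  using biproduct_split[OF assms(1), of x] biproduct_split[OF assms(1), of y] assms by metis

lemma biproduct_eqI':
  assumes "is_biproduct A X Y S i j p q" "x \<in> Arr A" "y \<in> Arr A" "src A x = S" "src A y = S"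
    "x \<cdot> i = y \<cdot> i" "x \<cdot> j = y \<cdot> j"
  shows "x = y"
  using biproduct_split'[OF assms(1), of x] biproduct_split'[OF assms(1), of y] assms by metis

lemma biproduct_short_exact:
  assumes "is_biproduct A X Y S i j p q"
  shows "short_exact A i q"
proof (rule short_exactI2)
  note b = biproductD[OF assms]
  show "is_epi A q" using epi_factor[of q j] idm_epi b by simp
  show "is_kernel A i q"
  proof (rule kernelI)
    show "is_mono A i" using mono_factor[of p i] idm_mono b by simp
    fix h assume h: "h \<in> Arr A" "tgt A h = src A q" "q \<cdot> h = hzero A (src A h) (tgt A q)"
    then have "i \<cdot> (p \<cdot> h) = h" using biproduct_split[OF assms, of h] b(1-19) by simp
    then show "\<exists>u\<in>Arr A. src A u = src A h \<and> tgt A u = src A i \<and> i \<cdot> u = h"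
      using h b by (intro bexI[of _ "p \<cdot> h"]) auto
  qed (use b in auto)
qed

lemma biproduct_swap:
  assumes "is_biproduct A X Y S i j p q"
  shows "is_biproduct A Y X S j i q p"
  using assms biproductD[OF assms] hadd_comm[of "i \<cdot> p" "j \<cdot> q"] by (auto simp: is_biproduct_def)

end

section \<open>Push-outs and pull-backs of short exact sequences\<close>

context abelian_category
begin

lemma pushoutD:
  assumes "is_pushout A i g g' i'"
  shows "i \<in> Arr A" "g \<in> Arr A" "src A i = src A g" "g' \<in> Arr A" "src A g' = tgt A i"
    "tgt A g' = tgt A i'" "i' \<in> Arr A" "src A i' = tgt A g" "g' \<cdot> i = i' \<cdot> g"
  using assms by (simp_all add: is_pushout_def Hom_def)

lemma pushout_ext:
  assumes "is_pushout A i g g' i'" "x \<in> Arr A" "y \<in> Arr A" "src A x = tgt A i" "src A y = tgt A g"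
    "tgt A x = tgt A y" "x \<cdot> i = y \<cdot> g"
  obtains w where "w \<in> Arr A" "src A w = tgt A i'" "tgt A w = tgt A y" "w \<cdot> g' = x" "w \<cdot> i' = y"
proof -
  have "x \<in> Hom A (tgt A i) (tgt A y)" "y \<in> Hom A (tgt A g) (tgt A y)" using assms by (auto simp: Hom_def)
  then have "\<exists>w. w \<in> Hom A (tgt A i') (tgt A y) \<and> w \<cdot> g' = x \<and> w \<cdot> i' = y"
    using assms(1,7) unfolding is_pushout_def by blast
  then show ?thesis using that by (auto simp: Hom_def)
qed

lemma pushout_unique:
  assumes po: "is_pushout A i g g' i'" and "w \<in> Arr A" "w' \<in> Arr A" "src A w = tgt A i'"
    "src A w' = tgt A i'" "tgt A w = tgt A w'" "w \<cdot> g' = w' \<cdot> g'" "w \<cdot> i' = w' \<cdot> i'"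
  shows "w = w'"
proof -
  note p = pushoutD[OF po]
  have "w \<cdot> g' \<in> Hom A (tgt A i) (tgt A w)" "w \<cdot> i' \<in> Hom A (tgt A g) (tgt A w)"
    "(w \<cdot> g') \<cdot> i = (w \<cdot> i') \<cdot> g"
    using assms(2-) p by (auto simp: Hom_def)
  then have "\<exists>!v. v \<in> Hom A (tgt A i') (tgt A w) \<and> v \<cdot> g' = w \<cdot> g' \<and> v \<cdot> i' = w \<cdot> i'"
    using po unfolding is_pushout_def by blast
  moreover have "w \<in> Hom A (tgt A i') (tgt A w)" "w' \<in> Hom A (tgt A i') (tgt A w)"
    using assms by (auto simp: Hom_def)
  ultimately show ?thesis using assms by metis
qed

lemma pushoutI:
  assumes "i \<in> Arr A" "g \<in> Arr A" "src A i = src A g" "g' \<in> Arr A" "src A g' = tgt A i"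
    "tgt A g' = tgt A i'" "i' \<in> Arr A" "src A i' = tgt A g" "g' \<cdot> i = i' \<cdot> g"
    and ex: "\<And>x y. x \<in> Arr A \<Longrightarrow> y \<in> Arr A \<Longrightarrow> src A x = tgt A i \<Longrightarrow> src A y = tgt A g \<Longrightarrow>
      tgt A x = tgt A y \<Longrightarrow> x \<cdot> i = y \<cdot> g \<Longrightarrow>
      \<exists>w\<in>Arr A. src A w = tgt A i' \<and> tgt A w = tgt A y \<and> w \<cdot> g' = x \<and> w \<cdot> i' = y"
    and un: "\<And>w w'. w \<in> Arr A \<Longrightarrow> w' \<in> Arr A \<Longrightarrow> src A w = tgt A i' \<Longrightarrow> src A w' = tgt A i' \<Longrightarrow>
      tgt A w = tgt A w' \<Longrightarrow> w \<cdot> g' = w' \<cdot> g' \<Longrightarrow> w \<cdot> i' = w' \<cdot> i' \<Longrightarrow> w = w'"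
  shows "is_pushout A i g g' i'"
  unfolding is_pushout_def
proof (intro conjI allI ballI impI)
  fix W x y assume x: "x \<in> Hom A (tgt A i) W" and y: "y \<in> Hom A (tgt A g) W" and eq: "x \<cdot> i = y \<cdot> g"
  note xy = HomD[OF x] HomD[OF y]
  obtain w where w: "w \<in> Arr A" "src A w = tgt A i'" "tgt A w = W" "w \<cdot> g' = x" "w \<cdot> i' = y"
    using ex[of x y] xy eq by auto
  show "\<exists>!w. w \<in> Hom A (tgt A i') W \<and> w \<cdot> g' = x \<and> w \<cdot> i' = y"
  proof (rule ex1I[of _ w])
    fix v assume "v \<in> Hom A (tgt A i') W \<and> v \<cdot> g' = x \<and> v \<cdot> i' = y"
    then show "v = w" using un[of v w] w by (auto simp: Hom_def)
  qed (use w in \<open>auto simp: Hom_def\<close>)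
qed (use assms(1-9) in \<open>auto simp: Hom_def\<close>)

text \<open>The push-out is realised as the cokernel of the map (i, -g) into the biproduct; the last
  exact sequence records this for the Mayer-Vietoris conflation. The biproduct is an argument
  because the chosen biproducts of the opposite category are unrelated to those of A.\<close>

lemma pushout_short_exact:
  assumes se: "short_exact A i p" and g: "g \<in> Arr A" "src A g = src A i"
    and bp: "is_biproduct A (tgt A i) (tgt A g) S j1 j2 q1 q2"
  obtains i' p' g' where "short_exact A i' p'" "is_pushout A i g g' i'" "p' \<cdot> g' = p" "tgt A p' = tgt A p"
    "short_exact A ((j1 \<cdot> i) \<boxplus> neg (j2 \<cdot> g)) ((g' \<cdot> q1) \<boxplus> (i' \<cdot> q2))"
proof -
  note ip = short_exactD[OF se]
  note b = biproductD[OF bp]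
  define m where "m = (j1 \<cdot> i) \<boxplus> neg (j2 \<cdot> g)"
  have m: "m \<in> Arr A" "src A m = src A i" "tgt A m = S" using ip(1-4) g b(1-19) by (auto simp: m_def)
  have q1m: "q1 \<cdot> m = i"
    using ip(1-4) g b(1-19) reassoc[OF b(16), of i] reassoc[OF b(19), of g] by (simp add: m_def)
  have q2m: "q2 \<cdot> m = neg g"
    using ip(1-4) g b(1-19) reassoc[OF b(17), of g] reassoc[OF b(18), of i] by (simp add: m_def)
  have "is_mono A m" using mono_factor[of q1 m] q1m ip(5) m b by simp
  moreover obtain c where c: "is_cokernel A c m" using ex_cokernel m by blast
  ultimately have mc: "short_exact A m c" by (rule short_exactI1)
  note cD = short_exactD[OF mc]
  define g' where "g' = c \<cdot> j1"
  define i' where "i' = c \<cdot> j2"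
  have gi': "g' \<in> Arr A" "src A g' = tgt A i" "tgt A g' = tgt A c" "i' \<in> Arr A" "src A i' = tgt A g" "tgt A i' = tgt A c"
    using cD(1-4) m b(1-19) by (auto simp: g'_def i'_def)
  have c_split: "c = (g' \<cdot> q1) \<boxplus> (i' \<cdot> q2)"
    using biproduct_split'[OF bp, of c] cD(1-4) m b(1-19) by (simp add: g'_def i'_def)
  have "c \<cdot> m = (g' \<cdot> i) \<boxplus> neg (i' \<cdot> g)"
    using cD(1-3) m b(1-19) ip(1-4) g by (simp add: g'_def i'_def m_def)
  with cD(4) have "(g' \<cdot> i) \<boxplus> neg (i' \<cdot> g) = hzero A (src A m) (tgt A c)" by simp
  then have sq: "g' \<cdot> i = i' \<cdot> g"
    using hadd_eq_zero[of "g' \<cdot> i" "i' \<cdot> g"] gi' ip(1-3) g m by simp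
  have po: "is_pushout A i g g' i'"
  proof (rule pushoutI)
    fix x y assume xy: "x \<in> Arr A" "y \<in> Arr A" "src A x = tgt A i" "src A y = tgt A g"
      "tgt A x = tgt A y" "x \<cdot> i = y \<cdot> g"
    let ?h = "(x \<cdot> q1) \<boxplus> (y \<cdot> q2)"
    have h: "?h \<in> Arr A" "src A ?h = tgt A m" "tgt A ?h = tgt A y"
      using xy(1-5) b(1-19) m by auto
    have "?h \<cdot> m = (x \<cdot> i) \<boxplus> neg (y \<cdot> g)" using xy(1-5) b(1-19) m q1m q2m g by simp
    then have "?h \<cdot> m = hzero A (src A m) (tgt A ?h)"
      using xy h m ip(1-4) g neg_hadd(2)[of "y \<cdot> g"] by simp
    then obtain w where w: "w \<in> Arr A" "src A w = tgt A c" "tgt A w = tgt A ?h" "w \<cdot> c = ?h"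
      using short_exact_ext[OF mc, of ?h] h by auto
    have "w \<cdot> g' = ?h \<cdot> j1" "w \<cdot> i' = ?h \<cdot> j2"
      using w(1-3) reassoc[OF w(4)] cD(1-4) m b(1-19) by (auto simp: g'_def i'_def)
    moreover have "?h \<cdot> j1 = x" "?h \<cdot> j2 = y"
      using xy(1-5) b(1-19) by simp_all
    ultimately show "\<exists>w\<in>Arr A. src A w = tgt A i' \<and> tgt A w = tgt A y \<and> w \<cdot> g' = x \<and> w \<cdot> i' = y"
      using w h gi' by auto
  next
    fix w w' assume w: "w \<in> Arr A" "w' \<in> Arr A" "src A w = tgt A i'" "src A w' = tgt A i'"
      "tgt A w = tgt A w'" "w \<cdot> g' = w' \<cdot> g'" "w \<cdot> i' = w' \<cdot> i'"
    have "w \<cdot> c = (w \<cdot> g' \<cdot> q1) \<boxplus> (w \<cdot> i' \<cdot> q2)"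
      by (subst c_split) (use w(1-5) gi' b(1-19) in simp)
    also have "\<dots> = (w' \<cdot> g' \<cdot> q1) \<boxplus> (w' \<cdot> i' \<cdot> q2)" by (simp only: w(6,7))
    also have "\<dots> = w' \<cdot> c" by (subst c_split) (use w(1-5) gi' b(1-19) in simp)
    finally show "w = w'" using epi_cancel[OF cD(6), of w w'] w gi' by simp
  qed (use gi' ip g sq in auto)
  obtain p' where p': "p' \<in> Arr A" "src A p' = tgt A i'" "tgt A p' = tgt A p" "p' \<cdot> g' = p"
    "p' \<cdot> i' = hzero A (tgt A g) (tgt A p)"
    using pushout_ext[OF po, of p "hzero A (tgt A g) (tgt A p)"] ip(1-4) g by auto
  have "short_exact A i' p'"
  proof (rule short_exactI1)
    show "is_mono A i'"
    proof (rule monoI)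
      fix w assume w: "w \<in> Arr A" "tgt A w = src A i'" "i' \<cdot> w = hzero A (src A w) (tgt A i')"
      \<comment> \<open>The arrow \<open>j2 \<cdot> w\<close> lifts along m to some v, and its
        vanishing first coordinate \<open>i \<cdot> v\<close> forces v = 0.\<close>
      have "c \<cdot> (j2 \<cdot> w) = hzero A (src A (j2 \<cdot> w)) (tgt A c)"
        using w gi' cD(1-4) m b(1-19) by (simp add: i'_def)
      then obtain v where v: "v \<in> Arr A" "src A v = src A (j2 \<cdot> w)" "tgt A v = src A m" "m \<cdot> v = j2 \<cdot> w"
        using short_exact_lift[OF mc, of "j2 \<cdot> w"] w gi' b(1-19) m cD(3) by auto
      have "i \<cdot> v = q1 \<cdot> (m \<cdot> v)" using reassoc[OF q1m, of v] v(1-3) m b(1-19) by simp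
      also have "\<dots> = hzero A (src A v) (tgt A i)"
        using v w gi' b(1-19) reassoc[OF b(19), of w] by simp
      finally have "v = hzero A (src A v) (src A i)" using mono_zero[OF ip(5), of v] v(1-3) m by simp
      then have "m \<cdot> v = hzero A (src A v) S" using v(1) m by (metis arr_obj(1) comp_hzero)
      then have "j2 \<cdot> w = hzero A (src A w) S" using v(2,4) w b(7-9) gi' by simp
      then have "q2 \<cdot> (j2 \<cdot> w) = hzero A (src A w) (tgt A g)" using b(1-19) w g by simp
      then show "w = hzero A (src A w) (src A i')" using reassoc[OF b(17), of w] b(1-19) w gi' by simp
    qed (use gi' in auto)
    show "is_cokernel A p' i'"
    proof (rule cokernelI)
      show "is_epi A p'" using epi_factor[of p' g'] ip(6) p' gi' by simp
      fix h assume h: "h \<in> Arr A" "src A h = tgt A i'" "h \<cdot> i' = hzero A (src A i') (tgt A h)"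
      have "(h \<cdot> g') \<cdot> i = (h \<cdot> i') \<cdot> g" using h(1,2) gi' ip(1-4) g sq by simp
      also have "\<dots> = hzero A (src A i) (tgt A h)" using h gi' g by simp
      finally obtain k where k: "k \<in> Arr A" "src A k = tgt A p" "tgt A k = tgt A h" "k \<cdot> p = h \<cdot> g'"
        using short_exact_ext[OF se, of "h \<cdot> g'"] h gi' ip(1-4) by auto
      have "k \<cdot> p' = h"
        using pushout_unique[OF po, of "k \<cdot> p'" h] k h p' gi' g ip(2) by simp
      then show "\<exists>u\<in>Arr A. src A u = tgt A p' \<and> tgt A u = tgt A h \<and> u \<cdot> p' = h"
        using k(1-3) p'(1-3) by (intro bexI[of _ k]) auto
    qed (use p' gi' in auto)
  qed
  with po p' mc c_split m_def show ?thesis using that by auto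
qed

lemma short_five:
  assumes ip: "short_exact A i p" and ip': "short_exact A i' p'"
    and t: "t \<in> Arr A" "src A t = tgt A i" "tgt A t = tgt A i'" "t \<cdot> i = i'" "p' \<cdot> t = p"
  obtains s where "s \<in> Arr A" "src A s = tgt A t" "tgt A s = src A t" "t \<cdot> s = idm A (tgt A t)"
    "s \<cdot> t = idm A (src A t)"
proof -
  note d = short_exactD[OF ip] and d' = short_exactD[OF ip']
  have "src A (t \<cdot> i) = src A i" "tgt A (p' \<cdot> t) = tgt A p'" using t(1-3) d d' by simp_all
  then have st: "src A i' = src A i" "tgt A p = tgt A p'" by (simp_all only: t(4,5))
  have "is_mono A t"
  proof (rule monoI)
    fix w assume w: "w \<in> Arr A" "tgt A w = src A t" "t \<cdot> w = hzero A (src A w) (tgt A t)"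
    have "p \<cdot> w = p' \<cdot> (t \<cdot> w)" using reassoc[OF t(5), of w] w t d' by simp
    also have "\<dots> = hzero A (src A w) (tgt A p)" using w t(1-3) d'(1-4) st by simp
    finally obtain v where v: "v \<in> Arr A" "src A v = src A w" "tgt A v = src A i" "i \<cdot> v = w"
      using short_exact_lift[OF ip, of w] w t d by auto
    have "i' \<cdot> v = t \<cdot> (i \<cdot> v)" using reassoc[OF t(4), of v] v t d by simp
    then have "i' \<cdot> v = hzero A (src A v) (tgt A i')" using v(2,4) w(3) t(3) by simp
    then have "v = hzero A (src A v) (src A i)" using mono_zero[OF d'(5), of v] v st by simp
    then show "w = hzero A (src A w) (src A t)" using v t d(1-4) by (metis comp_hzero arr_obj(1))
  qed fact
  moreover have "is_epi A t"
  proof (rule epiI)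
    fix w assume w: "w \<in> Arr A" "src A w = tgt A t" "w \<cdot> t = hzero A (src A t) (tgt A w)"
    have "w \<cdot> i' = hzero A (src A i') (tgt A w)" using reassoc[OF w(3), of i] w(1,2) t d(1-4) st by simp
    then obtain v where v: "v \<in> Arr A" "src A v = tgt A p'" "tgt A v = tgt A w" "v \<cdot> p' = w"
      using short_exact_ext[OF ip', of w] w t d' by auto
    have "v \<cdot> p = w \<cdot> t" using reassoc[OF v(4), of t] v t d' by simp
    then have "v \<cdot> p = hzero A (src A p) (tgt A v)" using v(3) w(3) t(2) d(3) by simp
    then have "v = hzero A (tgt A p) (tgt A v)" using epi_zero[OF d(6), of v] v st by simp
    then show "w = hzero A (tgt A t) (tgt A w)" using v t(3) d'(1-4) st by (metis hzero_comp arr_obj(2))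
  qed fact
  ultimately show ?thesis using mono_epi_iso that by metis
qed

lemma short_exact_iso:
  assumes "short_exact A i p" "t \<in> Arr A" "s \<in> Arr A" "tgt A t = src A i" "src A s = tgt A t" "tgt A s = src A t"
    "t \<cdot> s = idm A (tgt A t)" "s \<cdot> t = idm A (src A t)"
  shows "short_exact A (i \<cdot> t) p"
proof (rule short_exactI2)
  note d = short_exactD[OF assms(1)]
  show "is_epi A p" by fact
  have t: "is_mono A t" using mono_factor[of s t] idm_mono assms(2-) by simp
  show "is_kernel A (i \<cdot> t) p"
  proof (rule kernelI)
    show "is_mono A (i \<cdot> t)" using mono_comp t d assms by simp
    show "p \<cdot> (i \<cdot> t) = hzero A (src A (i \<cdot> t)) (tgt A p)" using reassoc[OF d(4), of t] d(1-4) assms(2-) by simp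
    fix h assume h: "h \<in> Arr A" "tgt A h = src A p" "p \<cdot> h = hzero A (src A h) (tgt A p)"
    obtain u where u: "u \<in> Arr A" "src A u = src A h" "tgt A u = src A i" "i \<cdot> u = h"
      using short_exact_lift[OF assms(1) h] by blast
    have "i \<cdot> t \<cdot> (s \<cdot> u) = h" using u d(1) assms(2-) reassoc[OF assms(7), of u] by simp
    then show "\<exists>u\<in>Arr A. src A u = src A h \<and> tgt A u = src A (i \<cdot> t) \<and> i \<cdot> t \<cdot> u = h"
      using u d(1) assms(2-) by (intro bexI[of _ "s \<cdot> u"]) auto
  qed (use d assms in auto)
qed

lemma short_exact_comp:
  assumes ip: "short_exact A i p" and jq: "short_exact A j q" and ij: "tgt A i = src A j"
  obtains r where "short_exact A (j \<cdot> i) r"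
proof -
  note d = short_exactD[OF ip] and e = short_exactD[OF jq]
  have m: "is_mono A (j \<cdot> i)" using mono_comp d e ij by simp
  moreover obtain r where "is_cokernel A r (j \<cdot> i)" using ex_cokernel monoE[OF m] by blast
  ultimately show ?thesis using short_exactI1 that by blast
qed

text \<open>The third isomorphism theorem for two successive subobjects. The square
  \<open>r \<cdot> j = k \<cdot> p\<close> is a push-out because r is a cokernel and p is epi;
  exactness of (k, s) is then carried over from \<open>pushout_short_exact\<close> by uniqueness of
  push-outs.\<close>

lemma noether:
  assumes ip: "short_exact A i p" and jq: "short_exact A j q" and ij: "tgt A i = src A j"
    and r: "short_exact A (j \<cdot> i) r"
  obtains k s where "short_exact A k s" "r \<cdot> j = k \<cdot> p" "s \<cdot> r = q" "src A k = tgt A p" "tgt A k = tgt A r" "tgt A s = tgt A q"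
    "is_pushout A j p r k"
proof -
  note d = short_exactD[OF ip] and e = short_exactD[OF jq] and f = short_exactD[OF r]
  have rD: "src A r = tgt A j" using f d e ij by simp
  have "(r \<cdot> j) \<cdot> i = hzero A (src A i) (tgt A r)" using f(2,4) rD d(1) e(1) ij by simp
  then obtain k where k: "k \<in> Arr A" "src A k = tgt A p" "tgt A k = tgt A r" "k \<cdot> p = r \<cdot> j"
    using short_exact_ext[OF ip, of "r \<cdot> j"] d(1-4) e(1) f(2) rD ij by auto
  have po: "is_pushout A j p r k"
  proof (rule pushoutI)
    fix x y assume xy: "x \<in> Arr A" "y \<in> Arr A" "src A x = tgt A j" "src A y = tgt A p"
      "tgt A x = tgt A y" "x \<cdot> j = y \<cdot> p"
    have "x \<cdot> (j \<cdot> i) = y \<cdot> (p \<cdot> i)" using reassoc[OF xy(6), of i] xy(1-5) d(1-3) e(1) ij by simp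
    also have "\<dots> = hzero A (src A (j \<cdot> i)) (tgt A x)" using xy(1-5) d(1-4) e(1) ij by simp
    finally obtain w where w: "w \<in> Arr A" "src A w = tgt A r" "tgt A w = tgt A x" "w \<cdot> r = x"
      using short_exact_ext[OF r, of x] xy d(1-4) e(1) ij by auto
    have "(w \<cdot> k) \<cdot> p = x \<cdot> j" using w k d(2) f(2) rD e(1) reassoc[OF w(4), of j] by simp
    then have "(w \<cdot> k) \<cdot> p = y \<cdot> p" using xy by simp
    then have "w \<cdot> k = y" using epi_cancel[OF d(6), of "w \<cdot> k" y] w k xy by simp
    then show "\<exists>w\<in>Arr A. src A w = tgt A k \<and> tgt A w = tgt A y \<and> w \<cdot> r = x \<and> w \<cdot> k = y"
      using w k xy by auto
  next
    fix w w' assume "w \<in> Arr A" "w' \<in> Arr A" "src A w = tgt A k" "src A w' = tgt A k"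
      "tgt A w = tgt A w'" "w \<cdot> r = w' \<cdot> r"
    then show "w = w'" using epi_cancel[OF f(6), of w w'] k by simp
  qed (use d e f k rD ij in auto)
  obtain S j1 j2 q1 q2 where bp: "is_biproduct A (tgt A j) (tgt A p) S j1 j2 q1 q2"
    using ex_biproduct[of "tgt A j" "tgt A p"] d e by auto
  obtain i' p' g' where se: "short_exact A i' p'" and po': "is_pushout A j p g' i'" and p': "p' \<cdot> g' = q" "tgt A p' = tgt A q"
    by (rule pushout_short_exact[OF jq d(2) _ bp]) (use d e ij in auto)
  note d' = short_exactD[OF se] and po'D = pushoutD[OF po']
  have kp: "r \<cdot> j = k \<cdot> p" using k by simp
  obtain w where w: "w \<in> Arr A" "src A w = tgt A k" "tgt A w = tgt A i'" "w \<cdot> r = g'" "w \<cdot> k = i'"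
    using pushout_ext[OF po, of g' i'] po'D by auto
  obtain w' where w': "w' \<in> Arr A" "src A w' = tgt A i'" "tgt A w' = tgt A k" "w' \<cdot> g' = r" "w' \<cdot> i' = k"
    using pushout_ext[OF po', of r k] kp k(1-3) f(2) rD by auto
  have ww: "w' \<cdot> w = idm A (tgt A k)"
    using pushout_unique[OF po, of "w' \<cdot> w" "idm A (tgt A k)"] w w' k f(2) rD by simp
  have ww': "w \<cdot> w' = idm A (tgt A i')"
    using pushout_unique[OF po', of "w \<cdot> w'" "idm A (tgt A i')"] w w' po'D(1-8) by simp
  have "short_exact A (w' \<cdot> i') (p' \<cdot> w)"
  proof (rule short_exactI1)
    show "is_mono A (w' \<cdot> i')"
      using mono_comp[OF d'(5), of w'] mono_factor[of w w'] idm_mono ww' w w' d' by simp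
    show "is_cokernel A (p' \<cdot> w) (w' \<cdot> i')"
    proof (rule cokernelI)
      show "is_epi A (p' \<cdot> w)"
        using epi_comp[OF _ d'(6), of w] epi_factor[of w w'] idm_epi ww' w(1-3) w' d'(1-4) by simp
      show "p' \<cdot> w \<cdot> (w' \<cdot> i') = hzero A (src A (w' \<cdot> i')) (tgt A (p' \<cdot> w))"
        using reassoc[OF ww', of i'] w(1-3) w'(1-3) d'(1-4) by simp
      fix h assume h: "h \<in> Arr A" "src A h = tgt A (w' \<cdot> i')"
        "h \<cdot> (w' \<cdot> i') = hzero A (src A (w' \<cdot> i')) (tgt A h)"
      then obtain u where u: "u \<in> Arr A" "src A u = tgt A p'" "tgt A u = tgt A h" "u \<cdot> p' = h \<cdot> w'"
        using short_exact_ext[OF se, of "h \<cdot> w'"] w'(1-3) d'(1-4) by auto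
      have "u \<cdot> (p' \<cdot> w) = h"
        using reassoc[OF u(4), of w] u(1-3) w(1-3) w'(1-3) h(1,2) d'(1-4) k ww by simp
      then show "\<exists>u\<in>Arr A. src A u = tgt A (p' \<cdot> w) \<and> tgt A u = tgt A h \<and> u \<cdot> (p' \<cdot> w) = h"
        using u(1-3) w(1-3) d'(1-4) by (intro bexI[of _ u]) auto
    qed (use w(1-3) w'(1-3) d'(1-4) in auto)
  qed
  moreover have "p' \<cdot> w \<cdot> r = q" using w(1-3) d'(1-4) f(2) k p' reassoc w(4) by simp
  ultimately show ?thesis using that[of k "p' \<cdot> w"] w'(5) kp k(1-3) p' w(1-3) d'(1-4) po by simp
qed

end

section \<open>Diagram lemmas\<close>

context abelian_category
begin

text \<open>This produces the third row of the 3x3 diagram with rows (w, a), (w1, a1) and columns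
  (t, v), (z, q), (x, p). The diagonal \<open>z \<cdot> w = w1 \<cdot> t\<close> has one cokernel r;
  \<open>noether\<close> for its two factorisations presents the target of r as an extension in two
  ways, and the new row crosses from one to the other as \<open>q' \<cdot> k\<close>.\<close>

lemma nine:
  assumes wa: "short_exact A w a" and wa1: "short_exact A w1 a1" and zq: "short_exact A z q"
    and xp: "short_exact A x p" and tv: "short_exact A t v"
    and ends: "tgt A w = src A z" "tgt A t = src A w1" "tgt A a1 = tgt A x" "tgt A w1 = tgt A z"
      "tgt A a = src A x"
    and sq: "w1 \<cdot> t = z \<cdot> w" "a1 \<cdot> z = x \<cdot> a"
  obtains v2 a2 where "short_exact A v2 a2" "a2 \<cdot> q = p \<cdot> a1" "src A v2 = tgt A v" "tgt A a2 = tgt A p" "src A a2 = tgt A q"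
proof -
  note waD = short_exactD(1-4)[OF wa] and wa1D = short_exactD(1-4)[OF wa1] and zqD = short_exactD(1-4)[OF zq]
    and xpD = short_exactD(1-4)[OF xp] and tvD = short_exactD(1-4)[OF tv]
  obtain r where r: "short_exact A (z \<cdot> w) r" using short_exact_comp[OF wa zq ends(1)] .
  have r': "short_exact A (w1 \<cdot> t) r" using r sq by simp
  note rD = short_exactD(1-4)[OF r]
  have rz: "src A r = tgt A z" using rD(3) zqD(1) waD(1) ends by simp
  obtain x' q' where x'q': "short_exact A x' q'" "r \<cdot> z = x' \<cdot> a" "q' \<cdot> r = q" "src A x' = tgt A a"
      "tgt A x' = tgt A r" "tgt A q' = tgt A q"
    using noether[OF wa zq ends(1) r] by metis
  obtain k s where ks: "short_exact A k s" "r \<cdot> w1 = k \<cdot> v" "s \<cdot> r = a1" "src A k = tgt A v"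
      "tgt A k = tgt A r" "tgt A s = tgt A a1"
    using noether[OF tv wa1 ends(2) r'] by metis
  note x'q'D = short_exactD(1-4)[OF x'q'(1)] and ksD = short_exactD(1-4)[OF ks(1)]
  have sk0: "src A s = src A q'" using ksD(3) x'q'D(3) ks(5) x'q'(5) by simp
  have "(s \<cdot> x') \<cdot> a = s \<cdot> (r \<cdot> z)" using x'q'(2,4,5) x'q'D(1) ksD(2,3) ks(5) waD(2) by simp
  also have "\<dots> = x \<cdot> a"
    using reassoc[OF ks(3), of z] rD(2) rz ksD ks(5) zqD(1) sq(2) by simp
  finally have sx: "s \<cdot> x' = x"
    by - (rule epi_cancel[OF short_exactD(6)[OF wa]],
      use x'q'(4,5) x'q'D(1) ksD(2,3) ks(5,6) xpD(1) ends in simp_all)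
  have "(p \<cdot> s) \<cdot> x' = hzero A (src A x') (tgt A (p \<cdot> s))"
    using xpD ksD(2,3) x'q'D(1) x'q'(4,5) ks(5,6) ends sx by simp
  then obtain a2 where a2: "a2 \<in> Arr A" "src A a2 = tgt A q'" "tgt A a2 = tgt A p" "a2 \<cdot> q' = p \<cdot> s"
    using short_exact_ext[OF x'q'(1), of "p \<cdot> s"] xpD ksD(2,3) ks(5,6) x'q'(5) ends by auto
  have a2q: "a2 \<cdot> q = p \<cdot> a1"
    using reassoc[OF a2(4), of r] a2(1,2) x'q'(3,5) x'q'D(2,3) rD(2) xpD(2,3) ksD(2,3) ks(3,5,6) ends by simp
  have "short_exact A (q' \<cdot> k) a2"
  proof (rule short_exactI1)
    show "is_mono A (q' \<cdot> k)"
    proof (rule monoI)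
      show "q' \<cdot> k \<in> Arr A" using x'q'D ksD x'q'(5) ks(5) by simp
      fix y assume y: "y \<in> Arr A" "tgt A y = src A (q' \<cdot> k)"
        "q' \<cdot> k \<cdot> y = hzero A (src A y) (tgt A (q' \<cdot> k))"
      then obtain b where b: "b \<in> Arr A" "src A b = src A y" "tgt A b = src A x'" "x' \<cdot> b = k \<cdot> y"
        using short_exact_lift[OF x'q'(1), of "k \<cdot> y"] x'q'D ksD x'q'(5) ks(5) by auto
      have "x \<cdot> b = s \<cdot> (k \<cdot> y)" using reassoc[OF sx, of b] b ksD(2,3) x'q'D(1) x'q'(5) ks(5) by simp
      also have "\<dots> = hzero A (src A b) (tgt A x)"
        using reassoc[OF ksD(4), of y] y(1,2) b(2) x'q'D(2,3) x'q'(5) ks(5,6) ksD(1-3) xpD(1) ends by simp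
      finally have "b = hzero A (src A b) (src A x)"
        using mono_zero[OF short_exactD(5)[OF xp], of b] b x'q'(4) ends by simp
      then have "k \<cdot> y = hzero A (src A y) (tgt A k)"
        using b x'q'D(1) x'q'(4,5) ks(5) ends arr_obj(1)[OF b(1)] comp_hzero[of x' "src A x" "src A b"] by simp
      then show "y = hzero A (src A y) (src A (q' \<cdot> k))"
        using mono_zero[OF short_exactD(5)[OF ks(1)], of y] y(1,2) x'q'D(2,3) x'q'(5) ks(5) ksD(1) by simp
    qed
    show "is_cokernel A a2 (q' \<cdot> k)"
    proof (rule cokernelI)
      have "is_epi A (a2 \<cdot> q')"
        unfolding a2(4)
        by (rule epi_comp[OF short_exactD(6)[OF ks(1)] short_exactD(6)[OF xp]]) (use ks(6) ends xpD in simp)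
      then show "is_epi A a2" using epi_factor[of a2 q'] a2(1,2) x'q'D(2) by simp
      show "a2 \<cdot> (q' \<cdot> k) = hzero A (src A (q' \<cdot> k)) (tgt A a2)"
        using reassoc[OF a2(4), of k] a2(1-3) x'q'D(2,3) x'q'(5) ksD ks(5,6) xpD(2,3) ends by simp
      fix h assume h: "h \<in> Arr A" "src A h = tgt A (q' \<cdot> k)" "h \<cdot> (q' \<cdot> k) = hzero A (src A (q' \<cdot> k)) (tgt A h)"
      have hq: "src A h = tgt A q'" using h x'q'D(2,3) x'q'(5) ksD(1) ks(5) by simp
      have hq': "h \<cdot> q' \<in> Arr A" "src A (h \<cdot> q') = tgt A k" "tgt A (h \<cdot> q') = tgt A h"
        using h hq x'q'D(2,3) x'q'(5) ks(5) by simp_all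
      have "h \<cdot> q' \<cdot> k = hzero A (src A k) (tgt A (h \<cdot> q'))"
        using h(1) h(3)[symmetric] hq hq'(3) x'q'D(2,3) x'q'(5) ksD(1) ks(5) by simp
      then obtain c where c: "c \<in> Arr A" "src A c = tgt A s" "tgt A c = tgt A h" "c \<cdot> s = h \<cdot> q'"
        using short_exact_ext[OF ks(1) hq'(1,2)] hq'(3) by metis
      have "c \<cdot> x = h \<cdot> (q' \<cdot> x')"
        using reassoc[OF c(4), of x'] c(1,2) h(1) hq x'q'D(1-3) x'q'(5) ksD(2,3) ks(5) sx by simp
      also have "\<dots> = hzero A (src A x) (tgt A c)" using x'q'D h(1) hq c(3) x'q'(4) ends xpD(1) by simp
      finally obtain d where d: "d \<in> Arr A" "src A d = tgt A p" "tgt A d = tgt A c" "d \<cdot> p = c"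
        using short_exact_ext[OF xp, of c] c ks(6) ends by auto
      have "(d \<cdot> a2) \<cdot> q' = c \<cdot> s"
        using d(1-3) a2 x'q'D(2) xpD(2,3) ksD(2) ks(6) ends reassoc[OF d(4), of s] by simp
      then have "(d \<cdot> a2) \<cdot> q' = h \<cdot> q'" using c by simp
      then have "d \<cdot> a2 = h"
        using epi_cancel[OF short_exactD(6)[OF x'q'(1)], of "d \<cdot> a2" h] d a2 h(1) hq c(3) by simp
      then show "\<exists>u\<in>Arr A. src A u = tgt A a2 \<and> tgt A u = tgt A h \<and> u \<cdot> a2 = h"
        using d a2(3) c(3) by auto
    qed (use a2(1-3) x'q'D(2,3) x'q'(5) ksD ks(5) in auto)
  qed
  then show ?thesis using that[of "q' \<cdot> k" a2] a2q a2(2,3) x'q'(5,6) x'q'D(2,3) ksD(1) ks(4,5) by simp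
qed

text \<open>An extension f of p over j has a kernel that meets the image of j in the image of i and
  maps onto the quotient by j. This kernel is the middle term of the preimage sought when (j, q)
  becomes split under p.\<close>

lemma middle_section:
  assumes ip: "short_exact A i p" and jq: "short_exact A j q"
    and f: "f \<in> Arr A" "src A f = tgt A j" "tgt A f = tgt A p" "f \<cdot> j = p"
  obtains l k where "short_exact A l (q \<cdot> k)" "src A l = src A i" "k \<in> Arr A" "tgt A k = tgt A j" "tgt A l = src A k"
    "k \<cdot> l = j \<cdot> i"
proof -
  note ipD = short_exactD(1-4)[OF ip] and jqD = short_exactD(1-4)[OF jq]
  have "src A (f \<cdot> j) = src A j" using f(1,2) jqD(1) by simp
  then have jp: "src A j = src A p" by (simp only: f(4))
  have f_epi: "is_epi A f" using epi_factor[of f j] short_exactD(6)[OF ip] f jqD by simp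
  obtain k where k: "is_kernel A k f" using ex_kernel f by blast
  have kf: "short_exact A k f" using short_exactI2[OF f_epi k] .
  note kD = short_exactD(1-4)[OF kf]
  have "f \<cdot> (j \<cdot> i) = hzero A (src A (j \<cdot> i)) (tgt A f)"
    using reassoc[OF f(4), of i] f(1-3) jqD(1) ipD jp by simp
  then obtain l where l: "l \<in> Arr A" "src A l = src A i" "tgt A l = src A k" "k \<cdot> l = j \<cdot> i"
    using short_exact_lift[OF kf, of "j \<cdot> i"] jqD(1) ipD jp f by auto
  have kj: "tgt A k = src A q" using kD f jqD by simp
  have lm: "is_mono A l"
    using mono_comp[OF short_exactD(5)[OF ip] short_exactD(5)[OF jq]] mono_factor[of k l] l kD ipD jp by simp
  have "short_exact A l (q \<cdot> k)"
  proof (rule short_exactI2)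
    show "is_epi A (q \<cdot> k)"
    proof (rule epiI)
      show "q \<cdot> k \<in> Arr A" using kj kD jqD by simp
      fix h assume h: "h \<in> Arr A" "src A h = tgt A (q \<cdot> k)" "h \<cdot> (q \<cdot> k) = hzero A (src A (q \<cdot> k)) (tgt A h)"
      then obtain a where a: "a \<in> Arr A" "src A a = tgt A f" "tgt A a = tgt A h" "a \<cdot> f = h \<cdot> q"
        using short_exact_ext[OF kf, of "h \<cdot> q"] kj kD jqD by auto
      have "a \<cdot> p = h \<cdot> (q \<cdot> j)" using reassoc[OF a(4), of j] a(1,2) f jqD(1-3) h(1,2) kD(1) kj by simp
      also have "\<dots> = hzero A (src A p) (tgt A a)" using jqD h(1,2) a(3) kD(1) kj jp ipD(2) by simp
      finally have "a = hzero A (tgt A f) (tgt A h)"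
        using epi_zero[OF short_exactD(6)[OF ip], of a] a(1-3) f by simp
      then have "h \<cdot> q = hzero A (src A f) (tgt A h)"
        using a(4) f(1) h(1) hzero_comp[of f "tgt A f" "tgt A h"] by simp
      then show "h = hzero A (tgt A (q \<cdot> k)) (tgt A h)"
        using epi_zero[OF short_exactD(6)[OF jq], of h] h(1,2) kj kD jqD f(2) by simp
    qed
    show "is_kernel A l (q \<cdot> k)"
    proof (rule kernelI)
      show "q \<cdot> k \<cdot> l = hzero A (src A l) (tgt A (q \<cdot> k))"
        using l kj kD(1) jqD reassoc[OF jqD(4), of i] ipD jp by simp
      fix h assume h: "h \<in> Arr A" "tgt A h = src A (q \<cdot> k)" "q \<cdot> k \<cdot> h = hzero A (src A h) (tgt A (q \<cdot> k))"
      obtain y where y: "y \<in> Arr A" "src A y = src A h" "tgt A y = src A j" "j \<cdot> y = k \<cdot> h"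
        using short_exact_lift[OF jq, of "k \<cdot> h"] h kj kD(1) jqD by auto
      have "p \<cdot> y = f \<cdot> (k \<cdot> h)" using reassoc[OF f(4), of y] y f jqD by simp
      also have "\<dots> = hzero A (src A y) (tgt A p)" using reassoc[OF kD(4), of h] h(1,2) y(2) kD(1-3) f(3) jqD(2) kj ipD(2) by simp
      finally obtain u where u: "u \<in> Arr A" "src A u = src A y" "tgt A u = src A i" "i \<cdot> u = y"
        using short_exact_lift[OF ip, of y] y jp by auto
      have "k \<cdot> (l \<cdot> u) = j \<cdot> (i \<cdot> u)"
        using reassoc[OF l(4), of u] l(1-3) u(1-3) kD(1) ipD(1,3) jqD(1) jp by simp
      also have "\<dots> = k \<cdot> h" using u y by simp
      finally have "l \<cdot> u = h"
        using mono_cancel[OF short_exactD(5)[OF kf], of "l \<cdot> u" h] l u h(1,2) y(2) kD(1) kj jqD by simp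
      then show "\<exists>u\<in>Arr A. src A u = src A h \<and> tgt A u = src A l \<and> l \<cdot> u = h"
        using u(1-3) y(2) l(2) by (intro bexI[of _ u]) auto
    qed (use l kj kD jqD lm in auto)
  qed
  then show ?thesis using that[of l k] l kD f by simp
qed

lemma zero_object_unique:
  assumes "is_zero_object A Z" "f \<in> Arr A" "g \<in> Arr A" "src A f = src A g" "tgt A f = tgt A g"
    "src A g = Z \<or> tgt A g = Z"
  shows "f = g"
proof -
  have "src A g \<in> Obj A" "tgt A g \<in> Obj A" using assms by simp_all
  then show ?thesis using assms unfolding is_zero_object_def by (metis HomI)
qed

text \<open>Isomorphisms are deflations with zero kernel. Closure under extensions then gives
  closure under isomorphisms, and the trivial conflations in the zero sequences arise in this
  way.\<close>

lemma zero_object_short_exact: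
  assumes Z: "is_zero_object A Z" and p: "is_mono A p" "is_epi A p"
  shows "short_exact A (hzero A Z (src A p)) p"
proof (rule short_exactI2)
  have ZO: "Z \<in> Obj A" using Z by (simp add: is_zero_object_def)
  note pA = monoE[OF p(1)]
  show "is_epi A p" by fact
  show "is_kernel A (hzero A Z (src A p)) p"
  proof (rule kernelI)
    show "is_mono A (hzero A Z (src A p))"
    proof (rule monoI)
      fix u assume u: "u \<in> Arr A" "tgt A u = src A (hzero A Z (src A p))"
      then show "u = hzero A (src A u) (src A (hzero A Z (src A p)))"
        using zero_object_unique[OF Z, of u "hzero A (src A u) Z"] ZO pA by simp
    qed (use ZO pA in simp)
    fix h assume h: "h \<in> Arr A" "tgt A h = src A p" "p \<cdot> h = hzero A (src A h) (tgt A p)"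
    have "h = hzero A (src A h) (src A p)" using mono_zero[OF p(1)] h by simp
    then show "\<exists>u\<in>Arr A. src A u = src A h \<and> tgt A u = src A (hzero A Z (src A p)) \<and>
        hzero A Z (src A p) \<cdot> u = h"
      using ZO pA h by (intro bexI[of _ "hzero A (src A h) Z"]) auto
  qed (use ZO pA in auto)
qed

lemma op_zero_short_exact:
  assumes Z: "is_zero_object A Z" and p: "is_mono A p" "is_epi A p"
  shows "short_exact A p (hzero A (tgt A p) Z)"
  using abelian_category.zero_object_short_exact[OF op_abelian, of Z p] assms by simp

subsection \<open>The chosen biproducts\<close>

definition bpo :: "'o \<Rightarrow> 'o \<Rightarrow> 'o" where "bpo X Y = fst (biprod A X Y)"
definition in1 :: "'o \<Rightarrow> 'o \<Rightarrow> 'm" where "in1 X Y = fst (snd (biprod A X Y))"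
definition in2 :: "'o \<Rightarrow> 'o \<Rightarrow> 'm" where "in2 X Y = fst (snd (snd (biprod A X Y)))"
definition pr1 :: "'o \<Rightarrow> 'o \<Rightarrow> 'm" where "pr1 X Y = fst (snd (snd (snd (biprod A X Y))))"
definition pr2 :: "'o \<Rightarrow> 'o \<Rightarrow> 'm" where "pr2 X Y = snd (snd (snd (snd (biprod A X Y))))"

lemma biprod_eq: "biprod A X Y = (bpo X Y, in1 X Y, in2 X Y, pr1 X Y, pr2 X Y)"
  by (simp add: bpo_def in1_def in2_def pr1_def pr2_def)

lemma biprod_is:
  assumes "X \<in> Obj A" "Y \<in> Obj A"
  shows "is_biproduct A X Y (bpo X Y) (in1 X Y) (in2 X Y) (pr1 X Y) (pr2 X Y)"
proof -
  have "\<exists>b. case b of (S, i, j, p, q) \<Rightarrow> is_biproduct A X Y S i j p q"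
    using ex_biproduct[OF assms] by auto
  then have "case biprod A X Y of (S, i, j, p, q) \<Rightarrow> is_biproduct A X Y S i j p q"
    unfolding biprod_def by (rule someI_ex)
  then show ?thesis by (simp add: biprod_eq)
qed

lemmas bp_simps [simp] = biproductD(1,4-20)[OF biprod_is]

lemma arr_sum_eq:
  assumes "f \<in> Arr A" "g \<in> Arr A"
  shows "arr_sum A f g = (in1 (tgt A f) (tgt A g) \<cdot> (f \<cdot> pr1 (src A f) (src A g))) \<boxplus>
    (in2 (tgt A f) (tgt A g) \<cdot> (g \<cdot> pr2 (src A f) (src A g)))"
  using assms by (simp add: arr_sum_def biprod_eq)

lemma arr_sum_arr [simp]:
  assumes "f \<in> Arr A" "g \<in> Arr A"
  shows "arr_sum A f g \<in> Arr A" "src A (arr_sum A f g) = bpo (src A f) (src A g)"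
    "tgt A (arr_sum A f g) = bpo (tgt A f) (tgt A g)"
  using assms by (simp_all add: arr_sum_eq)

lemma bp_reassoc [simp]:
  assumes "x \<in> Arr A"
  shows "tgt A x = X \<Longrightarrow> Y \<in> Obj A \<Longrightarrow> pr1 X Y \<cdot> (in1 X Y \<cdot> x) = x"
    "tgt A x = Y \<Longrightarrow> X \<in> Obj A \<Longrightarrow> pr2 X Y \<cdot> (in2 X Y \<cdot> x) = x"
    "tgt A x = X \<Longrightarrow> Y \<in> Obj A \<Longrightarrow> pr2 X Y \<cdot> (in1 X Y \<cdot> x) = hzero A (src A x) Y"
    "tgt A x = Y \<Longrightarrow> X \<in> Obj A \<Longrightarrow> pr1 X Y \<cdot> (in2 X Y \<cdot> x) = hzero A (src A x) X"
  using assms reassoc[of "pr1 X Y" "in1 X Y" "idm A X" x] reassoc[of "pr2 X Y" "in2 X Y" "idm A Y" x]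
    reassoc[of "pr2 X Y" "in1 X Y" "hzero A X Y" x] reassoc[of "pr1 X Y" "in2 X Y" "hzero A Y X" x] by auto

lemma arr_sum_proj [simp]:
  assumes "f \<in> Arr A" "g \<in> Arr A" 
  shows "X = tgt A f \<Longrightarrow> Y = tgt A g \<Longrightarrow> pr1 X Y \<cdot> arr_sum A f g = f \<cdot> pr1 (src A f) (src A g)"
    "X = tgt A f \<Longrightarrow> Y = tgt A g \<Longrightarrow> pr2 X Y \<cdot> arr_sum A f g = g \<cdot> pr2 (src A f) (src A g)"
    "X = src A f \<Longrightarrow> Y = src A g \<Longrightarrow> arr_sum A f g \<cdot> in1 X Y = in1 (tgt A f) (tgt A g) \<cdot> f"
    "X = src A f \<Longrightarrow> Y = src A g \<Longrightarrow> arr_sum A f g \<cdot> in2 X Y = in2 (tgt A f) (tgt A g) \<cdot> g"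
  using assms by (simp_all add: arr_sum_eq)

lemma arr_sum_proj' [simp]:
  assumes "f \<in> Arr A" "g \<in> Arr A" "x \<in> Arr A" "tgt A x = bpo (src A f) (src A g)"
  shows "X = tgt A f \<Longrightarrow> Y = tgt A g \<Longrightarrow> pr1 X Y \<cdot> (arr_sum A f g \<cdot> x) = f \<cdot> (pr1 (src A f) (src A g) \<cdot> x)"
    "X = tgt A f \<Longrightarrow> Y = tgt A g \<Longrightarrow> pr2 X Y \<cdot> (arr_sum A f g \<cdot> x) = g \<cdot> (pr2 (src A f) (src A g) \<cdot> x)"
  using assms reassoc[OF arr_sum_proj(1)[OF assms(1,2)], of X Y x]
    reassoc[OF arr_sum_proj(2)[OF assms(1,2)], of X Y x] by auto

lemma bpo_eqI:
  assumes "X \<in> Obj A" "Y \<in> Obj A" "x \<in> Arr A" "y \<in> Arr A" "tgt A x = bpo X Y" "tgt A y = bpo X Y"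
    "src A x = src A y" "pr1 X Y \<cdot> x = pr1 X Y \<cdot> y" "pr2 X Y \<cdot> x = pr2 X Y \<cdot> y"
  shows "x = y"
  using biproduct_eqI[OF biprod_is[OF assms(1,2)]] assms by metis

lemma bpo_eqI':
  assumes "X \<in> Obj A" "Y \<in> Obj A" "x \<in> Arr A" "y \<in> Arr A" "src A x = bpo X Y" "src A y = bpo X Y"
    "tgt A x = tgt A y" "x \<cdot> in1 X Y = y \<cdot> in1 X Y" "x \<cdot> in2 X Y = y \<cdot> in2 X Y"
  shows "x = y"
  using biproduct_eqI'[OF biprod_is[OF assms(1,2)]] assms by metis

lemma arr_sum_comp:
  assumes "f \<in> Arr A" "g \<in> Arr A" "f' \<in> Arr A" "g' \<in> Arr A" "tgt A f = src A f'" "tgt A g = src A g'"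
  shows "arr_sum A f' g' \<cdot> arr_sum A f g = arr_sum A (f' \<cdot> f) (g' \<cdot> g)"
  using assms by - (rule bpo_eqI[of "tgt A f'" "tgt A g'"], auto)

lemma arr_sum_idm: "X \<in> Obj A \<Longrightarrow> Y \<in> Obj A \<Longrightarrow> arr_sum A (idm A X) (idm A Y) = idm A (bpo X Y)"
  by - (rule bpo_eqI[of X Y], auto)

lemma diagonal_simps [simp]:
  assumes "X \<in> Obj A"
  shows "diagonal A X \<in> Arr A" "src A (diagonal A X) = X" "tgt A (diagonal A X) = bpo X X"
    "pr1 X X \<cdot> diagonal A X = idm A X" "pr2 X X \<cdot> diagonal A X = idm A X"
  using assms by (simp_all add: diagonal_def biprod_eq)

lemma codiagonal_simps [simp]:
  assumes "X \<in> Obj A"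
  shows "codiagonal A X \<in> Arr A" "src A (codiagonal A X) = bpo X X" "tgt A (codiagonal A X) = X"
    "codiagonal A X \<cdot> in1 X X = idm A X" "codiagonal A X \<cdot> in2 X X = idm A X"
  using assms by (simp_all add: codiagonal_def biprod_eq)

lemma diagonal_natural:
  "f \<in> Arr A \<Longrightarrow> arr_sum A f f \<cdot> diagonal A (src A f) = diagonal A (tgt A f) \<cdot> f"
  by - (rule bpo_eqI[of "tgt A f" "tgt A f"], auto simp: reassoc[OF diagonal_simps(4)] reassoc[OF diagonal_simps(5)])

lemma codiagonal_natural:
  assumes "f \<in> Arr A" shows "codiagonal A (tgt A f) \<cdot> arr_sum A f f = f \<cdot> codiagonal A (src A f)"
  by (rule bpo_eqI'[of "src A f" "src A f"])
    (use assms in \<open>auto simp: reassoc[OF codiagonal_simps(4)] reassoc[OF codiagonal_simps(5)]\<close>)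

text \<open>The arrow-level counterpart of the Baer sum, from which the additivity of push-out and
  pull-back in the arrow is derived.\<close>

lemma codiagonal_arr_sum_diagonal:
  assumes "f \<in> Arr A" "g \<in> Arr A" "src A f = src A g" "tgt A f = tgt A g"
  shows "codiagonal A (tgt A g) \<cdot> (arr_sum A f g \<cdot> diagonal A (src A g)) = f \<boxplus> g"
  using assms 
  by (simp add: arr_sum_eq reassoc[OF codiagonal_simps(4)] reassoc[OF codiagonal_simps(5)])

lemma arr_sum_short_exact:
  assumes ip: "short_exact A i p" and ip': "short_exact A i' p'"
  shows "short_exact A (arr_sum A i i') (arr_sum A p p')"
proof (rule short_exactI2)
  note d = short_exactD[OF ip] and d' = short_exactD[OF ip']
  show "is_epi A (arr_sum A p p')"
  proof (rule epiI)
    fix u assume u: "u \<in> Arr A" "src A u = tgt A (arr_sum A p p')"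
      "u \<cdot> arr_sum A p p' = hzero A (src A (arr_sum A p p')) (tgt A u)"
    have "(u \<cdot> in1 (tgt A p) (tgt A p')) \<cdot> p = u \<cdot> (arr_sum A p p' \<cdot> in1 (src A p) (src A p'))"
      using u(1,2) d(2) d'(2) by simp
    also have "\<dots> = hzero A (src A p) (tgt A u)" using reassoc[OF u(3), of "in1 (src A p) (src A p')"] u(1,2) d(2) d'(2)
      by (simp del: arr_sum_proj)
    finally have 1: "u \<cdot> in1 (tgt A p) (tgt A p') = hzero A (tgt A p) (tgt A u)"
      using epi_zero[OF d(6), of "u \<cdot> in1 (tgt A p) (tgt A p')"] u(1,2) d(2) d'(2) by simp
    have "(u \<cdot> in2 (tgt A p) (tgt A p')) \<cdot> p' = u \<cdot> (arr_sum A p p' \<cdot> in2 (src A p) (src A p'))"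
      using u(1,2) d(2) d'(2) by simp
    also have "\<dots> = hzero A (src A p') (tgt A u)" using reassoc[OF u(3), of "in2 (src A p) (src A p')"] u(1,2) d(2) d'(2)
      by (simp del: arr_sum_proj)
    finally have 2: "u \<cdot> in2 (tgt A p) (tgt A p') = hzero A (tgt A p') (tgt A u)"
      using epi_zero[OF d'(6), of "u \<cdot> in2 (tgt A p) (tgt A p')"] u(1,2) d(2) d'(2) by simp
    show "u = hzero A (tgt A (arr_sum A p p')) (tgt A u)"
      using 1 2 u(1,2) d(2) d'(2) by - (rule bpo_eqI'[of "tgt A p" "tgt A p'"], auto)
  qed (use d(2) d'(2) in simp)
  show "is_kernel A (arr_sum A i i') (arr_sum A p p')"
  proof (rule kernelI)
    show "is_mono A (arr_sum A i i')"
    proof (rule monoI)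
      fix u assume u: "u \<in> Arr A" "tgt A u = src A (arr_sum A i i')"
        "arr_sum A i i' \<cdot> u = hzero A (src A u) (tgt A (arr_sum A i i'))"
      have "i \<cdot> (pr1 (src A i) (src A i') \<cdot> u) = pr1 (tgt A i) (tgt A i') \<cdot> (arr_sum A i i' \<cdot> u)"
        using u(1,2) d(1) d'(1) by simp
      also have "\<dots> = hzero A (src A u) (tgt A i)" unfolding u(3) using u(1,2) d(1) d'(1) by simp
      finally have 1: "pr1 (src A i) (src A i') \<cdot> u = hzero A (src A u) (src A i)"
        using mono_zero[OF d(5), of "pr1 (src A i) (src A i') \<cdot> u"] u(1,2) d(1) d'(1) by simp
      have "i' \<cdot> (pr2 (src A i) (src A i') \<cdot> u) = pr2 (tgt A i) (tgt A i') \<cdot> (arr_sum A i i' \<cdot> u)"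
        using u(1,2) d(1) d'(1) by simp
      also have "\<dots> = hzero A (src A u) (tgt A i')" unfolding u(3) using u(1,2) d(1) d'(1) by simp
      finally have 2: "pr2 (src A i) (src A i') \<cdot> u = hzero A (src A u) (src A i')"
        using mono_zero[OF d'(5), of "pr2 (src A i) (src A i') \<cdot> u"] u(1,2) d(1) d'(1) by simp
      show "u = hzero A (src A u) (src A (arr_sum A i i'))"
        using 1 2 u(1,2) d(1) d'(1) by - (rule bpo_eqI[of "src A i" "src A i'"], auto)
    qed (use d d' in simp)
    show "arr_sum A p p' \<cdot> arr_sum A i i' = hzero A (src A (arr_sum A i i')) (tgt A (arr_sum A p p'))"
      using d(1-4) d'(1-4) by - (rule bpo_eqI[of "tgt A p" "tgt A p'"], auto simp: reassoc[OF d(4)] reassoc[OF d'(4)])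
    fix h assume h: "h \<in> Arr A" "tgt A h = src A (arr_sum A p p')"
      "arr_sum A p p' \<cdot> h = hzero A (src A h) (tgt A (arr_sum A p p'))"
    let ?h1 = "pr1 (src A p) (src A p') \<cdot> h" and ?h2 = "pr2 (src A p) (src A p') \<cdot> h"
    have "p \<cdot> ?h1 = pr1 (tgt A p) (tgt A p') \<cdot> (arr_sum A p p' \<cdot> h)" using h(1,2) d(2) d'(2) by simp
    also have "\<dots> = hzero A (src A h) (tgt A p)" unfolding h(3) using h(1,2) d(2) d'(2) by simp
    finally obtain a where a: "a \<in> Arr A" "src A a = src A h" "tgt A a = src A i" "i \<cdot> a = ?h1"
      using short_exact_lift[OF ip, of ?h1] h(1,2) d(2) d'(2) by auto
    have "p' \<cdot> ?h2 = pr2 (tgt A p) (tgt A p') \<cdot> (arr_sum A p p' \<cdot> h)" using h(1,2) d(2) d'(2) by simp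
    also have "\<dots> = hzero A (src A h) (tgt A p')" unfolding h(3) using h(1,2) d(2) d'(2) by simp
    finally obtain b where b: "b \<in> Arr A" "src A b = src A h" "tgt A b = src A i'" "i' \<cdot> b = ?h2"
      using short_exact_lift[OF ip', of ?h2] h(1,2) d(2) d'(2) by auto
    let ?u = "(in1 (src A i) (src A i') \<cdot> a) \<boxplus> (in2 (src A i) (src A i') \<cdot> b)"
    have u: "?u \<in> Arr A" "src A ?u = src A h" "tgt A ?u = bpo (src A i) (src A i')"
      using a b d(1) d'(1) by simp_all
    have "pr1 (src A i) (src A i') \<cdot> ?u = a" "pr2 (src A i) (src A i') \<cdot> ?u = b"
      using a b d(1) d'(1) by simp_all
    then have "arr_sum A i i' \<cdot> ?u = h"
      using u a(4) b(4) h(1,2) d(1-3) d'(1-3)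
      by - (rule bpo_eqI[of "src A p" "src A p'"], simp_all del: comp_hadd)
    then show "\<exists>u\<in>Arr A. src A u = src A h \<and> tgt A u = src A (arr_sum A i i') \<and> arr_sum A i i' \<cdot> u = h"
      using u d(1) d'(1) by (intro bexI[of _ ?u]) auto
  qed (use d d' in auto)
qed

end

section \<open>The exact structure on the extension-closed subcategory\<close>

section \<open>Conflations\<close>

lemma conflationE:
  assumes "conflation A C i p"
  shows "short_exact A i p" "src A i \<in> C" "tgt A i \<in> C" "tgt A p \<in> C"
  using assms by (auto simp: conflation_def)

context extension_closed_subcategory
begin

lemma sub_obj [simp]: "X \<in> C \<Longrightarrow> X \<in> Obj A" using sub_Obj by blast

lemma conflationI: "short_exact A i p \<Longrightarrow> src A i \<in> C \<Longrightarrow> tgt A p \<in> C \<Longrightarrow> conflation A C i p"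
  using extension_in_sub by (simp add: conflation_def)

lemma conflationD:
  assumes "conflation A C i p"
  shows "i \<in> Arr A" "p \<in> Arr A" "tgt A i = src A p" "p \<cdot> i = hzero A (src A i) (tgt A p)"
    "src A i \<in> C" "src A p \<in> C" "tgt A p \<in> C"
  using conflationE[OF assms] short_exactD(1-4)[of i p] by simp_all

lemma pushout_conflation:
  assumes c: "conflation A C i p" and g: "g \<in> Arr A" "src A g = src A i" "tgt A g \<in> C"
  obtains i' p' g' where "conflation A C i' p'" "is_pushout A i g g' i'" "p' \<cdot> g' = p" "tgt A p' = tgt A p"
proof -
  have "tgt A i \<in> Obj A" "tgt A g \<in> Obj A" using conflationD[OF c] g by simp_all
  then obtain S j1 j2 q1 q2 where bp: "is_biproduct A (tgt A i) (tgt A g) S j1 j2 q1 q2" using ex_biproduct by metis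
  obtain i' p' g' where *: "short_exact A i' p'" "is_pushout A i g g' i'" "p' \<cdot> g' = p" "tgt A p' = tgt A p"
    by (rule pushout_short_exact[OF conflationE(1)[OF c] g(1,2) bp]) blast
  have "conflation A C i' p'" using * pushoutD[OF *(2)] g conflationD[OF c] by (intro conflationI) auto
  with * show ?thesis using that by blast
qed

text \<open>A morphism of conflations with identity left component has a pull-back as its right
  square. The pull-back and its exact sequence come from \<open>pushout_short_exact\<close> in the
  opposite category, and \<open>short_five\<close> identifies it with the source of u.\<close>

lemma mayer_vietoris:
  assumes c: "conflation A C i p" and c': "conflation A C i' p'" 
    and u: "u \<in> Arr A" "src A u = tgt A i" "tgt A u = tgt A i'" "u \<cdot> i = i'"
    and g: "g \<in> Arr A" "src A g = tgt A p" "tgt A g = tgt A p'" "p' \<cdot> u = g \<cdot> p"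
    and bp: "is_biproduct A (tgt A i') (tgt A p) S j1 j2 q1 q2"
  shows "conflation A C ((j1 \<cdot> u) \<boxplus> (j2 \<cdot> p)) ((p' \<cdot> q1) \<boxplus> neg (g \<cdot> q2))"
proof -
  note d = conflationD[OF c] and d' = conflationD[OF c'] and b = biproductD[OF bp]
  interpret op: abelian_category "op_cat A" by (rule op_abelian)
  have op_neg: "op.neg = neg" by (auto simp: op.neg_def neg_def fun_eq_iff)
  have bp': "is_biproduct (op_cat A) (tgt (op_cat A) p') (tgt (op_cat A) g) S q1 q2 j1 j2"
    using bp d' g by simp
  obtain i2 p2 h where *: "short_exact A i2 p2" "is_pullback A p' g h p2" "h \<cdot> i2 = i'" "src A i2 = src A i'"
    "short_exact A ((j1 \<cdot> h) \<boxplus> (j2 \<cdot> p2)) ((p' \<cdot> q1) \<boxplus> neg (g \<cdot> q2))"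
    by (rule op.pushout_short_exact[of p' i' g, OF _ _ _ bp']) (use conflationE(1)[OF c'] g in \<open>auto simp: op_neg\<close>)
  have pb: "is_pushout (op_cat A) p' g h p2" using * by simp
  note pbD = op.pushoutD[OF pb, simplified]
  note e = short_exactD[OF *(1)]
  obtain t where t: "t \<in> Arr A" "src A t = src A p" "tgt A t = src A p2" "h \<cdot> t = u" "p2 \<cdot> t = p"
    using op.pushout_ext[OF pb, of u p] u g d d' by auto
  have "src A (u \<cdot> i) = src A i" using u(1,2) d by simp
  then have si: "src A i = src A i'" by (simp only: u(4))
  have "h \<cdot> (t \<cdot> i) = h \<cdot> i2" using t(1-3) *(3) reassoc[OF t(4), of i] d(1-3) u(4) pbD by simp
  moreover have "p2 \<cdot> (t \<cdot> i) = p2 \<cdot> i2"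
    using t(1-3) *(4) reassoc[OF t(5), of i] d(1-4) e(1-4) si g(2) pbD by simp
  ultimately have "t \<cdot> i = i2"
    by - (rule op.pushout_unique[OF pb], use t(1-3) *(4) si d(1-3) e(1-3) in simp_all)
  then obtain s where "s \<in> Arr A" "src A s = tgt A t" "tgt A s = src A t" "t \<cdot> s = idm A (tgt A t)"
      "s \<cdot> t = idm A (src A t)"
    using short_five[OF conflationE(1)[OF c] *(1), of t] t d e(3) by metis
  then have "short_exact A (((j1 \<cdot> h) \<boxplus> (j2 \<cdot> p2)) \<cdot> t) ((p' \<cdot> q1) \<boxplus> neg (g \<cdot> q2))"
    using short_exact_iso[OF *(5), of t s] t(1-3) b(1-15) pbD d' g by simp
  moreover have "((j1 \<cdot> h) \<boxplus> (j2 \<cdot> p2)) \<cdot> t = (j1 \<cdot> u) \<boxplus> (j2 \<cdot> p)"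
    using t b(1-15) pbD d' g by simp
  ultimately show ?thesis
    using u(1-3) g(1-3) d d' b(1-15) by (intro conflationI) auto
qed

lemma extend_section:
  assumes c: "conflation A C i p" and c': "conflation A C j q"
    and f: "f \<in> Arr A" "src A f = tgt A j" "tgt A f = tgt A p" "f \<cdot> j = p"
  obtains l k where "conflation A C l (q \<cdot> k)" "src A l = src A i" "k \<in> Arr A" "tgt A k = tgt A j" "tgt A l = src A k"
    "k \<cdot> l = j \<cdot> i"
proof -
  obtain l k where *: "short_exact A l (q \<cdot> k)" "src A l = src A i" "k \<in> Arr A" "tgt A k = tgt A j" "tgt A l = src A k"
    "k \<cdot> l = j \<cdot> i"
    using middle_section[OF conflationE(1)[OF c] conflationE(1)[OF c'] f] by blast
  moreover have "conflation A C l (q \<cdot> k)"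
    using * conflationD[OF c] conflationD[OF c'] by (intro conflationI) auto
  ultimately show ?thesis using that by blast
qed

lemma noether_conflation:
  assumes c: "conflation A C i p" and c': "conflation A C j q" and ij: "tgt A i = src A j"
  obtains r k s where "conflation A C (j \<cdot> i) r" "conflation A C k s" "r \<cdot> j = k \<cdot> p" "s \<cdot> r = q"
    "src A k = tgt A p" "tgt A k = tgt A r" "tgt A s = tgt A q"
proof -
  note d = conflationD[OF c] and d' = conflationD[OF c']
  obtain r where r: "short_exact A (j \<cdot> i) r"
    using short_exact_comp[OF conflationE(1)[OF c] conflationE(1)[OF c'] ij] .
  obtain k s where ks: "short_exact A k s" "r \<cdot> j = k \<cdot> p" "s \<cdot> r = q" "src A k = tgt A p" "tgt A k = tgt A r"
      "tgt A s = tgt A q"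
    using noether[OF conflationE(1)[OF c] conflationE(1)[OF c'] ij r] by metis
  have ks': "conflation A C k s" using ks d d' by (intro conflationI) auto
  then have "conflation A C (j \<cdot> i) r"
    using r ks(5) d d' ij conflationE(3)[OF ks'] by (intro conflationI) auto
  with ks ks' show ?thesis using that by blast
qed

text \<open>For arbitrary y the pair (i, y) is the mono that presents the push-out along
  \<open>neg y\<close>; the two signs cancel.\<close>

lemma inflation_pair:
  assumes c: "conflation A C i p" and y: "y \<in> Arr A" "src A y = src A i" "tgt A y \<in> C"
    and bp: "is_biproduct A (tgt A i) (tgt A y) S j1 j2 q1 q2"
  obtains r where "conflation A C ((j1 \<cdot> i) \<boxplus> (j2 \<cdot> y)) r"
proof -
  note d = conflationD[OF c] and b = biproductD[OF bp]
  have bp': "is_biproduct A (tgt A i) (tgt A (neg y)) S j1 j2 q1 q2" using bp y by simp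
  obtain i' p' g' where *: "short_exact A i' p'" "is_pushout A i (neg y) g' i'" "tgt A p' = tgt A p"
    "short_exact A ((j1 \<cdot> i) \<boxplus> neg (j2 \<cdot> neg y)) ((g' \<cdot> q1) \<boxplus> (i' \<cdot> q2))"
    by (rule pushout_short_exact[OF conflationE(1)[OF c] _ _ bp']) (use y in auto)
  note po = pushoutD[OF *(2)]
  have "conflation A C i' p'" using * po(1-8) y d by (intro conflationI) auto
  then have "tgt A i' \<in> C" by (rule conflationE(3))
  moreover have "neg (j2 \<cdot> neg y) = j2 \<cdot> y"
    using neg_neg[of "j2 \<cdot> y"] y b(7-9) by simp
  ultimately have se: "short_exact A ((j1 \<cdot> i) \<boxplus> (j2 \<cdot> y)) ((g' \<cdot> q1) \<boxplus> (i' \<cdot> q2))" using *(4) by simp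
  have "conflation A C ((j1 \<cdot> i) \<boxplus> (j2 \<cdot> y)) ((g' \<cdot> q1) \<boxplus> (i' \<cdot> q2))"
    by (rule conflationI[OF se]) (use \<open>tgt A i' \<in> C\<close> po(1-8) b(1-15) y d in auto)
  then show ?thesis by (rule that)
qed

lemma iso_closed:
  assumes "X \<in> C" "t \<in> Arr A" "s \<in> Arr A" "tgt A t = X" "src A s = X" "tgt A s = src A t"
    "t \<cdot> s = idm A X" "s \<cdot> t = idm A (src A t)"
  shows "src A t \<in> C"
proof -
  obtain Z where Z: "Z \<in> C" "is_zero_object A Z" using zero_in_sub by blast
  have "is_mono A t" "is_epi A t"
    using mono_factor[of s t] epi_factor[of t s] idm_mono idm_epi assms by simp_all
  then have "short_exact A (hzero A Z (src A t)) t" using zero_object_short_exact Z by blast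
  then show ?thesis using extension_in_sub[of "hzero A Z (src A t)" t] Z assms by simp
qed

lemma zero_object_in_sub:
  assumes "is_zero_object A Z" shows "Z \<in> C"
proof -
  obtain Z' where Z': "Z' \<in> C" "is_zero_object A Z'" using zero_in_sub by blast
  have Z: "Z \<in> Obj A" using assms by (simp add: is_zero_object_def)
  show ?thesis
    using iso_closed[of Z' "hzero A Z Z'" "hzero A Z' Z"] Z Z'
      zero_object_unique[OF assms, of "hzero A Z Z" "idm A Z"]
      zero_object_unique[OF Z'(2), of "hzero A Z' Z'" "idm A Z'"] by simp
qed

lemma zero_obj_zero: "is_zero_object A (zero_obj A)"
  unfolding zero_obj_def using ex_zero_object by (rule someI_ex)

lemma zero_obj_in [simp]: "zero_obj A \<in> C"
  using zero_object_in_sub zero_obj_zero .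

lemma bpo_conflation: "X \<in> C \<Longrightarrow> Y \<in> C \<Longrightarrow> conflation A C (in1 X Y) (pr2 X Y)"
  by (intro conflationI biproduct_short_exact[OF biprod_is]) auto

lemma bpo_in [simp]: "X \<in> C \<Longrightarrow> Y \<in> C \<Longrightarrow> bpo X Y \<in> C"
  using conflationE(3)[OF bpo_conflation] by simp

lemma arr_sum_conflation:
  "conflation A C i p \<Longrightarrow> conflation A C i' p' \<Longrightarrow> conflation A C (arr_sum A i i') (arr_sum A p p')"
  using arr_sum_short_exact[OF conflationE(1) conflationE(1), of C i p C i' p'] conflationD[of i p] conflationD[of i' p']
  by (intro conflationI) auto

lemma idm_zero_conflation:
  assumes "X \<in> C"
  shows "conflation A C (idm A X) (hzero A X (zero_obj A))" "conflation A C (hzero A (zero_obj A) X) (idm A X)"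
  using assms op_zero_short_exact[OF zero_obj_zero, of "idm A X"] zero_object_short_exact[OF zero_obj_zero, of "idm A X"]
  by (auto intro!: conflationI simp: idm_mono idm_epi)

end

section \<open>Yoneda extensions: sequences, classes, functoriality, splicing and the Baer
  sum\<close>

section \<open>Exact sequences and their morphisms\<close>

text \<open>In contrast to \<open>exseqs\<close>, the empty sequence is allowed; its two ends agree.\<close>

fun seq :: "('o, 'm) additive_data \<Rightarrow> 'o set \<Rightarrow> 'm exseq \<Rightarrow> 'o \<Rightarrow> 'o \<Rightarrow> bool" where
  "seq A C [] Y X \<longleftrightarrow> Y = X \<and> X \<in> C"
| "seq A C ((i, p) # E) Y X \<longleftrightarrow> conflation A C i p \<and> src A i = Y \<and> seq A C E (tgt A p) X"

text \<open>\<open>emor A C E F g h\<close>: there is a morphism \<open>E \<rightarrow> F\<close> of exact sequences whose component is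
  \<open>g\<close> at the left ends and \<open>h\<close> at the right ends.\<close>

inductive emor :: "('o, 'm) additive_data \<Rightarrow> 'o set \<Rightarrow> 'm exseq \<Rightarrow> 'm exseq \<Rightarrow> 'm \<Rightarrow> 'm \<Rightarrow> bool"
  for A C where
  Nil: "g \<in> Arr A \<Longrightarrow> src A g \<in> C \<Longrightarrow> tgt A g \<in> C \<Longrightarrow> emor A C [] [] g g"
| Cons: "conflation A C i p \<Longrightarrow> conflation A C i' p' \<Longrightarrow> g \<in> Hom A (src A i) (src A i') \<Longrightarrow>
    u \<in> Hom A (tgt A i) (tgt A i') \<Longrightarrow> k \<in> Hom A (tgt A p) (tgt A p') \<Longrightarrow>
    u \<cdot>\<^bsub>A\<^esub> i = i' \<cdot>\<^bsub>A\<^esub> g \<Longrightarrow> k \<cdot>\<^bsub>A\<^esub> p = p' \<cdot>\<^bsub>A\<^esub> u \<Longrightarrow> emor A C E F k h \<Longrightarrow>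
    emor A C ((i, p) # E) ((i', p') # F) g h"

inductive_cases emor_NilE: "emor A C [] F g h"
inductive_cases emor_ConsE: "emor A C ((i, p) # E) F g h"
lemma seq_append:
  "seq A C (E @ F) Z X \<longleftrightarrow> (\<exists>Y. seq A C E Z Y \<and> seq A C F Y X)"
proof (induction E arbitrary: Z)
  case Nil
  have "seq A C F Z X \<Longrightarrow> Z \<in> C" by (cases F) (auto simp: conflation_def)
  then show ?case by auto
qed auto

lemma seq_ends: "seq A C E Y X \<Longrightarrow> Y \<in> C \<and> X \<in> C"
  by (induction E arbitrary: Y) (auto simp: conflation_def)

lemma emor_ends:
  assumes "emor A C E F g h"
  shows "seq A C E (src A g) (src A h)" "seq A C F (tgt A g) (tgt A h)" "g \<in> Arr A" "h \<in> Arr A"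
    "length E = length F"
  using assms by (induction) (auto simp: Hom_def)

lemma emor_append: "emor A C E F g h \<Longrightarrow> emor A C E' F' h k \<Longrightarrow> emor A C (E @ E') (F @ F') g k"
  by (induction rule: emor.induct) (auto intro: emor.intros)

lemma exseqs_Cons:
  "(i, p) # E \<in> exseqs A C \<longleftrightarrow> conflation A C i p \<and> (E = [] \<or> E \<in> exseqs A C \<and> tgt A p = left_end A E)"
proof (cases E)
  case (Cons c E')
  have "(\<forall>k. Suc k < length ((i, p) # E) \<longrightarrow> tgt A (snd (((i, p) # E) ! k)) = src A (fst (((i, p) # E) ! Suc k)))
    \<longleftrightarrow> tgt A p = left_end A E \<and> (\<forall>k. Suc k < length E \<longrightarrow> tgt A (snd (E ! k)) = src A (fst (E ! Suc k)))"
    (is "?L \<longleftrightarrow> ?R")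
  proof
    assume L: ?L
    have "tgt A p = left_end A E" using L[rule_format, of 0] Cons by (simp add: left_end_def)
    then show ?R using L[rule_format, of "Suc k" for k] by auto
  next
    assume R: ?R
    show ?L
    proof (intro allI impI)
      fix k assume "Suc k < length ((i, p) # E)"
      then show "tgt A (snd (((i, p) # E) ! k)) = src A (fst (((i, p) # E) ! Suc k))"
        using R Cons by (cases k) (auto simp: left_end_def)
    qed
  qed
  then show ?thesis using Cons unfolding exseqs_def by auto
qed (auto simp: exseqs_def)

lemma seq_iff: "E \<noteq> [] \<and> seq A C E Y X \<longleftrightarrow> E \<in> exseqs A C \<and> left_end A E = Y \<and> right_end A E = X"
proof (induction E arbitrary: Y)
  case Nil show ?case by (simp add: exseqs_def)
next
  case (Cons c E)
  obtain i p where c: "c = (i, p)" by force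
  show ?case
  proof (cases "E = []")
    case True
    then show ?thesis by (auto simp: c exseqs_Cons left_end_def right_end_def conflation_def)
  next
    case False
    then have lr: "left_end A (c # E) = src A i" "right_end A (c # E) = right_end A E"
      by (simp_all add: left_end_def right_end_def c)
    show ?thesis using Cons[of "tgt A p"] False unfolding lr unfolding c exseqs_Cons seq.simps
      by (simp add: eq_commute[of "left_end A E"]) blast
  qed
qed

lemma seq_unique: "seq A C E Y X \<Longrightarrow> seq A C E Y' X' \<Longrightarrow> E \<noteq> [] \<Longrightarrow> Y' = Y \<and> X' = X"
  using seq_iff[of E A C Y X] seq_iff[of E A C Y' X'] by metis

lemma emor_of_components:
  assumes "length E = length F" "\<forall>(i, p)\<in>set E. conflation A C i p" "\<forall>(i, p)\<in>set F. conflation A C i p"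
    "v 0 \<in> Arr A" "src A (v 0) \<in> C" "tgt A (v 0) \<in> C"
    "\<forall>k<length E. case (E ! k, F ! k) of ((i, p), (i', p')) \<Rightarrow>
           v k \<in> Hom A (src A i) (src A i') \<and>
           u k \<in> Hom A (tgt A i) (tgt A i') \<and>
           v (Suc k) \<in> Hom A (tgt A p) (tgt A p') \<and>
           u k \<cdot>\<^bsub>A\<^esub> i = i' \<cdot>\<^bsub>A\<^esub> v k \<and>
           v (Suc k) \<cdot>\<^bsub>A\<^esub> p = p' \<cdot>\<^bsub>A\<^esub> u k"
  shows "emor A C E F (v 0) (v (length E))"
  using assms
proof (induction E arbitrary: F u v)
  case Nil then show ?case by (auto intro: emor.Nil)
next
  case (Cons c E)
  obtain c' F' where F: "F = c' # F'" using Cons.prems(1) by (cases F) auto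
  obtain i p i' p' where c: "c = (i, p)" "c' = (i', p')" by (metis surj_pair)
  note * = Cons.prems(7)[rule_format, of 0, simplified, unfolded F c, simplified]
  note ** = Cons.prems(7)[rule_format, of "Suc k" for k, simplified, unfolded F, simplified]
  have "emor A C E F' (v (Suc 0)) (v (Suc (length E)))"
    using Cons.IH[of F' "\<lambda>k. v (Suc k)" "\<lambda>k. u (Suc k)"] Cons.prems(1-3) F c * ** 
    by (auto simp: Hom_def conflation_def)
  then show ?case using Cons.prems(2,3) * F c by (auto intro!: emor.Cons[where k = "v (Suc 0)"])
qed

lemma emor_components:
  assumes "emor A C E F g h"
  shows "\<exists>u v. v 0 = g \<and> v (length E) = h \<and> (\<forall>k<length E. case (E ! k, F ! k) of ((i, p), (i', p')) \<Rightarrow>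
           v k \<in> Hom A (src A i) (src A i') \<and>
           u k \<in> Hom A (tgt A i) (tgt A i') \<and>
           v (Suc k) \<in> Hom A (tgt A p) (tgt A p') \<and>
           u k \<cdot>\<^bsub>A\<^esub> i = i' \<cdot>\<^bsub>A\<^esub> v k \<and>
           v (Suc k) \<cdot>\<^bsub>A\<^esub> p = p' \<cdot>\<^bsub>A\<^esub> u k)"
  using assms
proof induction
  case (Nil g)
  then show ?case by (intro exI[of _ "\<lambda>_. g"]) simp
next
  case (Cons i p i' p' g u k E F h)
  then obtain us vs where uv: "vs 0 = k" "vs (length E) = h" "\<forall>k<length E. case (E ! k, F ! k) of ((i, p), (i', p')) \<Rightarrow>
           vs k \<in> Hom A (src A i) (src A i') \<and>
           us k \<in> Hom A (tgt A i) (tgt A i') \<and>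
           vs (Suc k) \<in> Hom A (tgt A p) (tgt A p') \<and>
           us k \<cdot>\<^bsub>A\<^esub> i = i' \<cdot>\<^bsub>A\<^esub> vs k \<and>
           vs (Suc k) \<cdot>\<^bsub>A\<^esub> p = p' \<cdot>\<^bsub>A\<^esub> us k" by blast
  show ?case
  proof (rule exI[of _ "case_nat u us"], rule exI[of _ "case_nat g vs"], intro conjI allI impI)
    fix l assume "l < length ((i, p) # E)"
    then show "case (((i, p) # E) ! l, ((i', p') # F) ! l) of ((i, p), (i', p')) \<Rightarrow>
           case_nat g vs l \<in> Hom A (src A i) (src A i') \<and>
           case_nat u us l \<in> Hom A (tgt A i) (tgt A i') \<and>
           case_nat g vs (Suc l) \<in> Hom A (tgt A p) (tgt A p') \<and>
           case_nat u us l \<cdot>\<^bsub>A\<^esub> i = i' \<cdot>\<^bsub>A\<^esub> case_nat g vs l \<and>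
           case_nat g vs (Suc l) \<cdot>\<^bsub>A\<^esub> p = p' \<cdot>\<^bsub>A\<^esub> case_nat u us l"
      using Cons.hyps uv by (cases l) auto
  qed (use uv in auto)
qed

lemma exseqs_conflations: "E \<in> exseqs A C \<Longrightarrow> \<forall>(i, p)\<in>set E. conflation A C i p"
  by (simp add: exseqs_def)

text \<open>The indexed families u and v are traded for the inductive relation \<open>emor\<close>,
  so that diagrams can be built conflation by conflation along the list.\<close>

lemma (in extension_closed_subcategory) exseq_morphism_iff:
  "exseq_morphism A C E F \<longleftrightarrow> E \<noteq> [] \<and> emor A C E F (idm A (left_end A E)) (idm A (right_end A E))"
proof
  assume m: "exseq_morphism A C E F"
  then obtain u v where uv: "v 0 = idm A (left_end A E)" "v (length E) = idm A (right_end A E)"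
    "\<forall>k<length E. case (E ! k, F ! k) of ((i, p), (i', p')) \<Rightarrow>
           v k \<in> Hom A (src A i) (src A i') \<and>
           u k \<in> Hom A (tgt A i) (tgt A i') \<and>
           v (Suc k) \<in> Hom A (tgt A p) (tgt A p') \<and>
           u k \<cdot> i = i' \<cdot> v k \<and>
           v (Suc k) \<cdot> p = p' \<cdot> u k"
    unfolding exseq_morphism_def by blast
  have EF: "E \<in> exseqs A C" "F \<in> exseqs A C" "length E = length F" using m unfolding exseq_morphism_def by - (elim conjE, assumption)+
  then have "E \<noteq> []" "seq A C E (left_end A E) (right_end A E)"
    using seq_iff[of E A C "left_end A E" "right_end A E"] EF(1) by simp_all
  then have "left_end A E \<in> C" using seq_ends by fast
  then have "emor A C E F (v 0) (v (length E))"
    using emor_of_components[OF EF(3) exseqs_conflations[OF EF(1)] exseqs_conflations[OF EF(2)] _ _ _ uv(3)] uv(1) by simp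
  then show "E \<noteq> [] \<and> emor A C E F (idm A (left_end A E)) (idm A (right_end A E))"
    using uv(1,2) \<open>E \<noteq> []\<close> by simp
next
  assume *: "E \<noteq> [] \<and> emor A C E F (idm A (left_end A E)) (idm A (right_end A E))"
  note m = emor_ends[OF conjunct2[OF *]]
  have F: "F \<noteq> []" using m(5) * by auto
  obtain X Y where XY: "seq A C E Y X" using m by blast
  then have ends: "left_end A E = Y" "right_end A E = X" using * seq_iff[of E A C Y X] by auto
  have "Y \<in> Obj A" "X \<in> Obj A" using seq_ends[OF XY] by auto
  then have "seq A C F Y X" using m(2) by (simp add: ends)
  then have "E \<in> exseqs A C" "F \<in> exseqs A C" "left_end A E = left_end A F" "right_end A E = right_end A F"
    using XY ends * F seq_iff[of E A C Y X] seq_iff[of F A C Y X] by auto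
  then show "exseq_morphism A C E F"
    unfolding exseq_morphism_def using m(5) emor_components[OF conjunct2[OF *]] by (intro conjI)
qed

subsection \<open>Opposite sequences\<close>

definition opseq :: "'m exseq \<Rightarrow> 'm exseq" where "opseq E = rev (map prod.swap E)"

lemma opseq_opseq [simp]: "opseq (opseq E) = E"
  by (simp add: opseq_def rev_map comp_def)

lemma opseq_simps [simp]: "opseq [] = []" "opseq ((i, p) # E) = opseq E @ [(p, i)]"
  "opseq (E @ F) = opseq F @ opseq E" "length (opseq E) = length E" "opseq E = [] \<longleftrightarrow> E = []"
  by (simp_all add: opseq_def)

lemma seq_op_imp: "seq A C E Y X \<Longrightarrow> seq (op_cat A) C (opseq E) X Y"
proof (induction E arbitrary: Y)
  case (Cons c E)
  obtain i p where c: "c = (i, p)" by force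
  have "conflation A C i p" "src A i = Y" "seq A C E (tgt A p) X" using Cons.prems c by simp_all
  moreover from this have "tgt A i = src A p" using kernel_tgt[of A i p] by (auto simp: conflation_def short_exact_def)
  ultimately show ?case using Cons.IH[of "tgt A p"] by (auto simp: c seq_append conflation_def)
qed simp

lemma seq_op [simp]: "seq (op_cat A) C (opseq E) X Y \<longleftrightarrow> seq A C E Y X"
  using seq_op_imp[of A C E Y X] seq_op_imp[of "op_cat A" C "opseq E" X Y] by auto

lemma emor_op_imp: "emor A C E F g h \<Longrightarrow> emor (op_cat A) C (opseq F) (opseq E) h g"
proof (induction rule: emor.induct)
  case (Nil g) then show ?case by (auto intro: emor.Nil)
next
  case (Cons i p i' p' g u k E F h)
  have t: "tgt A i = src A p" "tgt A i' = src A p'" "src A i \<in> C" "src A i' \<in> C"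
    using Cons kernel_tgt[of A i p] kernel_tgt[of A i' p'] by (auto simp: conflation_def short_exact_def)
  have "emor (op_cat A) C [] [] g g" using Cons(3) t(3,4) by (intro emor.Nil) (auto simp: Hom_def)
  then have "emor (op_cat A) C [(p', i')] [(p, i)] k g"
    by (rule emor.Cons[where u = u, rotated 7]) (use Cons t in auto)
  with Cons.IH show ?case using emor_append by fastforce
qed

lemma emor_op [simp]: "emor (op_cat A) C (opseq F) (opseq E) h g \<longleftrightarrow> emor A C E F g h"
  using emor_op_imp[of A C E F g h] emor_op_imp[of "op_cat A" C "opseq F" "opseq E" h g] by auto

lemma op_pushout_seq [simp]: "pushout_seq (op_cat A) C h (opseq E) (opseq E') \<longleftrightarrow> pullback_seq A C h E E'"
proof
  assume "pushout_seq (op_cat A) C h (opseq E) (opseq E')"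
  then obtain i p i' p' g' Es where *: "opseq E = (i, p) # Es" "opseq E' = (i', p') # Es"
    "is_pushout (op_cat A) i h g' i'" "conflation (op_cat A) C i' p'" "p' \<cdot>\<^bsub>op_cat A\<^esub> g' = p"
    unfolding pushout_seq_def by blast
  have "E = opseq ((i, p) # Es)" "E' = opseq ((i', p') # Es)" using * by (metis opseq_opseq)+
  then show "pullback_seq A C h E E'" using *(3-) unfolding pullback_seq_def by force
next
  assume "pullback_seq A C h E E'"
  then obtain i p i' p' h' Es where *: "E = Es @ [(i, p)]" "E' = Es @ [(i', p')]"
    "is_pullback A p h h' p'" "conflation A C i' p'" "h' \<cdot>\<^bsub>A\<^esub> i' = i" unfolding pullback_seq_def by blast
  show "pushout_seq (op_cat A) C h (opseq E) (opseq E')"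
    unfolding pushout_seq_def
    by (intro exI[of _ p] exI[of _ i] exI[of _ p'] exI[of _ i'] exI[of _ h'] exI[of _ "opseq Es"]) (use * in simp)
qed

context extension_closed_subcategory
begin

lemma emor_idm: "seq A C E Y X \<Longrightarrow> emor A C E E (idm A Y) (idm A X)"
proof (induction E arbitrary: Y)
  case Nil then show ?case by (auto intro: emor.Nil)
next
  case (Cons c E)
  obtain i p where c: "c = (i, p)" by force
  have ip: "conflation A C i p" "src A i = Y" "seq A C E (tgt A p) X" using Cons c by auto
  note d = conflationD[OF ip(1)]
  show ?case unfolding c
    by (rule emor.Cons[OF _ _ _ _ _ _ _ Cons.IH[OF ip(3)], where u = "idm A (tgt A i)"])
      (use ip d in \<open>auto intro!: HomI\<close>)
qed

lemma emor_comp: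
  "emor A C E F g h \<Longrightarrow> emor A C F G g' h' \<Longrightarrow> tgt A g = src A g' \<Longrightarrow> emor A C E G (g' \<cdot> g) (h' \<cdot> h)"
proof (induction arbitrary: G g' rule: emor.induct)
  case (Nil g)
  note e = emor_ends[OF Nil(4)]
  have "G = []" "g' = h'" using Nil(4) by (auto elim: emor_NilE)
  moreover have "tgt A h' \<in> C" using e(2) seq_ends by fast
  ultimately show ?case using Nil e(3) by (auto intro: emor.Nil)
next
  case (Cons i p i' p' g u k E F h)
  from Cons(10) obtain i'' p'' G' u' k' where G: "G = (i'', p'') # G'" and *: "conflation A C i'' p''"
    "g' \<in> Hom A (src A i') (src A i'')" "u' \<in> Hom A (tgt A i') (tgt A i'')" "k' \<in> Hom A (tgt A p') (tgt A p'')"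
    "u' \<cdot> i' = i'' \<cdot> g'" "k' \<cdot> p' = p'' \<cdot> u'" "emor A C F G' k' h'"
    by (elim emor_ConsE) blast
  note d = conflationD[OF Cons(1)] conflationD[OF Cons(2)] conflationD[OF *(1)]
    HomD[OF Cons(3)] HomD[OF Cons(4)] HomD[OF Cons(5)] HomD[OF *(2)] HomD[OF *(3)] HomD[OF *(4)]
  have "(u' \<cdot> u) \<cdot> i = i'' \<cdot> (g' \<cdot> g)" using reassoc[OF *(5), of g] Cons(6) d by simp
  moreover have "(k' \<cdot> k) \<cdot> p = p'' \<cdot> (u' \<cdot> u)" using reassoc[OF *(6), of u] Cons(7) d by simp
  ultimately show ?case unfolding G
    by (intro emor.Cons[OF Cons(1) *(1) _ _ _ _ _ Cons.IH[OF *(7)], where u = "u' \<cdot> u"])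
      (use d in \<open>auto intro!: HomI\<close>)
qed

end

section \<open>Extension classes\<close>

lemma exseqs_iff: "E \<in> exseqs A C \<longleftrightarrow> E \<noteq> [] \<and> (\<exists>Y X. seq A C E Y X)"
  using seq_iff[of E A C] by metis

lemma op_exseqs [simp]: "opseq E \<in> exseqs (op_cat A) C \<longleftrightarrow> E \<in> exseqs A C"
  by (auto simp: exseqs_iff)

lemma equivclp_invariant:
  assumes "equivclp R E F" "\<And>E F. R E F \<Longrightarrow> P E = P F"
  shows "P E = P F"
  using assms(1) by (induction rule: equivclp_induct) (use assms(2) in auto)

lemma exseq_equiv_equiv: "equiv (exseqs A C) (exseq_equiv A C)"
proof (rule equivI)
  show "sym (exseq_equiv A C)" by (auto simp: sym_def exseq_equiv_def intro: equivclp_sym)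
  show "trans (exseq_equiv A C)" by (auto simp: trans_def exseq_equiv_def intro: equivclp_trans)
qed (auto simp: refl_on_def exseq_equiv_def)

lemma ext_class_eq_iff:
  "E \<in> exseqs A C \<Longrightarrow> F \<in> exseqs A C \<Longrightarrow>
    ext_class A C E = ext_class A C F \<longleftrightarrow> equivclp (exseq_morphism A C) E F"
  unfolding ext_class_def using eq_equiv_class_iff[OF exseq_equiv_equiv, of E A C F]
  by (simp add: exseq_equiv_def)

lemma ext_class_self: "E \<in> exseqs A C \<Longrightarrow> E \<in> ext_class A C E"
  unfolding ext_class_def by (rule equiv_class_self[OF exseq_equiv_equiv])

lemma ext_class_mem:
  assumes "F \<in> ext_class A C E"
  shows "F \<in> exseqs A C" "E \<in> exseqs A C" "ext_class A C F = ext_class A C E"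
proof -
  have EF: "(E, F) \<in> exseq_equiv A C" using assms by (simp add: ext_class_def)
  then show "F \<in> exseqs A C" "E \<in> exseqs A C" by (simp_all add: exseq_equiv_def)
  show "ext_class A C F = ext_class A C E"
    using equiv_class_eq[OF exseq_equiv_equiv EF] by (simp add: ext_class_def)
qed

context extension_closed_subcategory
begin

abbreviation "cls E \<equiv> ext_class A C E"
abbreviation "push g c \<equiv> ext_push A C g c"
abbreviation "pull c h \<equiv> ext_pull A C c h"
abbreviation "XT t X Y \<equiv> ext_set A C t X Y"

lemma exseq_morphismD:
  assumes "exseq_morphism A C E F"
  shows "E \<in> exseqs A C" "F \<in> exseqs A C" "length E = length F" "left_end A E = left_end A F"
    "right_end A E = right_end A F"
  using assms unfolding exseq_morphism_def by - (elim conjE, assumption)+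

lemma exseq_morphism_emor:
  assumes "seq A C E Y X" "E \<noteq> []" "emor A C E F (idm A Y) (idm A X)"
  shows "exseq_morphism A C E F"
  using assms seq_iff[of E A C Y X] by (auto simp: exseq_morphism_iff)

lemma emor_exseq_morphism:
  assumes "exseq_morphism A C E F" "seq A C E Y X"
  shows "emor A C E F (idm A Y) (idm A X)"
  using assms seq_iff[of E A C Y X] by (auto simp: exseq_morphism_iff)

lemma cls_eqI:
  assumes "seq A C E Y X" "E \<noteq> []" "emor A C E F (idm A Y) (idm A X)"
  shows "cls E = cls F"
proof -
  have m: "exseq_morphism A C E F" using exseq_morphism_emor assms by blast
  then show ?thesis using exseq_morphismD[OF m] by (simp add: ext_class_eq_iff r_into_equivclp)
qed

lemma cls_self: "seq A C E Y X \<Longrightarrow> E \<noteq> [] \<Longrightarrow> E \<in> cls E"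
  using exseqs_iff ext_class_self by metis

lemma cls_eq_seq:
  assumes "cls E = cls F" "seq A C E Y X" "E \<noteq> []" "F \<in> exseqs A C"
  shows "seq A C F Y X" "length F = length E"
proof -
  have E: "E \<in> exseqs A C" using assms by (auto simp: exseqs_iff)
  have "equivclp (exseq_morphism A C) E F" using assms(1) ext_class_eq_iff[OF E assms(4)] by simp
  then have "(left_end A E, right_end A E, length E) = (left_end A F, right_end A F, length F)"
    by (rule equivclp_invariant) (use exseq_morphismD in auto)
  then show "seq A C F Y X" "length F = length E" using assms(2-4) seq_iff[of E A C Y X] seq_iff[of F A C Y X] by auto
qed

text \<open>A function that takes equal values on any two sequences linked by one morphism descends
  to classes. With truth values as results this carries a property along a whole zigzag, provided
  one morphism transports it in both directions.\<close>

lemma cls_invariant: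
  assumes eq: "cls E = cls F" and E: "seq A C E Y X" "E \<noteq> []" and F: "F \<in> exseqs A C"
    and P: "\<And>E F. E \<noteq> [] \<Longrightarrow> F \<noteq> [] \<Longrightarrow> seq A C E Y X \<Longrightarrow> seq A C F Y X \<Longrightarrow>
      emor A C E F (idm A Y) (idm A X) \<Longrightarrow> P E = P F"
  shows "P E = P F"
proof -
  have E': "E \<in> exseqs A C" using E by (auto simp: exseqs_iff)
  have eqv: "equivclp (exseq_morphism A C) E F" using eq ext_class_eq_iff[OF E' F] by simp
  \<comment> \<open>\<open>P\<close> is controlled only on nonempty sequences from Y to X; the
    default \<open>None\<close> also shows that the zigzag never leaves these.\<close>
  let ?P = "\<lambda>E. if E \<noteq> [] \<and> seq A C E Y X then Some (P E) else None"
  have "?P E = ?P F" using eqv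
  proof (rule equivclp_invariant)
    fix E F assume m: "exseq_morphism A C E F"
    note d = exseq_morphismD[OF m]
    have "(E \<noteq> [] \<and> seq A C E Y X) = (F \<noteq> [] \<and> seq A C F Y X)"
      unfolding seq_iff using d by simp
    moreover have "P E = P F" if "E \<noteq> [] \<and> seq A C E Y X" "F \<noteq> [] \<and> seq A C F Y X"
      by (rule P) (use emor_exseq_morphism[OF m] that in auto)
    ultimately show "?P E = ?P F" by auto
  qed
  then show ?thesis using E cls_eq_seq(1)[OF eq E F] F by (auto simp: exseqs_iff)
qed

lemma XT_iff: "c \<in> XT t X Y \<longleftrightarrow> (\<exists>E. E \<noteq> [] \<and> seq A C E Y X \<and> length E = t \<and> c = cls E)"
proof -
  have "c \<in> XT t X Y \<longleftrightarrow> (\<exists>E. E \<in> exseqs A C \<and> length E = t \<and> right_end A E = X \<and> left_end A E = Y \<and> c = cls E)"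
    by (auto simp: ext_set_def quotient_def ext_class_def)
  then show ?thesis using seq_iff[of _ A C Y X] by metis
qed

lemma XT_I: "E \<noteq> [] \<Longrightarrow> seq A C E Y X \<Longrightarrow> cls E \<in> XT (length E) X Y"
  by (auto simp: XT_iff)

lemma XT_E:
  assumes "c \<in> XT t X Y"
  obtains E where "E \<noteq> []" "seq A C E Y X" "length E = t" "c = cls E"
  using assms by (auto simp: XT_iff)

lemma XT_ends: "c \<in> XT t X Y \<Longrightarrow> X \<in> C \<and> Y \<in> C"
  by (auto simp: XT_iff dest: seq_ends)

subsection \<open>Push-outs of classes\<close>

lemma pushout_seqE:
  assumes "pushout_seq A C g E F" "seq A C E Y X"
  obtains i p i' p' g' Es where "E = (i, p) # Es" "F = (i', p') # Es" "is_pushout A i g g' i'"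
    "conflation A C i p" "conflation A C i' p'" "p' \<cdot> g' = p" "tgt A p' = tgt A p" "seq A C Es (tgt A p) X"
proof -
  obtain i p i' p' g' Es where *: "E = (i, p) # Es" "F = (i', p') # Es" "is_pushout A i g g' i'"
    "conflation A C i' p'" "p' \<cdot> g' = p" using assms unfolding pushout_seq_def by blast
  note po = pushoutD[OF *(3)] and d = conflationD[OF *(4)]
  have "tgt A (p' \<cdot> g') = tgt A p'" using po d by simp
  then show ?thesis using that * assms(2) by auto
qed

lemma pushout_seq_emor:
  assumes po: "pushout_seq A C g E F" and E: "seq A C E Y X"
  shows "emor A C E F g (idm A X)"
proof -
  obtain i p i' p' g' Es where *: "E = (i, p) # Es" "F = (i', p') # Es" "is_pushout A i g g' i'"
    "conflation A C i p" "conflation A C i' p'" "p' \<cdot> g' = p" "tgt A p' = tgt A p" "seq A C Es (tgt A p) X"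
    using pushout_seqE[OF po E] by metis
  show ?thesis unfolding *(1,2)
    by (rule emor.Cons[OF *(4,5) _ _ _ _ _ emor_idm[OF *(8)], where u = g'])
      (use pushoutD[OF *(3)] *(6,7) conflationD[OF *(4)] in \<open>auto intro!: HomI\<close>)
qed

lemma pushout_seq_exists:
  assumes "seq A C E Y X" "E \<noteq> []" "g \<in> Arr A" "src A g = Y" "tgt A g \<in> C"
  obtains F where "pushout_seq A C g E F"
proof -
  obtain i p Es where E: "E = (i, p) # Es" using assms(2) by (metis list.exhaust surj_pair)
  then have ip: "conflation A C i p" "src A i = Y" using assms by auto
  obtain i' p' g' where "conflation A C i' p'" "is_pushout A i g g' i'" "p' \<cdot> g' = p" "tgt A p' = tgt A p"
    using pushout_conflation[OF ip(1), of g] assms(3-5) ip(2) by metis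
  then have "pushout_seq A C g E ((i', p') # Es)" unfolding pushout_seq_def E by blast
  then show ?thesis by (rule that)
qed

text \<open>Only the first conflation changes under push-out, so the universal property of one
  square extends to whole sequences. It stands in for all explicit comparisons of push-outs.\<close>

lemma pushout_seq_universal:
  assumes po: "pushout_seq A C g E E'" and m: "emor A C E F (k \<cdot> g) h" and k: "k \<in> Arr A" "src A k = tgt A g"
  shows "emor A C E' F k h"
proof -
  obtain i p i' p' g' Es where *: "E = (i, p) # Es" "E' = (i', p') # Es" "is_pushout A i g g' i'"
    "conflation A C i p" "conflation A C i' p'" "p' \<cdot> g' = p" "tgt A p' = tgt A p"
    using pushout_seqE[OF po emor_ends(1)[OF m]] by metis
  note po = pushoutD[OF *(3)] and d = conflationD[OF *(4)] and d' = conflationD[OF *(5)]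
  from m obtain j q u l F' where F: "F = (j, q) # F'" and **: "conflation A C j q"
    "k \<cdot> g \<in> Hom A (src A i) (src A j)" "u \<in> Hom A (tgt A i) (tgt A j)" "l \<in> Hom A (tgt A p) (tgt A q)"
    "u \<cdot> i = j \<cdot> (k \<cdot> g)" "l \<cdot> p = q \<cdot> u" "emor A C Es F' l h"
    unfolding *(1) by (elim emor_ConsE) blast
  note e = conflationD[OF **(1)] HomD[OF **(3)] HomD[OF **(4)]
  have "tgt A (k \<cdot> g) = tgt A k" using k po by simp
  then have tk: "tgt A k = src A j" using HomD(3)[OF **(2)] by simp
  have "u \<cdot> i = (j \<cdot> k) \<cdot> g" using **(5) e k tk po by simp
  then obtain w where w: "w \<in> Arr A" "src A w = tgt A i'" "tgt A w = tgt A j" "w \<cdot> g' = u" "w \<cdot> i' = j \<cdot> k"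
    using pushout_ext[OF *(3), of u "j \<cdot> k"] e k tk po by auto
  have "l \<cdot> p' = q \<cdot> w"
  proof (rule pushout_unique[OF *(3)])
    have "(l \<cdot> p') \<cdot> g' = l \<cdot> p" using *(6,7) e po d' by simp
    also have "\<dots> = (q \<cdot> w) \<cdot> g'" using **(6) w e po by simp
    finally show "l \<cdot> p' \<cdot> g' = q \<cdot> w \<cdot> g'" .
    have "(l \<cdot> p') \<cdot> i' = hzero A (src A i') (tgt A l)" using *(7) e d' by simp
    also have "\<dots> = (q \<cdot> w) \<cdot> i'" using w e tk k po d' reassoc[OF e(4), of k] by simp
    finally show "l \<cdot> p' \<cdot> i' = q \<cdot> w \<cdot> i'" .
  qed (use e w d' *(7) in auto)
  then show ?thesis unfolding F *(2)
    by (intro emor.Cons[OF *(5) **(1) _ _ _ _ _ **(7), where u = w])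
      (use k tk w e *(7) d' po in \<open>auto intro!: HomI\<close>)
qed

text \<open>The union in \<open>ext_push\<close> collapses because any two push-outs of any two
  representatives are linked by the universal property. From here on, a push-out is computed by
  exhibiting any morphism with identity right component.\<close>

lemma push_cls:
  assumes m: "emor A C E F g (idm A X)" and E: "seq A C E Y X" "E \<noteq> []"
  shows "push g (cls E) = cls F"
proof -
  note e = emor_ends[OF m]
  have Y: "src A g = Y" using seq_unique[OF e(1) E(1) E(2)] by simp
  have X: "X \<in> C" "Y \<in> C" using seq_ends[OF E(1)] by auto
  have g: "g \<in> Arr A" "tgt A g \<in> C" using e(3) seq_ends[OF e(2)] by auto
  define f where "f E = \<Union> (cls ` {E'. pushout_seq A C g E E'})" for E
  have f: "f E = cls F" if E: "seq A C E Y X" "E \<noteq> []" and m: "emor A C E F g (idm A X)" for E F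
  proof -
    have "cls E' = cls F" if po: "pushout_seq A C g E E'" for E'
    proof (rule cls_eqI)
      note m' = pushout_seq_emor[OF po E(1)]
      show "seq A C E' (tgt A g) X" using emor_ends(2)[OF m'] X by simp
      show "E' \<noteq> []" using emor_ends(5)[OF m'] E by auto
      have "emor A C E F (idm A (tgt A g) \<cdot> g) (idm A X)" using m g by simp
      from pushout_seq_universal[OF po this] show "emor A C E' F (idm A (tgt A g)) (idm A X)"
        using g by simp
    qed
    moreover obtain E' where "pushout_seq A C g E E'" using pushout_seq_exists[OF E g(1) Y g(2)] .
    ultimately show ?thesis by (auto simp: f_def)
  qed
  have ff: "f E = f E'" if EE': "E \<noteq> []" "E' \<noteq> []" "seq A C E Y X" "seq A C E' Y X" "emor A C E E' (idm A Y) (idm A X)" for E E'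
  proof -
    obtain F where po: "pushout_seq A C g E' F" using pushout_seq_exists[OF EE'(4,2) g(1) Y g(2)] .
    note m = pushout_seq_emor[OF po EE'(4)]
    have "emor A C E F g (idm A X)" using emor_comp[OF EE'(5) m] g X Y by simp
    then show ?thesis using f[OF EE'(3,1)] f[OF EE'(4,2) m] by simp
  qed
  have "f E' = f E" if "E' \<in> cls E" for E'
    using cls_invariant[of E E' Y X f] ext_class_mem[OF that] E ff by metis
  moreover have "E \<in> cls E" using cls_self[OF E] .
  ultimately have "(\<Union>E\<in>cls E. f E) = f E" by blast
  then show ?thesis using f[OF E m] by (simp add: ext_push_def f_def)
qed

lemma push_exists:
  assumes E: "seq A C E Y X" "E \<noteq> []" and g: "g \<in> Hom A Y Y'" "Y' \<in> C"
  obtains F where "emor A C E F g (idm A X)" "seq A C F Y' X" "F \<noteq> []" "push g (cls E) = cls F" "length F = length E"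
    "\<And>G k h. emor A C E G (k \<cdot> g) h \<Longrightarrow> k \<in> Arr A \<Longrightarrow> src A k = Y' \<Longrightarrow> emor A C F G k h"
proof -
  note gD = HomD[OF g(1)]
  obtain F where po: "pushout_seq A C g E F" using pushout_seq_exists[OF E, of g] gD g by auto
  note m = pushout_seq_emor[OF po E(1)]
  have "seq A C F Y' X" "length F = length E" using emor_ends[OF m] gD seq_ends[OF E(1)] by auto
  then show ?thesis using that[OF m _ _ push_cls[OF m E]] pushout_seq_universal[OF po] gD E(2) by fastforce
qed

end

subsection \<open>Classes in the opposite category\<close>

lemma opseq_mem: "E \<in> opseq ` c \<longleftrightarrow> opseq E \<in> c"
  by (metis image_iff opseq_opseq)

lemma (in extension_closed_subcategory) op_exseq_morphism:
  "exseq_morphism A C E F \<Longrightarrow> exseq_morphism (op_cat A) C (opseq F) (opseq E)"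
proof -
  interpret O: extension_closed_subcategory "op_cat A" C by (rule op_ext_closed)
  assume m: "exseq_morphism A C E F"
  note d = exseq_morphismD[OF m]
  obtain Y X where E: "seq A C E Y X" "E \<noteq> []" using d by (auto simp: exseqs_iff)
  then have F: "seq A C F Y X" "F \<noteq> []" using d seq_iff[of E A C Y X] seq_iff[of F A C Y X] by auto
  show ?thesis
    by (rule O.exseq_morphism_emor[of _ X Y]) (use emor_exseq_morphism[OF m E(1)] F in auto)
qed

lemma (in extension_closed_subcategory) op_ext_class_imp:
  assumes "(E, F) \<in> exseq_equiv A C"
  shows "(opseq E, opseq F) \<in> exseq_equiv (op_cat A) C"
proof -
  have "equivclp (exseq_morphism A C) E F" using assms by (simp add: exseq_equiv_def)
  then have "equivclp (exseq_morphism (op_cat A) C) (opseq E) (opseq F)"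
  proof (induction rule: equivclp_induct)
    case (step y z)
    then have "equivclp (exseq_morphism (op_cat A) C) (opseq y) (opseq z)"
      using op_exseq_morphism r_into_equivclp equivclp_sym by metis
    with step show ?case using equivclp_trans by metis
  qed simp
  then show ?thesis using assms by (simp add: exseq_equiv_def)
qed

context extension_closed_subcategory
begin

lemma op_ext_class [simp]: "ext_class (op_cat A) C (opseq E) = opseq ` ext_class A C E"
proof -
  interpret O: extension_closed_subcategory "op_cat A" C by (rule op_ext_closed)
  have "(opseq E, G) \<in> exseq_equiv (op_cat A) C \<longleftrightarrow> (E, opseq G) \<in> exseq_equiv A C" for G
    using op_ext_class_imp[of E "opseq G"] O.op_ext_class_imp[of "opseq E" G] by auto
  then show ?thesis by (intro Set.set_eqI) (simp add: ext_class_def opseq_mem)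
qed

lemma opseq_image_cancel [simp]: "opseq ` (opseq ` c) = c"
  by (intro Set.set_eqI) (simp add: opseq_mem)

lemma opseq_image_eq [simp]: "opseq ` c = opseq ` d \<longleftrightarrow> c = d"
  using opseq_image_cancel by metis

lemma op_XT [simp]: "opseq ` c \<in> ext_set (op_cat A) C t Y X \<longleftrightarrow> c \<in> XT t X Y"
proof -
  interpret O: extension_closed_subcategory "op_cat A" C by (rule op_ext_closed)
  have "opseq ` c \<in> ext_set (op_cat A) C t Y X \<longleftrightarrow>
    (\<exists>E. opseq E \<noteq> [] \<and> seq (op_cat A) C (opseq E) X Y \<and> length (opseq E) = t \<and> opseq ` c = ext_class (op_cat A) C (opseq E))"
    unfolding O.XT_iff by (metis opseq_opseq)
  then show ?thesis by (simp add: XT_iff)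
qed

text \<open>The basic facts about \<open>pull\<close> are those about \<open>push\<close> in the
  opposite category, read back through reversal of sequences.\<close>

lemma op_push [simp]: "ext_push (op_cat A) C h (opseq ` c) = opseq ` pull c h"
proof -
  have "(\<Union>E'\<in>{E'. pushout_seq (op_cat A) C h (opseq E) E'}. ext_class (op_cat A) C E') =
      (\<Union>E'\<in>{E'. pullback_seq A C h E E'}. opseq ` ext_class A C E')" for E
  proof -
    have "{E'. pushout_seq (op_cat A) C h (opseq E) E'} = opseq ` {E'. pullback_seq A C h E E'}"
      using op_pushout_seq[of A C h E "opseq E'" for E'] by (intro Set.set_eqI) (simp add: opseq_mem)
    then show ?thesis by simp
  qed
  then show ?thesis by (simp add: ext_push_def ext_pull_def image_UN)
qed

lemma pull_cls:
  assumes m: "emor A C E F (idm A Y) h" and F: "seq A C F Y X" "F \<noteq> []"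
  shows "pull (cls F) h = cls E"
  using extension_closed_subcategory.push_cls[OF op_ext_closed, of "opseq F" "opseq E" h Y X] assms by simp

lemma pull_exists:
  assumes E: "seq A C E Y X" "E \<noteq> []" and h: "h \<in> Hom A X' X" "X' \<in> C"
  obtains F where "emor A C F E (idm A Y) h" "seq A C F Y X'" "F \<noteq> []" "pull (cls E) h = cls F" "length F = length E"
    "\<And>G k g. emor A C G E g (h \<cdot> k) \<Longrightarrow> k \<in> Arr A \<Longrightarrow> tgt A k = X' \<Longrightarrow> emor A C G F g k"
proof -
  interpret O: extension_closed_subcategory "op_cat A" C by (rule op_ext_closed)
  obtain F where F: "emor (op_cat A) C (opseq E) F h (idm (op_cat A) Y)" "seq (op_cat A) C F X' Y" "F \<noteq> []"
      "O.push h (O.cls (opseq E)) = O.cls F" "length F = length (opseq E)"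
    and u: "\<And>G k l. emor (op_cat A) C (opseq E) G (k \<cdot>\<^bsub>op_cat A\<^esub> h) l \<Longrightarrow> k \<in> Arr (op_cat A) \<Longrightarrow>
      src (op_cat A) k = X' \<Longrightarrow> emor (op_cat A) C F G k l"
    using O.push_exists[of "opseq E" X Y h X'] E h by (simp add: Hom_def) metis
  obtain G where G: "F = opseq G" using opseq_opseq by metis
  show ?thesis
  proof (rule that[of G])
    fix H k g assume "emor A C H E g (h \<cdot> k)" "k \<in> Arr A" "tgt A k = X'"
    then show "emor A C H G g k" using u[of "opseq H" k g] G by simp
  qed (use F G in simp_all)
qed

subsection \<open>Functoriality\<close>

text \<open>The morphism factors through the push-out along g; the remaining factor is the identity
  on the left and so exhibits the push-out of E as the pull-back of F.\<close>

lemma push_pull_emor: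
  assumes m: "emor A C E F g h" and E: "E \<noteq> []"
  shows "push g (cls E) = pull (cls F) h"
proof -
  note e = emor_ends[OF m]
  have C: "tgt A g \<in> C" "src A h \<in> C" using seq_ends[OF e(1)] seq_ends[OF e(2)] by auto
  obtain G where G: "push g (cls E) = cls G" "seq A C G (tgt A g) (src A h)" "G \<noteq> []"
    and u: "\<And>H k l. emor A C E H (k \<cdot> g) l \<Longrightarrow> k \<in> Arr A \<Longrightarrow> src A k = tgt A g \<Longrightarrow> emor A C G H k l"
    using push_exists[OF e(1) E, of g "tgt A g"] e(3) C by (metis HomI)
  have "emor A C E F (idm A (tgt A g) \<cdot> g) h" using m e by simp
  then have "emor A C G F (idm A (tgt A g)) h" by (rule u) (use C in simp_all)
  then have "pull (cls F) h = cls G" by (rule pull_cls[OF _ e(2)]) (use e E in auto)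
  then show ?thesis using G by simp
qed

lemma push_XT [intro]: "c \<in> XT t X Y \<Longrightarrow> g \<in> Hom A Y Y' \<Longrightarrow> Y' \<in> C \<Longrightarrow> push g c \<in> XT t X Y'"
  by (elim XT_E) (metis push_exists XT_I)

lemma pull_XT [intro]: "c \<in> XT t X Y \<Longrightarrow> h \<in> Hom A X' X \<Longrightarrow> X' \<in> C \<Longrightarrow> pull c h \<in> XT t X' Y"
  by (elim XT_E) (metis pull_exists XT_I)

lemma push_idm: "c \<in> XT t X Y \<Longrightarrow> push (idm A Y) c = c"
  by (elim XT_E) (simp add: push_cls[OF emor_idm])

lemma pull_idm: "c \<in> XT t X Y \<Longrightarrow> pull c (idm A X) = c"
  by (elim XT_E) (simp add: pull_cls[OF emor_idm])

lemma push_push: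
  assumes c: "c \<in> XT t X Y" and g: "g \<in> Hom A Y Y'" "g' \<in> Hom A Y' Y''" "Y' \<in> C" "Y'' \<in> C"
  shows "push g' (push g c) = push (g' \<cdot> g) c"
proof -
  obtain E where E: "E \<noteq> []" "seq A C E Y X" "c = cls E" using XT_E[OF c] by metis
  obtain F where F: "emor A C E F g (idm A X)" "seq A C F Y' X" "F \<noteq> []" "push g (cls E) = cls F"
    using push_exists[OF E(2,1) g(1,3)] by metis
  obtain G where G: "emor A C F G g' (idm A X)" "push g' (cls F) = cls G"
    using push_exists[OF F(2,3) g(2,4)] by metis
  have "emor A C E G (g' \<cdot> g) (idm A X)"
    using emor_comp[OF F(1) G(1)] HomD[OF g(1)] HomD[OF g(2)] seq_ends[OF E(2)] by simp
  then show ?thesis using push_cls[OF _ E(2,1)] E(3) F(4) G(2) by simp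
qed

lemma pull_pull:
  assumes "c \<in> XT t X Y" "h \<in> Hom A X' X" "h' \<in> Hom A X'' X'" "X' \<in> C" "X'' \<in> C"
  shows "pull (pull c h) h' = pull c (h \<cdot> h')"
  using extension_closed_subcategory.push_push[OF op_ext_closed, of "opseq ` c" t Y X h X' h' X''] assms by simp

lemma push_pull:
  assumes c: "c \<in> XT t X Y" and g: "g \<in> Hom A Y Y'" "Y' \<in> C" and h: "h \<in> Hom A X' X" "X' \<in> C"
  shows "push g (pull c h) = pull (push g c) h"
proof -
  obtain E where E: "E \<noteq> []" "seq A C E Y X" "c = cls E" using XT_E[OF c] by metis
  obtain F where F: "emor A C E F g (idm A X)" "push g (cls E) = cls F"
    using push_exists[OF E(2,1) g] by metis
  obtain G where G: "emor A C G E (idm A Y) h" "pull (cls E) h = cls G" "G \<noteq> []"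
    using pull_exists[OF E(2,1) h] by metis
  have "emor A C G F g h"
    using emor_comp[OF G(1) F(1)] HomD[OF g(1)] HomD[OF h(1)] seq_ends[OF E(2)] by simp
  then show ?thesis using push_pull_emor[OF _ G(3)] E(3) F(2) G(2) by simp
qed

subsection \<open>Splicing\<close>

definition splice :: "'m exseq set \<Rightarrow> 'm exseq set \<Rightarrow> 'm exseq set" where
  "splice c d = (\<Union>E\<in>c. \<Union>F\<in>d. cls (E @ F))"

text \<open>The two factors are replaced one after the other: a morphism of one is continued by the
  identity of the other.\<close>

lemma splice_cls:
  assumes E: "seq A C E Z Y" "E \<noteq> []" and F: "seq A C F Y X" "F \<noteq> []"
  shows "splice (cls E) (cls F) = cls (E @ F)"
proof -
  have eF: "cls (G @ F) = cls (G' @ F)" 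
    if "seq A C F Y X" "G \<noteq> []" "G' \<noteq> []" "seq A C G Z Y" "seq A C G' Z Y" "emor A C G G' (idm A Z) (idm A Y)" for G G' F
    by (rule cls_eqI[of _ Z X]) (use that emor_append[OF that(6) emor_idm[OF that(1)]] in \<open>auto simp: seq_append\<close>)
  have Ee: "cls (E @ G) = cls (E @ G')" 
    if "seq A C E Z Y" "G \<noteq> []" "G' \<noteq> []" "seq A C G Y X" "seq A C G' Y X" "emor A C G G' (idm A Y) (idm A X)" for G G' E
    by (rule cls_eqI[of _ Z X]) (use that emor_append[OF emor_idm[OF that(1)] that(6)] in \<open>auto simp: seq_append\<close>)
  have "cls (E' @ F') = cls (E @ F)" if E': "E' \<in> cls E" and F': "F' \<in> cls F" for E' F'
  proof -
    note e = ext_class_mem[OF E'] and f = ext_class_mem[OF F']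
    have E'Z: "seq A C E' Z Y" using cls_eq_seq(1)[OF _ E e(1)] e(3) by simp
    have "cls (E @ F) = cls (E' @ F)"
      using cls_invariant[OF e(3)[symmetric] E e(1), of "\<lambda>E. cls (E @ F)"] eF[OF F(1)] by blast
    also have "\<dots> = cls (E' @ F')"
      using cls_invariant[OF f(3)[symmetric] F f(1), of "\<lambda>F. cls (E' @ F)"] Ee[OF E'Z] by blast
    finally show ?thesis by simp
  qed
  moreover have "E \<in> cls E" "F \<in> cls F" using cls_self E F by blast+
  ultimately show ?thesis unfolding splice_def by blast
qed

lemma splice_XT [intro]: "c \<in> XT s Y Z \<Longrightarrow> d \<in> XT t X Y \<Longrightarrow> splice c d \<in> XT (s + t) X Z"
proof -
  assume "c \<in> XT s Y Z" "d \<in> XT t X Y"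
  then obtain E F where E: "E \<noteq> []" "seq A C E Z Y" "c = cls E" "length E = s"
    and F: "F \<noteq> []" "seq A C F Y X" "d = cls F" "length F = t" by (auto simp: XT_iff)
  then have "seq A C (E @ F) Z X" by (auto simp: seq_append)
  then show ?thesis using XT_I[of "E @ F" Z X] E F splice_cls[OF E(2,1) F(2,1)] by simp
qed

lemma splice_assoc:
  assumes "c \<in> XT r Y Z" "d \<in> XT s X Y" "e \<in> XT t W X"
  shows "splice (splice c d) e = splice c (splice d e)"
proof -
  obtain E F G where "E \<noteq> []" "seq A C E Z Y" "c = cls E" "F \<noteq> []" "seq A C F Y X" "d = cls F"
    "G \<noteq> []" "seq A C G X W" "e = cls G" using assms by (auto simp: XT_iff)
  moreover from this have "seq A C (E @ F) Z X" "seq A C (F @ G) Y W" by (auto simp: seq_append)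
  ultimately show ?thesis by (simp add: splice_cls)
qed

lemma push_splice:
  assumes c: "c \<in> XT s Y Z" and d: "d \<in> XT t X Y" and g: "g \<in> Hom A Z Z'" "Z' \<in> C"
  shows "push g (splice c d) = splice (push g c) d"
proof -
  obtain E F where E: "E \<noteq> []" "seq A C E Z Y" "c = cls E" and F: "F \<noteq> []" "seq A C F Y X" "d = cls F"
    using c d by (auto simp: XT_iff)
  obtain G where G: "emor A C E G g (idm A Y)" "seq A C G Z' Y" "G \<noteq> []" "push g (cls E) = cls G"
    using push_exists[OF E(2,1) g] by metis
  have "push g (cls (E @ F)) = cls (G @ F)"
    by (rule push_cls[OF emor_append[OF G(1) emor_idm[OF F(2)]]]) (use E F in \<open>auto simp: seq_append\<close>)
  then show ?thesis using E F G by (simp add: splice_cls)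
qed

lemma pull_splice:
  assumes c: "c \<in> XT s Y Z" and d: "d \<in> XT t X Y" and h: "h \<in> Hom A X' X" "X' \<in> C"
  shows "pull (splice c d) h = splice c (pull d h)"
proof -
  obtain E F where E: "E \<noteq> []" "seq A C E Z Y" "c = cls E" and F: "F \<noteq> []" "seq A C F Y X" "d = cls F"
    using c d by (auto simp: XT_iff)
  obtain G where G: "emor A C G F (idm A Y) h" "seq A C G Y X'" "G \<noteq> []" "pull (cls F) h = cls G"
    using pull_exists[OF F(2,1) h] by metis
  have "pull (cls (E @ F)) h = cls (E @ G)"
    by (rule pull_cls[OF emor_append[OF emor_idm[OF E(2)] G(1)]]) (use E F in \<open>auto simp: seq_append\<close>)
  then show ?thesis using E F G by (simp add: splice_cls)
qed

text \<open>The morphism from the pull-back to E ends in h, the one from F to the push-out begins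
  with h; joined at h they form a single morphism with identities at both ends.\<close>

lemma splice_middle:
  assumes c: "c \<in> XT s Y Z" and d: "d \<in> XT t X Y'" and h: "h \<in> Hom A Y' Y"
  shows "splice (pull c h) d = splice c (push h d)"
proof -
  obtain E F where E: "E \<noteq> []" "seq A C E Z Y" "c = cls E" and F: "F \<noteq> []" "seq A C F Y' X" "d = cls F"
    using c d by (auto simp: XT_iff)
  have C: "Y \<in> C" "Y' \<in> C" "Z \<in> C" "X \<in> C" using seq_ends E F by fast+
  obtain E' where E': "emor A C E' E (idm A Z) h" "seq A C E' Z Y'" "E' \<noteq> []" "pull (cls E) h = cls E'"
    using pull_exists[OF E(2,1) h C(2)] by metis
  obtain F' where F': "emor A C F F' h (idm A X)" "seq A C F' Y X" "F' \<noteq> []" "push h (cls F) = cls F'"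
    using push_exists[OF F(2,1) h C(1)] by metis
  have "cls (E' @ F) = cls (E @ F')"
    by (rule cls_eqI[OF _ _ emor_append[OF E'(1) F'(1)]]) (use E' F in \<open>auto simp: seq_append\<close>)
  then show ?thesis using E F E' F' by (simp add: splice_cls)
qed

lemma splice_decompose:
  assumes c: "c \<in> XT (s + t) X Z" "s > 0" "t > 0"
  obtains Y d e where "Y \<in> C" "d \<in> XT s Y Z" "e \<in> XT t X Y" "c = splice d e"
proof -
  obtain E where E: "E \<noteq> []" "seq A C E Z X" "length E = s + t" "c = cls E" using XT_E[OF c(1)] by metis
  define F G where "F = take s E" and "G = drop s E"
  have FG: "E = F @ G" "length F = s" "length G = t" using E by (auto simp: F_def G_def)
  then obtain Y where Y: "seq A C F Z Y" "seq A C G Y X" using E(2) by (auto simp: seq_append)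
  have ne: "F \<noteq> []" "G \<noteq> []" using FG c by auto
  have "cls F \<in> XT s Y Z" "cls G \<in> XT t X Y" using XT_I ne Y FG by metis+
  moreover have "c = splice (cls F) (cls G)" using splice_cls[OF Y(1) ne(1) Y(2) ne(2)] FG(1) E(4) by simp
  moreover have "Y \<in> C" using seq_ends[OF Y(1)] by simp
  ultimately show ?thesis using that by metis
qed

lemma op_splice:
  assumes "c \<in> XT s Y Z" "d \<in> XT t X Y"
  shows "extension_closed_subcategory.splice (op_cat A) C (opseq ` d) (opseq ` c) = opseq ` splice c d"
proof -
  interpret O: extension_closed_subcategory "op_cat A" C by (rule op_ext_closed)
  obtain E F where E: "E \<noteq> []" "seq A C E Z Y" "c = cls E" and F: "F \<noteq> []" "seq A C F Y X" "d = cls F"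
    using assms by (auto simp: XT_iff)
  have "O.splice (O.cls (opseq F)) (O.cls (opseq E)) = O.cls (opseq F @ opseq E)"
    by (rule O.splice_cls[of _ X Y _ Z]) (use E F in auto)
  also have "\<dots> = opseq ` cls (E @ F)" by (simp flip: op_ext_class)
  finally show ?thesis using E F by (simp add: splice_cls)
qed

end

section \<open>The extension groups\<close>

context extension_closed_subcategory
begin

subsection \<open>The zero class\<close>

abbreviation "zer t X Y \<equiv> ext_class A C (zero_exseq A t X Y)"

text \<open>For t at least 2, \<open>zero_exseq\<close> of length t is one conflation followed by
  \<open>zero_tail (t - 2) X\<close>, which itself has length t - 1.\<close>

definition zero_tail :: "nat \<Rightarrow> 'o \<Rightarrow> 'm exseq" where
  "zero_tail s X = replicate s (idm A (zero_obj A), idm A (zero_obj A)) @ [(hzero A (zero_obj A) X, idm A X)]"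

lemma zero_obj_unique:
  "f \<in> Arr A \<Longrightarrow> g \<in> Arr A \<Longrightarrow> src A f = src A g \<Longrightarrow> tgt A f = tgt A g \<Longrightarrow>
    src A g = zero_obj A \<or> tgt A g = zero_obj A \<Longrightarrow> f = g"
  using zero_object_unique[OF zero_obj_zero] by metis

lemma zero_idm_conflation: "conflation A C (idm A (zero_obj A)) (idm A (zero_obj A))"
  using idm_zero_conflation(1)[OF zero_obj_in] zero_obj_unique[of "hzero A (zero_obj A) (zero_obj A)" "idm A (zero_obj A)"]
  by simp

lemma zero_tail_seq: "X \<in> C \<Longrightarrow> seq A C (zero_tail s X) (zero_obj A) X"
  unfolding zero_tail_def
  by (induction s) (use zero_idm_conflation idm_zero_conflation in auto)

lemma emor_zero_tail:
  assumes "seq A C E K X" "length E = Suc s"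
  shows "emor A C E (zero_tail s X) (hzero A K (zero_obj A)) (idm A X)"
  using assms
proof (induction s arbitrary: E K)
  case 0
  then obtain i p where E: "E = [(i, p)]" by (cases E) auto
  have ip: "conflation A C i p" "src A i = K" "tgt A p = X" "X \<in> C" using 0 E by auto
  note d = conflationD[OF ip(1)]
  show ?case unfolding E zero_tail_def replicate.simps append_Nil
    by (rule emor.Cons[OF ip(1) idm_zero_conflation(2)[OF ip(4)] _ _ _ _ _ emor.Nil, where u = p])
      (use ip d in \<open>auto intro!: HomI\<close>)
next
  case (Suc s)
  then obtain i p F where E: "E = (i, p) # F" by (cases E) auto
  have ip: "conflation A C i p" "src A i = K" "seq A C F (tgt A p) X" "length F = Suc s" using Suc.prems E by auto
  note d = conflationD[OF ip(1)]
  have "zero_tail (Suc s) X = (idm A (zero_obj A), idm A (zero_obj A)) # zero_tail s X"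
    by (simp add: zero_tail_def)
  then show ?case unfolding E
    by (simp, intro emor.Cons[OF ip(1) zero_idm_conflation _ _ _ _ _ Suc.IH[OF ip(3,4)],
          where u = "hzero A (tgt A i) (zero_obj A)"])
      (use ip(2) d in \<open>auto intro!: HomI\<close>)
qed

lemma zero_exseq_Suc:
  assumes "t \<ge> 1"
  shows "zero_exseq A t X Y = (if t = 1 then [(in1 Y X, pr2 Y X)]
    else (idm A Y, hzero A Y (zero_obj A)) # zero_tail (t - 2) X)"
  using assms by (auto simp: zero_exseq_def biprod_eq Let_def zero_tail_def)

lemma zero_exseq_seq:
  assumes "t \<ge> 1" "X \<in> C" "Y \<in> C"
  shows "seq A C (zero_exseq A t X Y) Y X" "length (zero_exseq A t X Y) = t" "zero_exseq A t X Y \<noteq> []"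
  using assms bpo_conflation[of Y X] idm_zero_conflation[of Y] zero_tail_seq[of X "t - 2"]
  by (auto simp: zero_exseq_Suc) (simp add: zero_tail_def)

lemma zer_XT: "t \<ge> 1 \<Longrightarrow> X \<in> C \<Longrightarrow> Y \<in> C \<Longrightarrow> zer t X Y \<in> XT t X Y"
  using XT_I[OF zero_exseq_seq(3,1)] zero_exseq_seq(2) by metis

text \<open>All components can be zero until the right end is reached, where p leads to X; in length
  1 the middle component is p followed by the second injection.\<close>

lemma emor_zero_exseq:
  assumes E: "seq A C E Y X" "E \<noteq> []" and Y': "Y' \<in> C"
  shows "emor A C E (zero_exseq A (length E) X Y') (hzero A Y Y') (idm A X)"
proof -
  obtain i p F where E': "E = (i, p) # F" using E(2) by (metis list.exhaust surj_pair)
  have ip: "conflation A C i p" "src A i = Y" "seq A C F (tgt A p) X" "X \<in> C"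
    using E E' seq_ends[OF E(1)] by auto
  note d = conflationD[OF ip(1)]
  show ?thesis
  proof (cases F)
    case Nil
    have X: "tgt A p = X" using ip(3) Nil by simp
    have u: "in2 Y' X \<cdot> p \<in> Hom A (tgt A i) (tgt A (in1 Y' X))" using d X ip(4) Y' by (auto intro!: HomI)
    have "emor A C ((i, p) # []) ((in1 Y' X, pr2 Y' X) # []) (hzero A Y Y') (idm A X)"
      by (rule emor.Cons[OF ip(1) bpo_conflation[OF Y' ip(4)] _ u _ _ _ emor.Nil])
        (use ip(2,4) d X Y' in \<open>auto intro!: HomI simp: reassoc[OF bp_simps(15)]\<close>)
    then show ?thesis unfolding E' Nil by (simp add: zero_exseq_Suc)
  next
    case (Cons c F')
    then have l: "length F = Suc (length E - 2)" using E' by simp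
    have "emor A C E ((idm A Y', hzero A Y' (zero_obj A)) # zero_tail (length E - 2) X) (hzero A Y Y') (idm A X)"
      unfolding E'(1)
      by (rule emor.Cons[OF ip(1) idm_zero_conflation(1)[OF Y'] _ _ _ _ _ emor_zero_tail[OF ip(3) l, unfolded E'],
          where u = "hzero A (tgt A i) Y'"])
        (use ip(2) d Y' in \<open>auto intro!: HomI\<close>)
    then show ?thesis using Cons E' by (simp add: zero_exseq_Suc)
  qed
qed

text \<open>The neutral element is 0c for every class c, so its behaviour under push-out, pull-back
  and splicing reduces to functoriality.\<close>

lemma push_zero:
  assumes "c \<in> XT t X Y" "Y' \<in> C" shows "push (hzero A Y Y') c = zer t X Y'"
  using assms push_cls[OF emor_zero_exseq] by (auto simp: XT_iff)

lemma emor_zero: "seq A C E Y X \<Longrightarrow> emor A C E E (hzero A Y Y) (hzero A X X)"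
proof (induction E arbitrary: Y)
  case (Cons c E)
  obtain i p where c: "c = (i, p)" by force
  have ip: "conflation A C i p" "src A i = Y" "seq A C E (tgt A p) X" using Cons c by auto
  note d = conflationD[OF ip(1)]
  show ?case unfolding c
    by (rule emor.Cons[OF ip(1,1) _ _ _ _ _ Cons.IH[OF ip(3)], where u = "hzero A (tgt A i) (tgt A i)"])
      (use ip d in \<open>auto intro!: HomI\<close>)
qed (auto intro!: emor.Nil)

lemma XT_pos: "c \<in> XT t X Y \<Longrightarrow> t \<ge> 1"
  using XT_iff[of c t X Y] by (auto simp: Suc_le_eq)

lemma push_zer: "t \<ge> 1 \<Longrightarrow> X \<in> C \<Longrightarrow> g \<in> Hom A Y Y' \<Longrightarrow> Y \<in> C \<Longrightarrow> Y' \<in> C \<Longrightarrow> push g (zer t X Y) = zer t X Y'"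
  using push_zero[OF zer_XT[of t X Y], of Y] push_zero[OF zer_XT[of t X Y], of Y']
    push_push[OF zer_XT[of t X Y], of "hzero A Y Y" Y g Y'] HomD[of g A Y Y'] by (simp add: HomI)

lemma pull_zero_endo:
  assumes "c \<in> XT t X Y" shows "pull c (hzero A X X) = zer t X Y"
proof -
  obtain E where E: "E \<noteq> []" "seq A C E Y X" "c = cls E" using XT_E[OF assms] by metis
  have "push (hzero A Y Y) c = pull c (hzero A X X)" using push_pull_emor[OF emor_zero[OF E(2)] E(1)] E(3) by simp
  then show ?thesis using push_zero[OF assms] XT_ends[OF assms] by simp
qed

lemma pull_zer:
  assumes "t \<ge> 1" "X \<in> C" "h \<in> Hom A X' X" "Y \<in> C" "X' \<in> C"
  shows "pull (zer t X Y) h = zer t X' Y"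
proof -
  note z = zer_XT[OF assms(1,2,4)] and h = HomD[OF assms(3)]
  have Y: "hzero A Y Y \<in> Hom A Y Y" using assms by (auto intro!: HomI)
  have "pull (zer t X Y) h = pull (push (hzero A Y Y) (zer t X Y)) h" using push_zero[OF z] assms by simp
  also have "\<dots> = push (hzero A Y Y) (pull (zer t X Y) h)" using push_pull[OF z Y] assms by simp
  also have "\<dots> = zer t X' Y" using push_zero pull_XT[OF z assms(3,5)] assms(4) by blast
  finally show ?thesis .
qed

lemma splice_zer_left:
  assumes "d \<in> XT t X Y" "Z \<in> C" "s \<ge> 1"
  shows "splice (zer s Y Z) d = zer (s + t) X Z"
proof -
  have C: "Y \<in> C" "X \<in> C" using XT_ends[OF assms(1)] by auto
  note z = zer_XT[OF assms(3) C(1) assms(2)]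
  have "splice (zer s Y Z) d = push (hzero A Z Z) (splice (zer s Y Z) d)"
    using push_splice[OF z assms(1), of "hzero A Z Z" Z] push_zero[OF z assms(2)] assms(2) by (simp add: HomI)
  then show ?thesis using push_zero[OF splice_XT[OF z assms(1)]] assms by simp
qed

text \<open>In degree 1 the reversed zero sequence need not be the zero sequence of the opposite
  category, as the chosen biproducts may differ. The classes agree because a zero arrow sends every
  class to the neutral one.\<close>

lemma op_zer:
  assumes "t \<ge> 1" "X \<in> C" "Y \<in> C"
  shows "ext_class (op_cat A) C (zero_exseq (op_cat A) t Y X) = opseq ` zer t X Y"
proof -
  interpret O: extension_closed_subcategory "op_cat A" C by (rule op_ext_closed)
  have "opseq ` zer t X Y = O.push (hzero A X X) (opseq ` zer t X Y)"
    using pull_zero_endo[OF zer_XT[OF assms]] by simp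
  also have "\<dots> = O.zer t Y X"
    using O.push_zero[of "opseq ` zer t X Y" t Y X X] zer_XT[OF assms] assms by simp
  finally show ?thesis by simp
qed

subsection \<open>The Baer sum\<close>

lemma exseq_sum_simps [simp]:
  "exseq_sum A [] [] = []" "exseq_sum A ((i, p) # E) ((j, q) # F) = (arr_sum A i j, arr_sum A p q) # exseq_sum A E F"
  by (simp_all add: exseq_sum_def)

lemma exseq_sum_eq_Nil [simp]: "length E = length F \<Longrightarrow> exseq_sum A E F = [] \<longleftrightarrow> E = []"
  by (auto simp: exseq_sum_def)

lemma length_exseq_sum [simp]: "length E = length F \<Longrightarrow> length (exseq_sum A E F) = length F"
  by (simp add: exseq_sum_def)

lemma emor_sum:
  assumes "emor A C E E' g h" "emor A C F F' g' h'" "length E = length F"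
  shows "emor A C (exseq_sum A E F) (exseq_sum A E' F') (arr_sum A g g') (arr_sum A h h')"
  using assms
proof (induction arbitrary: F F' g' rule: emor.induct)
  case (Nil g)
  then have "F = []" "F' = []" "g' = h'" by (auto elim: emor_NilE)
  then show ?case using Nil emor_ends[OF Nil(4)] seq_ends[OF emor_ends(1)[OF Nil(4)]] seq_ends[OF emor_ends(2)[OF Nil(4)]]
    by (auto intro!: emor.Nil)
next
  case (Cons i p i' p' g u k E E' h)
  from Cons.prems(2) obtain j q F1 where F: "F = (j, q) # F1" by (cases F) auto
  from Cons.prems(1)[unfolded F] obtain j' q' v l F1' where F': "F' = (j', q') # F1'" and *: "conflation A C j q" "conflation A C j' q'"
    "g' \<in> Hom A (src A j) (src A j')" "v \<in> Hom A (tgt A j) (tgt A j')" "l \<in> Hom A (tgt A q) (tgt A q')"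
    "v \<cdot> j = j' \<cdot> g'" "l \<cdot> q = q' \<cdot> v" "emor A C F1 F1' l h'"
    by (elim emor_ConsE) blast
  note d = conflationD[OF Cons(1)] conflationD[OF Cons(2)] conflationD[OF *(1)] conflationD[OF *(2)]
  note e = HomD[OF Cons(3)] HomD[OF Cons(4)] HomD[OF Cons(5)] HomD[OF *(3)] HomD[OF *(4)] HomD[OF *(5)]
  show ?case unfolding F F' exseq_sum_simps
    by (rule emor.Cons[OF arr_sum_conflation[OF Cons(1) *(1)] arr_sum_conflation[OF Cons(2) *(2)] _ _ _ _ _
          Cons.IH[OF *(8)], where u = "arr_sum A u v"])
      (use d(1-3,8-10,15-17,22-24) e Cons.prems(2) F Cons(6,7) *(6,7) in \<open>auto intro!: HomI simp: arr_sum_comp\<close>)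
qed

lemma seq_sum:
  assumes "seq A C E Y X" "seq A C F Y' X'" "length E = length F"
  shows "seq A C (exseq_sum A E F) (bpo Y Y') (bpo X X')"
  using emor_ends(1)[OF emor_sum[OF emor_idm[OF assms(1)] emor_idm[OF assms(2)] assms(3)]]
    seq_ends[OF assms(1)] seq_ends[OF assms(2)] by simp

lemma emor_pr:
  assumes "seq A C E Y X" "seq A C F Y' X'" "length E = length F"
  shows "emor A C (exseq_sum A E F) E (pr1 Y Y') (pr1 X X')" "emor A C (exseq_sum A E F) F (pr2 Y Y') (pr2 X X')"
  using assms
proof (induction E arbitrary: F Y Y')
  case Nil
  { case 1 then show ?case by (auto intro!: emor.Nil) next
    case 2 then show ?case by (auto intro!: emor.Nil) }
next
  case (Cons c E)
  obtain i p where c: "c = (i, p)" by force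
  { case 1
    then obtain j q F1 where F: "F = (j, q) # F1" by (cases F) auto
    have ip: "conflation A C i p" "src A i = Y" "seq A C E (tgt A p) X" using 1 c by auto
    have jq: "conflation A C j q" "src A j = Y'" "seq A C F1 (tgt A q) X'" "length E = length F1" using 1 F by auto
    note d = conflationD[OF ip(1)] conflationD[OF jq(1)]
    show ?case unfolding c F exseq_sum_simps
      by (rule emor.Cons[OF arr_sum_conflation[OF ip(1) jq(1)] ip(1) _ _ _ _ _ Cons.IH(1)[OF ip(3) jq(3,4)],
            where u = "pr1 (tgt A i) (tgt A j)"])
        (use ip(2) jq(2) d in \<open>auto intro!: HomI\<close>)
  next
    case 2
    then obtain j q F1 where F: "F = (j, q) # F1" by (cases F) auto
    have ip: "conflation A C i p" "src A i = Y" "seq A C E (tgt A p) X" using 2 c by auto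
    have jq: "conflation A C j q" "src A j = Y'" "seq A C F1 (tgt A q) X'" "length E = length F1" using 2 F by auto
    note d = conflationD[OF ip(1)] conflationD[OF jq(1)]
    show ?case unfolding c F exseq_sum_simps
      by (rule emor.Cons[OF arr_sum_conflation[OF ip(1) jq(1)] jq(1) _ _ _ _ _ Cons.IH(2)[OF ip(3) jq(3,4)],
            where u = "pr2 (tgt A i) (tgt A j)"])
        (use ip(2) jq(2) d in \<open>auto intro!: HomI\<close>) }
qed

lemma emor_diagonal: "seq A C E Y X \<Longrightarrow> emor A C E (exseq_sum A E E) (diagonal A Y) (diagonal A X)"
proof (induction E arbitrary: Y)
  case (Cons c E)
  obtain i p where c: "c = (i, p)" by force
  have ip: "conflation A C i p" "src A i = Y" "seq A C E (tgt A p) X" using Cons c by auto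
  note d = conflationD[OF ip(1)]
  show ?case unfolding c exseq_sum_simps
    by (rule emor.Cons[OF ip(1) arr_sum_conflation[OF ip(1,1)] _ _ _ _ _ Cons.IH[OF ip(3)], where u = "diagonal A (tgt A i)"])
      (use ip(2) d diagonal_natural[of i] diagonal_natural[of p] in \<open>auto intro!: HomI\<close>)
qed (auto intro!: emor.Nil)

lemma emor_codiagonal: "seq A C E Y X \<Longrightarrow> emor A C (exseq_sum A E E) E (codiagonal A Y) (codiagonal A X)"
proof (induction E arbitrary: Y)
  case (Cons c E)
  obtain i p where c: "c = (i, p)" by force
  have ip: "conflation A C i p" "src A i = Y" "seq A C E (tgt A p) X" using Cons c by auto
  note d = conflationD[OF ip(1)]
  show ?case unfolding c exseq_sum_simps
    by (rule emor.Cons[OF arr_sum_conflation[OF ip(1,1)] ip(1) _ _ _ _ _ Cons.IH[OF ip(3)], where u = "codiagonal A (tgt A i)"])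
      (use ip(2) d codiagonal_natural[of i] codiagonal_natural[of p] in \<open>auto intro!: HomI\<close>)
qed (auto intro!: emor.Nil)

abbreviation "bsum X Y c d \<equiv> baer_sum A C X Y c d"

lemma cls_exseq_sum:
  assumes E: "seq A C E Y X" "E \<noteq> []" and F: "seq A C F Y X" "length F = length E"
    and E': "E' \<in> cls E" and F': "F' \<in> cls F"
  shows "cls (exseq_sum A E' F') = cls (exseq_sum A E F)"
proof -
  note e = ext_class_mem[OF E'] and f = ext_class_mem[OF F']
  have Fn: "F \<noteq> []" using E F by auto
  have C: "X \<in> C" "Y \<in> C" using seq_ends[OF E(1)] by auto
  have E's: "seq A C E' Y X" "length E' = length E" using cls_eq_seq[OF e(3)[symmetric] E e(1)] by auto
  \<comment> \<open>\<open>cls_invariant\<close> provides no information on lengths, so pairs of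
    unequal length get a dummy value.\<close>
  have 1: "cls (if length G = length F then exseq_sum A G F else []) = cls (if length G' = length F then exseq_sum A G' F else [])"
    if "seq A C F Y X" "G \<noteq> []" "G' \<noteq> []" "seq A C G Y X" "seq A C G' Y X" "emor A C G G' (idm A Y) (idm A X)" for G G' F
    using emor_ends(5)[OF that(6)] that(2) C emor_sum[OF that(6) emor_idm[OF that(1)]] 
      cls_eqI[OF seq_sum[OF that(4,1)], of "exseq_sum A G' F"] by (auto simp: arr_sum_idm)
  have 2: "cls (if length G = length F then exseq_sum A F G else []) = cls (if length G' = length F then exseq_sum A F G' else [])"
    if "seq A C F Y X" "G \<noteq> []" "G' \<noteq> []" "seq A C G Y X" "seq A C G' Y X" "emor A C G G' (idm A Y) (idm A X)" for G G' F
    using emor_ends(5)[OF that(6)] that(2) C emor_sum[OF emor_idm[OF that(1)] that(6)]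
      cls_eqI[OF seq_sum[OF that(1,4)], of "exseq_sum A F G'"] by (cases "F = []") (auto simp: arr_sum_idm)
  have "cls (exseq_sum A E F) = cls (exseq_sum A E' F)"
    using cls_invariant[OF e(3)[symmetric] E e(1), of "\<lambda>G. cls (if length G = length F then exseq_sum A G F else [])"] 
      1[OF F(1)] F(2) E's(2) by force
  moreover have "cls (exseq_sum A E' F) = cls (exseq_sum A E' F')"
    using cls_invariant[OF f(3)[symmetric] F(1) Fn f(1), of "\<lambda>G. cls (if length G = length E' then exseq_sum A E' G else [])"]
      2[OF E's(1)] cls_eq_seq(2)[OF f(3)[symmetric] F(1) Fn f(1)] F(2) E's(2) by force
  ultimately show ?thesis by simp
qed

lemma bsum_cls:
  assumes E: "seq A C E Y X" "E \<noteq> []" and F: "seq A C F Y X" "length F = length E"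
  shows "bsum X Y (cls E) (cls F) = push (codiagonal A Y) (pull (cls (exseq_sum A E F)) (diagonal A X))"
proof -
  have "F \<noteq> []" using E F by auto
  then have "E \<in> cls E" "F \<in> cls F" using cls_self E F by blast+
  then have ne: "cls E \<noteq> {}" "cls F \<noteq> {}" by blast+
  have "bsum X Y (cls E) (cls F) = (\<Union>E'\<in>cls E. \<Union>F'\<in>cls F. push (codiagonal A Y) (pull (cls (exseq_sum A E F)) (diagonal A X)))"
    unfolding baer_sum_def by (intro SUP_cong refl) (simp add: cls_exseq_sum[OF E F])
  then show ?thesis using ne by simp
qed

lemma bsum_exists:
  assumes E: "seq A C E Y X" "E \<noteq> []" and F: "seq A C F Y X" "length F = length E"
  obtains S T where "emor A C S (exseq_sum A E F) (idm A (bpo Y Y)) (diagonal A X)"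
    "emor A C S T (codiagonal A Y) (idm A X)" "seq A C S (bpo Y Y) X" "seq A C T Y X" "T \<noteq> []" "S \<noteq> []" "length T = length E"
    "bsum X Y (cls E) (cls F) = cls T"
    "\<And>G k g. emor A C G (exseq_sum A E F) g (diagonal A X \<cdot> k) \<Longrightarrow> k \<in> Arr A \<Longrightarrow> tgt A k = X \<Longrightarrow> emor A C G S g k"
    "\<And>G k h. emor A C S G (k \<cdot> codiagonal A Y) h \<Longrightarrow> k \<in> Arr A \<Longrightarrow> src A k = Y \<Longrightarrow> emor A C T G k h"
proof -
  have C: "X \<in> C" "Y \<in> C" using seq_ends[OF E(1)] by auto
  have s: "seq A C (exseq_sum A E F) (bpo Y Y) (bpo X X)" "exseq_sum A E F \<noteq> []" "length (exseq_sum A E F) = length E"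
    using seq_sum[OF E(1) F(1)] E(2) F(2) by auto
  have dX: "diagonal A X \<in> Hom A X (bpo X X)" and dY: "codiagonal A Y \<in> Hom A (bpo Y Y) Y"
    using C by (auto intro!: HomI)
  obtain S where S: "emor A C S (exseq_sum A E F) (idm A (bpo Y Y)) (diagonal A X)" "seq A C S (bpo Y Y) X" "S \<noteq> []"
    "pull (cls (exseq_sum A E F)) (diagonal A X) = cls S" "length S = length (exseq_sum A E F)"
    "\<And>G k g. emor A C G (exseq_sum A E F) g (diagonal A X \<cdot> k) \<Longrightarrow> k \<in> Arr A \<Longrightarrow> tgt A k = X \<Longrightarrow> emor A C G S g k"
    using pull_exists[OF s(1,2) dX C(1)] by blast
  obtain T where T: "emor A C S T (codiagonal A Y) (idm A X)" "seq A C T Y X" "T \<noteq> []" "push (codiagonal A Y) (cls S) = cls T"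
    "length T = length S"
    "\<And>G k h. emor A C S G (k \<cdot> codiagonal A Y) h \<Longrightarrow> k \<in> Arr A \<Longrightarrow> src A k = Y \<Longrightarrow> emor A C T G k h"
    using push_exists[OF S(2,3) dY C(2)] by blast
  show ?thesis by (rule that[OF S(1) T(1) S(2) T(2,3) S(3)]) (use S T s bsum_cls[OF E F] in simp_all)
qed

lemma bsum_XT [intro]: "c \<in> XT t X Y \<Longrightarrow> d \<in> XT t X Y \<Longrightarrow> bsum X Y c d \<in> XT t X Y"
  by (elim XT_E) (metis bsum_exists XT_I)

text \<open>The diagonal of E followed by the sum of the two push-out morphisms lies over the
  diagonal of X, hence factors through the pull-back in the Baer sum; the codiagonal then turns its
  left component into f + g.\<close>

lemma push_add:
  assumes c: "c \<in> XT t X W" and f: "f \<in> Hom A W Y" and g: "g \<in> Hom A W Y" and Y: "Y \<in> C"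
  shows "push (f \<boxplus> g) c = bsum X Y (push f c) (push g c)"
proof -
  obtain E where E: "E \<noteq> []" "seq A C E W X" "c = cls E" using XT_E[OF c] by metis
  have C: "W \<in> C" "X \<in> C" using seq_ends[OF E(2)] by auto
  note fD = HomD[OF f] and gD = HomD[OF g]
  obtain F where F: "emor A C E F f (idm A X)" "seq A C F Y X" "F \<noteq> []" "push f (cls E) = cls F" "length F = length E"
    using push_exists[OF E(2,1) f Y] by metis
  obtain G where G: "emor A C E G g (idm A X)" "seq A C G Y X" "G \<noteq> []" "push g (cls E) = cls G" "length G = length E"
    using push_exists[OF E(2,1) g Y] by metis
  obtain S T where S: "emor A C S T (codiagonal A Y) (idm A X)" "bsum X Y (cls F) (cls G) = cls T"
    "\<And>H k g. emor A C H (exseq_sum A F G) g (diagonal A X \<cdot> k) \<Longrightarrow> k \<in> Arr A \<Longrightarrow> tgt A k = X \<Longrightarrow> emor A C H S g k"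
    using bsum_exists[OF F(2,3) G(2)] G(5) F(5) by metis
  have "emor A C E (exseq_sum A F G) (arr_sum A f g \<cdot> diagonal A W) (arr_sum A (idm A X) (idm A X) \<cdot> diagonal A X)"
    by (rule emor_comp[OF emor_diagonal[OF E(2)] emor_sum[OF F(1) G(1)]]) (use fD gD C in auto)
  then have "emor A C E S (arr_sum A f g \<cdot> diagonal A W) (idm A X)"
    using S(3)[of E _ "idm A X"] C by (simp add: arr_sum_idm)
  from emor_comp[OF this S(1)] have "emor A C E T (f \<boxplus> g) (idm A X)"
    using codiagonal_arr_sum_diagonal[of f g] fD gD C Y by simp
  then show ?thesis using push_cls[OF _ E(2,1)] S(2) F(4) G(4) E(3) by simp
qed

text \<open>Duality does not give this literally, since the Baer sum of the opposite category uses
  its own chosen biproducts. The argument for \<open>push_add\<close> is mirrored, with the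
  codiagonal of E and the universal property of the push-out.\<close>

lemma pull_add:
  assumes c: "c \<in> XT t W Y" and f: "f \<in> Hom A X W" and g: "g \<in> Hom A X W" and X: "X \<in> C"
  shows "pull c (f \<boxplus> g) = bsum X Y (pull c f) (pull c g)"
proof -
  obtain E where E: "E \<noteq> []" "seq A C E Y W" "c = cls E" using XT_E[OF c] by metis
  have C: "W \<in> C" "Y \<in> C" using seq_ends[OF E(2)] by auto
  note fD = HomD[OF f] and gD = HomD[OF g]
  obtain F where F: "emor A C F E (idm A Y) f" "seq A C F Y X" "F \<noteq> []" "pull (cls E) f = cls F" "length F = length E"
    using pull_exists[OF E(2,1) f X] by metis
  obtain G where G: "emor A C G E (idm A Y) g" "seq A C G Y X" "G \<noteq> []" "pull (cls E) g = cls G" "length G = length E"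
    using pull_exists[OF E(2,1) g X] by metis
  have l: "length G = length F" using F G by simp
  obtain S T where S: "emor A C S (exseq_sum A F G) (idm A (bpo Y Y)) (diagonal A X)" "bsum X Y (cls F) (cls G) = cls T"
    "\<And>G k h. emor A C S G (k \<cdot> codiagonal A Y) h \<Longrightarrow> k \<in> Arr A \<Longrightarrow> src A k = Y \<Longrightarrow> emor A C T G k h"
    "seq A C T Y X" "T \<noteq> []"
    by (rule bsum_exists[OF F(2,3) G(2) l]) blast
  have 1: "emor A C (exseq_sum A F G) E (codiagonal A Y \<cdot> arr_sum A (idm A Y) (idm A Y)) (codiagonal A W \<cdot> arr_sum A f g)"
    by (rule emor_comp[OF emor_sum[OF F(1) G(1)] emor_codiagonal[OF E(2)]]) (use fD gD C l in auto)
  have "emor A C S E (codiagonal A Y) (f \<boxplus> g)"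
    using emor_comp[OF S(1) 1] codiagonal_arr_sum_diagonal[of f g] fD gD C X by (simp add: arr_sum_idm)
  then have "emor A C T E (idm A Y) (f \<boxplus> g)" using S(3)[of E "idm A Y"] C by simp
  then show ?thesis using pull_cls[OF _ E(2,1)] S(2) F(4) G(4) E(3) by simp
qed

text \<open>A pair of classes is the image of a single class under two morphisms. Hence all laws for
  \<open>bsum\<close> follow from the additivity of \<open>push\<close> in its morphism argument.\<close>

lemma pair_class:
  assumes a: "a \<in> XT t X Y" and b: "b \<in> XT t X Y'"
  obtains d where "d \<in> XT t X (bpo Y Y')" "push (pr1 Y Y') d = a" "push (pr2 Y Y') d = b"
proof -
  obtain E where E: "E \<noteq> []" "seq A C E Y X" "length E = t" "a = cls E" using XT_E[OF a] by metis
  obtain F where F: "F \<noteq> []" "seq A C F Y' X" "length F = t" "b = cls F" using XT_E[OF b] by metis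
  have C: "X \<in> C" "Y \<in> C" "Y' \<in> C" using seq_ends E F by fast+
  have s: "seq A C (exseq_sum A E F) (bpo Y Y') (bpo X X)" "exseq_sum A E F \<noteq> []" "length (exseq_sum A E F) = t"
    using seq_sum[OF E(2) F(2)] E F by auto
  have dX: "diagonal A X \<in> Hom A X (bpo X X)" using C by (auto intro!: HomI)
  have sx: "cls (exseq_sum A E F) \<in> XT t (bpo X X) (bpo Y Y')" using XT_I[OF s(2,1)] s(3) by simp
  have p: "pr1 Y Y' \<in> Hom A (bpo Y Y') Y" "pr2 Y Y' \<in> Hom A (bpo Y Y') Y'"
    "pr1 X X \<in> Hom A (bpo X X) X" "pr2 X X \<in> Hom A (bpo X X) X" using C by (auto intro!: HomI)
  let ?d = "pull (cls (exseq_sum A E F)) (diagonal A X)"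
  note m = emor_pr[OF E(2) F(2)]
  have "push (pr1 Y Y') ?d = pull (push (pr1 Y Y') (cls (exseq_sum A E F))) (diagonal A X)"
    by (rule push_pull[OF sx p(1) C(2) dX C(1)])
  also have "\<dots> = pull (pull a (pr1 X X)) (diagonal A X)" using push_pull_emor[OF m(1) s(2)] E F by simp
  also have "\<dots> = a" using pull_pull[OF a p(3) dX] C pull_idm[OF a] by simp
  finally have 1: "push (pr1 Y Y') ?d = a" .
  have "push (pr2 Y Y') ?d = pull (push (pr2 Y Y') (cls (exseq_sum A E F))) (diagonal A X)"
    by (rule push_pull[OF sx p(2) C(3) dX C(1)])
  also have "\<dots> = pull (pull b (pr2 X X)) (diagonal A X)" using push_pull_emor[OF m(2) s(2)] E F by simp
  also have "\<dots> = b" using pull_pull[OF b p(4) dX] C pull_idm[OF b] by simp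
  finally have 2: "push (pr2 Y Y') ?d = b" .
  show ?thesis by (rule that[OF _ 1 2]) (use pull_XT[OF sx dX C(1)] in simp)
qed

lemma pair_sum:
  assumes a: "a \<in> XT t X Y" and b: "b \<in> XT t X Y"
  obtains d where "d \<in> XT t X (bpo Y Y)" "push (pr1 Y Y) d = a" "push (pr2 Y Y) d = b"
    "\<And>Y' g. g \<in> Hom A Y Y' \<Longrightarrow> Y' \<in> C \<Longrightarrow> push g (bsum X Y a b) = push ((g \<cdot> pr1 Y Y) \<boxplus> (g \<cdot> pr2 Y Y)) d"
    "bsum X Y a b = push (pr1 Y Y \<boxplus> pr2 Y Y) d"
proof -
  obtain d where d: "d \<in> XT t X (bpo Y Y)" "push (pr1 Y Y) d = a" "push (pr2 Y Y) d = b"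
    using pair_class[OF a b] .
  have Y: "Y \<in> C" using XT_ends[OF a] by simp
  have p: "pr1 Y Y \<in> Hom A (bpo Y Y) Y" "pr2 Y Y \<in> Hom A (bpo Y Y) Y" "pr1 Y Y \<boxplus> pr2 Y Y \<in> Hom A (bpo Y Y) Y"
    using Y by (auto intro!: HomI)
  have s: "bsum X Y a b = push (pr1 Y Y \<boxplus> pr2 Y Y) d" using push_add[OF d(1) p(1,2) Y] d by simp
  show ?thesis
  proof (rule that[OF d _ s])
    fix Y' g assume g: "g \<in> Hom A Y Y'" "Y' \<in> C"
    show "push g (bsum X Y a b) = push ((g \<cdot> pr1 Y Y) \<boxplus> (g \<cdot> pr2 Y Y)) d"
      using push_push[OF d(1) p(3) g(1) Y g(2)] s HomD[OF g(1)] Y by simp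
  qed
qed

lemma push_bsum:
  assumes a: "a \<in> XT t X Y" and b: "b \<in> XT t X Y" and g: "g \<in> Hom A Y Y'" "Y' \<in> C"
  shows "push g (bsum X Y a b) = bsum X Y' (push g a) (push g b)"
proof -
  obtain d where d: "d \<in> XT t X (bpo Y Y)" "push (pr1 Y Y) d = a" "push (pr2 Y Y) d = b"
    "\<And>Y' g. g \<in> Hom A Y Y' \<Longrightarrow> Y' \<in> C \<Longrightarrow> push g (bsum X Y a b) = push ((g \<cdot> pr1 Y Y) \<boxplus> (g \<cdot> pr2 Y Y)) d"
    using pair_sum[OF a b] by metis
  have Y: "Y \<in> C" using XT_ends[OF a] by simp
  have p: "pr1 Y Y \<in> Hom A (bpo Y Y) Y" "pr2 Y Y \<in> Hom A (bpo Y Y) Y" using Y by (auto intro!: HomI)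
  have gp: "g \<cdot> pr1 Y Y \<in> Hom A (bpo Y Y) Y'" "g \<cdot> pr2 Y Y \<in> Hom A (bpo Y Y) Y'" using comp_in p g by auto
  show ?thesis
    using d(4)[OF g] push_add[OF d(1) gp g(2)] push_push[OF d(1) p(1) g(1) Y g(2)] push_push[OF d(1) p(2) g(1) Y g(2)] d(2,3)
    by simp
qed

lemma pull_bsum:
  assumes a: "a \<in> XT t X Y" and b: "b \<in> XT t X Y" and h: "h \<in> Hom A X' X" "X' \<in> C"
  shows "pull (bsum X Y a b) h = bsum X' Y (pull a h) (pull b h)"
proof -
  obtain d where d: "d \<in> XT t X (bpo Y Y)" "push (pr1 Y Y) d = a" "push (pr2 Y Y) d = b"
    "bsum X Y a b = push (pr1 Y Y \<boxplus> pr2 Y Y) d"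
    using pair_sum[OF a b] by metis
  have Y: "Y \<in> C" using XT_ends[OF a] by simp
  have p: "pr1 Y Y \<in> Hom A (bpo Y Y) Y" "pr2 Y Y \<in> Hom A (bpo Y Y) Y" "pr1 Y Y \<boxplus> pr2 Y Y \<in> Hom A (bpo Y Y) Y"
    using Y by (auto intro!: HomI)
  have "pull (bsum X Y a b) h = push (pr1 Y Y \<boxplus> pr2 Y Y) (pull d h)"
    using push_pull[OF d(1) p(3) Y h] d(4) by simp
  then show ?thesis
    using push_add[OF pull_XT[OF d(1) h] p(1,2) Y] push_pull[OF d(1) p(1) Y h] push_pull[OF d(1) p(2) Y h] d(2,3) by simp
qed

lemma splice_bsum_left:
  assumes a: "a \<in> XT s Y Z" and b: "b \<in> XT s Y Z" and c: "c \<in> XT t X Y"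
  shows "splice (bsum Y Z a b) c = bsum X Z (splice a c) (splice b c)"
proof -
  obtain d where d: "d \<in> XT s Y (bpo Z Z)" "push (pr1 Z Z) d = a" "push (pr2 Z Z) d = b"
    "bsum Y Z a b = push (pr1 Z Z \<boxplus> pr2 Z Z) d"
    using pair_sum[OF a b] by metis
  have Z: "Z \<in> C" using XT_ends[OF a] by simp
  have p: "pr1 Z Z \<in> Hom A (bpo Z Z) Z" "pr2 Z Z \<in> Hom A (bpo Z Z) Z" "pr1 Z Z \<boxplus> pr2 Z Z \<in> Hom A (bpo Z Z) Z"
    using Z by (auto intro!: HomI)
  have "splice (bsum Y Z a b) c = push (pr1 Z Z \<boxplus> pr2 Z Z) (splice d c)"
    using push_splice[OF d(1) c p(3) Z] d(4) by simp
  then show ?thesis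
    using push_add[OF splice_XT[OF d(1) c] p(1,2) Z] push_splice[OF d(1) c p(1) Z] push_splice[OF d(1) c p(2) Z] d(2,3) by simp
qed

text \<open>The sum is a push-out of one class along pr1 + pr2. \<open>splice_middle\<close> moves
  this arrow to the left factor, where \<open>pull_add\<close> and distributivity on the left
  apply.\<close>

lemma splice_bsum_right:
  assumes c: "c \<in> XT s Y Z" and a: "a \<in> XT t X Y" and b: "b \<in> XT t X Y"
  shows "splice c (bsum X Y a b) = bsum X Z (splice c a) (splice c b)"
proof -
  obtain d where d: "d \<in> XT t X (bpo Y Y)" "push (pr1 Y Y) d = a" "push (pr2 Y Y) d = b"
    "bsum X Y a b = push (pr1 Y Y \<boxplus> pr2 Y Y) d"
    using pair_sum[OF a b] by metis
  have Y: "Y \<in> C" using XT_ends[OF a] by simp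
  have p: "pr1 Y Y \<in> Hom A (bpo Y Y) Y" "pr2 Y Y \<in> Hom A (bpo Y Y) Y" "pr1 Y Y \<boxplus> pr2 Y Y \<in> Hom A (bpo Y Y) Y"
    using Y by (auto intro!: HomI)
  have YY: "bpo Y Y \<in> C" using Y by simp
  have "splice c (bsum X Y a b) = splice (pull c (pr1 Y Y \<boxplus> pr2 Y Y)) d"
    using splice_middle[OF c d(1) p(3)] d(4) by simp
  also have "\<dots> = splice (bsum (bpo Y Y) Z (pull c (pr1 Y Y)) (pull c (pr2 Y Y))) d"
    using pull_add[OF c p(1,2) YY] by simp
  also have "\<dots> = bsum X Z (splice (pull c (pr1 Y Y)) d) (splice (pull c (pr2 Y Y)) d)"
    by (rule splice_bsum_left[OF pull_XT[OF c p(1) YY] pull_XT[OF c p(2) YY] d(1)])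
  finally show ?thesis using splice_middle[OF c d(1) p(1)] splice_middle[OF c d(1) p(2)] d(2,3) by simp
qed

lemma bsum_assoc:
  assumes a: "a \<in> XT t X Y" and b: "b \<in> XT t X Y" and c: "c \<in> XT t X Y"
  shows "bsum X Y (bsum X Y a b) c = bsum X Y a (bsum X Y b c)"
proof -
  have Y: "Y \<in> C" using XT_ends[OF a] by simp
  obtain d where d: "d \<in> XT t X (bpo Y Y)" "push (pr1 Y Y) d = a" "push (pr2 Y Y) d = b" using pair_class[OF a b] .
  obtain e where e: "e \<in> XT t X (bpo (bpo Y Y) Y)" "push (pr1 (bpo Y Y) Y) e = d" "push (pr2 (bpo Y Y) Y) e = c"
    using pair_class[OF d(1) c] .
  let ?f = "pr1 Y Y \<cdot> pr1 (bpo Y Y) Y" and ?g = "pr2 Y Y \<cdot> pr1 (bpo Y Y) Y" and ?h = "pr2 (bpo Y Y) Y"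
  have H: "?f \<in> Hom A (bpo (bpo Y Y) Y) Y" "?g \<in> Hom A (bpo (bpo Y Y) Y) Y" "?h \<in> Hom A (bpo (bpo Y Y) Y) Y"
    "?f \<boxplus> ?g \<in> Hom A (bpo (bpo Y Y) Y) Y" "?g \<boxplus> ?h \<in> Hom A (bpo (bpo Y Y) Y) Y"
    using Y by (auto intro!: HomI)
  have p: "pr1 (bpo Y Y) Y \<in> Hom A (bpo (bpo Y Y) Y) (bpo Y Y)" "pr1 Y Y \<in> Hom A (bpo Y Y) Y" "pr2 Y Y \<in> Hom A (bpo Y Y) Y"
    using Y by (auto intro!: HomI)
  have abc: "push ?f e = a" "push ?g e = b" "push ?h e = c"
    using push_push[OF e(1) p(1,2) _ Y] push_push[OF e(1) p(1,3) _ Y] d e Y by simp_all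
  have "bsum X Y (bsum X Y a b) c = push ((?f \<boxplus> ?g) \<boxplus> ?h) e"
    using push_add[OF e(1) H(4,3) Y] push_add[OF e(1) H(1,2) Y] abc by simp
  also have "(?f \<boxplus> ?g) \<boxplus> ?h = ?f \<boxplus> (?g \<boxplus> ?h)" by (rule hadd_assoc) (use Y in auto)
  also have "push (?f \<boxplus> (?g \<boxplus> ?h)) e = bsum X Y a (bsum X Y b c)"
    using push_add[OF e(1) H(1,5) Y] push_add[OF e(1) H(2,3) Y] abc by simp
  finally show ?thesis .
qed

lemma Ext_simps [simp]: "carrier (Ext A C t X Y) = XT t X Y" "mult (Ext A C t X Y) = baer_sum A C X Y"
  "one (Ext A C t X Y) = zer t X Y"
  by (simp_all add: Ext_def)

lemma bsum_zer_left: "c \<in> XT t X Y \<Longrightarrow> bsum X Y (zer t X Y) c = c"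
proof -
  assume c: "c \<in> XT t X Y"
  have Y: "Y \<in> C" "hzero A Y Y \<in> Hom A Y Y" "idm A Y \<in> Hom A Y Y" using XT_ends[OF c] by (auto intro!: HomI)
  show ?thesis using push_add[OF c Y(2,3,1)] push_zero[OF c Y(1)] push_idm[OF c] Y(1) by simp
qed

lemma Ext_group:
  assumes "t \<ge> 1" "X \<in> C" "Y \<in> C"
  shows "group (Ext A C t X Y)"
proof (rule groupI)
  fix c assume "c \<in> carrier (Ext A C t X Y)"
  then have c: "c \<in> XT t X Y" by simp
  have n: "neg (idm A Y) \<in> Hom A Y Y" "idm A Y \<in> Hom A Y Y" using assms by (auto intro!: HomI)
  have "bsum X Y (push (neg (idm A Y)) c) c = push (neg (idm A Y) \<boxplus> idm A Y) c"
    using push_add[OF c n assms(3)] push_idm[OF c] by simp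
  also have "\<dots> = zer t X Y" using push_zero[OF c assms(3)] assms by simp
  finally show "\<exists>y\<in>carrier (Ext A C t X Y). y \<otimes>\<^bsub>Ext A C t X Y\<^esub> c = \<one>\<^bsub>Ext A C t X Y\<^esub>"
    using push_XT[OF c n(1) assms(3)] by (intro bexI[of _ "push (neg (idm A Y)) c"]) simp_all
qed (use zer_XT[OF assms] in \<open>auto simp: bsum_assoc bsum_zer_left\<close>)

end

section \<open>Exactness of Yoneda extensions in both arguments\<close>

section \<open>Long exact sequences\<close>

context extension_closed_subcategory
begin

lemma cls_single: "conflation A C i p \<Longrightarrow> cls [(i, p)] \<in> XT 1 (tgt A p) (src A i)"
  using XT_I[of "[(i, p)]" "src A i" "tgt A p"] conflationD(7)[of i p] by simp

lemma XT_single: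
  assumes "c \<in> XT 1 X Y"
  obtains i p where "conflation A C i p" "src A i = Y" "tgt A p = X" "c = cls [(i, p)]"
proof -
  obtain E where E: "seq A C E Y X" "length E = 1" "c = cls E" using XT_E[OF assms] by metis
  obtain i p where "E = [(i, p)]" using E(2) by (metis length_0_conv length_Suc_conv One_nat_def surj_pair)
  then show ?thesis using that[of i p] E by simp
qed

lemma XT_Suc:
  assumes "c \<in> XT (Suc t) X Z" "t \<ge> 1"
  obtains Y d e where "Y \<in> C" "d \<in> XT 1 Y Z" "e \<in> XT t X Y" "c = splice d e"
  using splice_decompose[of c 1 t X Z] assms by auto

lemma emor_singleI:
  assumes "conflation A C i p" "conflation A C i' p'" "g \<in> Hom A (src A i) (src A i')"
    "u \<in> Hom A (tgt A i) (tgt A i')" "k \<in> Hom A (tgt A p) (tgt A p')" "u \<cdot> i = i' \<cdot> g" "k \<cdot> p = p' \<cdot> u"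
  shows "emor A C [(i, p)] [(i', p')] g k"
  by (rule emor.Cons[OF assms emor.Nil]) (use assms(5) conflationD(7)[OF assms(1)] conflationD(7)[OF assms(2)] in \<open>auto simp: Hom_def\<close>)

lemma emor_singleE:
  assumes "emor A C ((i, p) # E) F g h"
  obtains i' p' F' u k where "F = (i', p') # F'" "conflation A C i p" "conflation A C i' p'"
    "g \<in> Arr A" "src A g = src A i" "tgt A g = src A i'"
    "u \<in> Arr A" "src A u = tgt A i" "tgt A u = tgt A i'" 
    "k \<in> Arr A" "src A k = tgt A p" "tgt A k = tgt A p'" "u \<cdot> i = i' \<cdot> g" "k \<cdot> p = p' \<cdot> u" "emor A C E F' k h"
proof -
  obtain i' p' u k F' where "F = (i', p') # F'" "conflation A C i p" "conflation A C i' p'" "g \<in> Hom A (src A i) (src A i')"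
    "u \<in> Hom A (tgt A i) (tgt A i')" "k \<in> Hom A (tgt A p) (tgt A p')" "u \<cdot> i = i' \<cdot> g" "k \<cdot> p = p' \<cdot> u" "emor A C E F' k h"
    using assms by (elim emor_ConsE) blast
  then show ?thesis using that[of i' p' F' u k] by (simp add: Hom_def)
qed

text \<open>The existence of a retraction is carried along the zigzag from the zero sequence.
  Against a morphism, a retraction is composed with the middle component; in its direction, the
  retraction is first converted into a section, the section is composed, and the result converted
  back.\<close>

lemma split_of_zero:
  assumes c: "conflation A C i p" and z: "cls [(i, p)] = zer 1 (tgt A p) (src A i)"
  obtains r where "r \<in> Arr A" "src A r = tgt A i" "tgt A r = src A i" "r \<cdot> i = idm A (src A i)"
proof -
  let ?Y = "src A i" and ?X = "tgt A p"
  \<comment> \<open>The guard makes the property vacuous for sequences of other lengths, about which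
    \<open>cls_invariant\<close> also asks.\<close>
  define P where "P E \<longleftrightarrow> length E = 1 \<longrightarrow> (\<exists>r\<in>Arr A. src A r = tgt A (fst (hd E)) \<and> tgt A r = ?Y \<and> r \<cdot> fst (hd E) = idm A ?Y)"
    for E :: "'m exseq"
  have C: "?Y \<in> C" "?X \<in> C" using conflationD[OF c] by auto
  have z1: "zero_exseq A 1 ?X ?Y = [(in1 ?Y ?X, pr2 ?Y ?X)]" by (simp add: zero_exseq_Suc)
  have s: "seq A C [(i, p)] ?Y ?X" using c C by simp
  have "P [(i, p)] = P (zero_exseq A 1 ?X ?Y)"
  proof (rule cls_invariant[OF z s])
    show "zero_exseq A 1 ?X ?Y \<in> exseqs A C"
      using zero_exseq_seq[of 1, OF _ C(2,1)] exseqs_iff[of "zero_exseq A 1 ?X ?Y" A C] by blast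
    fix E F assume EF: "E \<noteq> []" "F \<noteq> []" "seq A C E ?Y ?X" "seq A C F ?Y ?X" "emor A C E F (idm A ?Y) (idm A ?X)"
    show "P E = P F"
    proof (cases "length E = 1")
      case True
      then obtain j q where E: "E = [(j, q)]" by (metis length_0_conv length_Suc_conv One_nat_def surj_pair)
      have "length F = 1" using emor_ends(5)[OF EF(5)] True by simp
      then obtain j' q' where F: "F = [(j', q')]" by (metis length_0_conv length_Suc_conv One_nat_def surj_pair)
      have jq: "conflation A C j q" "src A j = ?Y" "tgt A q = ?X" "conflation A C j' q'" "src A j' = ?Y" "tgt A q' = ?X"
        using EF(3,4) E F by auto
      note d = conflationD(1-4)[OF jq(1)] conflationD(1-4)[OF jq(4)]
      obtain u k where u: "u \<in> Arr A" "src A u = tgt A j" "tgt A u = tgt A j'" "u \<cdot> j = j' \<cdot> idm A ?Y" "k \<cdot> q = q' \<cdot> u"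
        and k: "emor A C [] [] k (idm A ?X)"
        using EF(5) unfolding E F by (elim emor_singleE) (metis list.inject prod.inject)
      have "k = idm A ?X" using k by (auto elim: emor_NilE)
      then have uj: "u \<cdot> j = j'" and qu: "q' \<cdot> u = q" using u(4,5) d jq by simp_all
      have "\<exists>r'\<in>Arr A. src A r' = tgt A j' \<and> tgt A r' = ?Y \<and> r' \<cdot> j' = idm A ?Y"
        if r: "r \<in> Arr A" "src A r = tgt A j" "tgt A r = ?Y" "r \<cdot> j = idm A ?Y" for r
      proof -
        obtain s where s: "s \<in> Arr A" "src A s = tgt A q" "tgt A s = src A q" "q \<cdot> s = idm A (tgt A q)"
          using retraction_section[OF conflationE(1)[OF jq(1)] r(1,2)] r(3,4) jq(2) by metis
        have us: "q' \<cdot> (u \<cdot> s) = idm A (tgt A q')" using reassoc[OF qu, of s] s u(1-3) d jq by simp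
        have "u \<cdot> s \<in> Arr A" "src A (u \<cdot> s) = tgt A q'" "tgt A (u \<cdot> s) = src A q'" using s u(1-3) d jq by simp_all
        from section_retraction[OF conflationE(1)[OF jq(4)] this us] show ?thesis using jq(5) by metis
      qed
      moreover have "\<exists>r\<in>Arr A. src A r = tgt A j \<and> tgt A r = ?Y \<and> r \<cdot> j = idm A ?Y"
        if r: "r \<in> Arr A" "src A r = tgt A j'" "tgt A r = ?Y" "r \<cdot> j' = idm A ?Y" for r
        using r u(1-3) d jq uj by (intro bexI[of _ "r \<cdot> u"]) auto
      ultimately show ?thesis unfolding P_def E F by auto
    qed (use emor_ends(5)[OF EF(5)] in \<open>simp add: P_def\<close>)
  qed simp
  moreover have "P (zero_exseq A 1 ?X ?Y)" unfolding P_def z1 using C by (auto intro!: bexI[of _ "pr1 ?Y ?X"])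
  ultimately show ?thesis using that unfolding P_def by auto
qed

text \<open>The kernel pair of p has a diagonal and hence splits. Concretely, the arrow with
  components i and the identity from the biproduct of \<open>src A i\<close> and
  \<open>src A p\<close> lies over p.\<close>

lemma pull_own_deflation:
  assumes c: "conflation A C i p"
  shows "pull (cls [(i, p)]) p = zer 1 (src A p) (src A i)"
proof -
  note d = conflationD[OF c]
  let ?W = "src A i" and ?Z = "src A p"
  let ?u = "(i \<cdot> pr1 ?W ?Z) \<boxplus> pr2 ?W ?Z"
  have u: "?u \<in> Hom A (bpo ?W ?Z) ?Z" using d by (auto intro!: HomI)
  have "emor A C [(in1 ?W ?Z, pr2 ?W ?Z)] [(i, p)] (idm A ?W) p"
    by (rule emor_singleI[OF bpo_conflation c, where u = ?u])
      (use d reassoc[OF d(4)] in \<open>auto intro!: HomI\<close>)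
  then show ?thesis using pull_cls[of "[(in1 ?W ?Z, pr2 ?W ?Z)]" "[(i, p)]" ?W p "tgt A p"] c d
    by (simp add: zero_exseq_Suc)
qed

text \<open>A retraction of the split push-out, composed with the push-out arrow u on the middle
  terms, extends g.\<close>

lemma push_zero_extends:
  assumes c: "conflation A C j q" and g: "g \<in> Hom A (src A j) Y" "Y \<in> C"
    and z: "push g (cls [(j, q)]) = zer 1 (tgt A q) Y"
  obtains f where "f \<in> Arr A" "src A f = tgt A j" "tgt A f = Y" "f \<cdot> j = g"
proof -
  note d = conflationD[OF c] and gD = HomD[OF g(1)]
  obtain j' q' u where po: "conflation A C j' q'" "is_pushout A j g u j'" "q' \<cdot> u = q" "tgt A q' = tgt A q"
    using pushout_conflation[OF c gD(1,2)] gD(3) g(2) by metis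
  note p = pushoutD[OF po(2)] and d' = conflationD[OF po(1)]
  have "emor A C [(j, q)] [(j', q')] g (idm A (tgt A q))"
    by (rule emor_singleI[OF c po(1), where u = u]) (use p d d' gD po in \<open>simp_all add: Hom_def\<close>)
  then have "push g (cls [(j, q)]) = cls [(j', q')]" using push_cls[of "[(j, q)]"] c d by simp
  then have "cls [(j', q')] = zer 1 (tgt A q') (src A j')" using z po(4) p(8) gD by simp
  then obtain r where r: "r \<in> Arr A" "src A r = tgt A j'" "tgt A r = src A j'" "r \<cdot> j' = idm A (src A j')"
    using split_of_zero[OF po(1)] by metis
  have "(r \<cdot> u) \<cdot> j = g" using r p(1-9) gD reassoc[OF r(4), of g] by simp
  then show ?thesis using that[of "r \<cdot> u"] r p gD by simp
qed

text \<open>The vanishing of the push-out along p yields an extension f of p to the middle term of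
  x; the kernel of f carries the class y.\<close>

lemma push_exact_1:
  assumes c: "conflation A C i p" and x: "x \<in> XT 1 X (tgt A i)" and z: "push p x = zer 1 X (tgt A p)"
  obtains y where "y \<in> XT 1 X (src A i)" "x = push i y"
proof -
  note d = conflationD[OF c]
  obtain j q where jq: "conflation A C j q" "src A j = tgt A i" "tgt A q = X" "x = cls [(j, q)]"
    using XT_single[OF x] by metis
  note e = conflationD[OF jq(1)]
  have "p \<in> Hom A (src A j) (tgt A p)" using jq(2) d by (simp add: Hom_def)
  then obtain f where f: "f \<in> Arr A" "src A f = tgt A j" "tgt A f = tgt A p" "f \<cdot> j = p"
    using push_zero_extends[OF jq(1)] d(7) z jq(3,4) by metis
  obtain l k where lk: "conflation A C l (q \<cdot> k)" "src A l = src A i" "k \<in> Arr A" "tgt A k = tgt A j"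
    "tgt A l = src A k" "k \<cdot> l = j \<cdot> i"
    using extend_section[OF c jq(1) f] .
  note e' = conflationD[OF lk(1)]
  have "emor A C [(l, q \<cdot> k)] [(j, q)] i (idm A X)"
    by (rule emor_singleI[OF lk(1) jq(1), where u = k]) (use lk d e e' jq in \<open>auto intro!: HomI\<close>)
  then have "push i (cls [(l, q \<cdot> k)]) = x"
    using push_cls[of "[(l, q \<cdot> k)]" "[(j, q)]" i X "src A l"] lk(1) jq(3,4) lk(3,4) e e' by simp
  then show ?thesis using that[of "cls [(l, q \<cdot> k)]"] cls_single[OF lk(1)] lk(2,3,4) jq(3) e by simp
qed

text \<open>An extension f of i to the middle term of x induces g on the quotients, and this
  morphism exhibits x as a pull-back of (i, p).\<close>

lemma push_exact_connecting_1:
  assumes c: "conflation A C i p" and x: "x \<in> XT 1 X (src A i)" and z: "push i x = zer 1 X (tgt A i)"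
  obtains g where "g \<in> Hom A X (tgt A p)" "x = pull (cls [(i, p)]) g"
proof -
  note d = conflationD[OF c]
  obtain j q where jq: "conflation A C j q" "src A j = src A i" "tgt A q = X" "x = cls [(j, q)]"
    using XT_single[OF x] by metis
  note e = conflationD[OF jq(1)]
  have "i \<in> Hom A (src A j) (tgt A i)" "tgt A i \<in> C" using jq(2) d by (simp_all add: Hom_def)
  then obtain f where f: "f \<in> Arr A" "src A f = tgt A j" "tgt A f = tgt A i" "f \<cdot> j = i"
    using push_zero_extends[OF jq(1)] z jq(3,4) by metis
  have "(p \<cdot> f) \<cdot> j = hzero A (src A j) (tgt A (p \<cdot> f))" using f d e jq(2) by simp
  moreover have "p \<cdot> f \<in> Arr A" "src A (p \<cdot> f) = tgt A j" "tgt A (p \<cdot> f) = tgt A p" using f d by simp_all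
  ultimately obtain g where g: "g \<in> Arr A" "src A g = tgt A q" "tgt A g = tgt A p" "g \<cdot> q = p \<cdot> f"
    using short_exact_ext[OF conflationE(1)[OF jq(1)], of "p \<cdot> f"] by metis
  have "emor A C [(j, q)] [(i, p)] (idm A (src A i)) g"
    by (rule emor_singleI[OF jq(1) c, where u = f]) (use f g d e jq(2) in \<open>simp_all add: Hom_def\<close>)
  then have "pull (cls [(i, p)]) g = x"
    using pull_cls[of "[(j, q)]" "[(i, p)]" "src A i" g "tgt A p"] c d jq(4) by simp
  then show ?thesis using that[of g] g jq(3) by (simp add: HomI)
qed

subsection \<open>Exactness in the second argument\<close>

text \<open>That \<open>(i, p)\<close> spliced with \<open>x\<close> is zero is witnessed by a zigzag of morphisms of exact sequences; the property
  that \<open>x\<close> lifts along \<open>p\<close> is transported along the zigzag, in the backward direction by exactness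
  at the middle term of the conflation \<open>E \<rightarrow> E' \<oplus> K \<rightarrow> K'\<close> attached to the pull-back
  square of two deflations \<open>E \<rightarrow> K\<close>, \<open>E' \<rightarrow> K'\<close>.\<close>

lemma push_exact_right_step:
  assumes mid: "\<And>i p x. conflation A C i p \<Longrightarrow> x \<in> XT t X (tgt A i) \<Longrightarrow> push p x = zer t X (tgt A p) \<Longrightarrow>
      \<exists>y\<in>XT t X (src A i). x = push i y"
    and c: "conflation A C i p" and x: "x \<in> XT t X (tgt A p)"
    and z: "splice (cls [(i, p)]) x = zer (t + 1) X (src A i)"
  shows "\<exists>y\<in>XT t X (tgt A i). x = push p y"
proof -
  note d = conflationD[OF c]
  let ?W = "src A i"
  obtain E where E: "E \<noteq> []" "seq A C E (tgt A p) X" "length E = t" "x = cls E" using XT_E[OF x] by metis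
  have t: "t \<ge> 1" using XT_pos[OF x] .
  have C: "X \<in> C" "?W \<in> C" using XT_ends[OF x] d by auto
  \<comment> \<open>The first conflation takes the place of (i, p) and the tail that of x; sequences
    of other lengths satisfy the property vacuously.\<close>
  define P where "P E \<longleftrightarrow> length E = Suc t \<longrightarrow> (\<exists>y\<in>XT t X (tgt A (fst (hd E))). cls (tl E) = push (snd (hd E)) y)"
    for E :: "'m exseq"
  have s: "seq A C ((i, p) # E) ?W X" using c E by simp
  have z': "cls ((i, p) # E) = zer (t + 1) X ?W"
    using z splice_cls[of "[(i, p)]" ?W "tgt A p" E X] E c d by simp
  note z1 = zero_exseq_seq[of "t + 1" X ?W, OF _ C]
  have "P ((i, p) # E) = P (zero_exseq A (t + 1) X ?W)"
  proof (rule cls_invariant[OF z' s])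
    show "zero_exseq A (t + 1) X ?W \<in> exseqs A C"
      using z1 exseqs_iff[of "zero_exseq A (t + 1) X ?W" A C] by auto
    fix F G assume FG: "F \<noteq> []" "G \<noteq> []" "seq A C F ?W X" "seq A C G ?W X" "emor A C F G (idm A ?W) (idm A X)"
    show "P F = P G"
    proof (cases "length F = Suc t")
      case True
      obtain j q F1 where F: "F = (j, q) # F1" using FG(1) by (metis list.exhaust surj_pair)
      obtain j' q' G1 u g where G: "G = (j', q') # G1" and c': "conflation A C j q" "conflation A C j' q'"
        and u: "u \<in> Arr A" "src A u = tgt A j" "tgt A u = tgt A j'" 
        and g: "g \<in> Arr A" "src A g = tgt A q" "tgt A g = tgt A q'"
        and sq: "u \<cdot> j = j' \<cdot> idm A ?W" "g \<cdot> q = q' \<cdot> u" and m: "emor A C F1 G1 g (idm A X)"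
        using FG(5) unfolding F by (elim emor_singleE) metis
      note e = conflationD[OF c'(1)] conflationD[OF c'(2)]
      have sj: "src A j = ?W" "src A j' = ?W" using FG(3,4) F G by auto
      then have uj: "u \<cdot> j = j'" using sq e by simp
      have F1: "seq A C F1 (tgt A q) X" "length F1 = t" "F1 \<noteq> []" using FG(3) F True t by auto
      have G1: "seq A C G1 (tgt A q') X" "length G1 = t" "G1 \<noteq> []" using FG(4) G emor_ends(5)[OF m] F1 by auto
      have gF: "push g (cls F1) = cls G1" by (rule push_cls[OF m F1(1,3)])
      have F1X: "cls F1 \<in> XT t X (tgt A q)" using XT_I F1 by metis
      have H: "u \<in> Hom A (tgt A j) (tgt A j')" "q \<in> Hom A (tgt A j) (tgt A q)" "q' \<in> Hom A (tgt A j') (tgt A q')"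
        "g \<in> Hom A (tgt A q) (tgt A q')" using e u g by (auto intro!: HomI)
      have C': "tgt A j \<in> C" "tgt A q \<in> C" "tgt A j' \<in> C" "tgt A q' \<in> C" using e by auto
      have "\<exists>y\<in>XT t X (tgt A j'). cls G1 = push q' y" if y: "y \<in> XT t X (tgt A j)" "cls F1 = push q y" for y
      proof (intro bexI)
        have "cls G1 = push (g \<cdot> q) y" using gF y(2) push_push[OF y(1) H(2,4) C'(2,4)] by simp
        then show "cls G1 = push q' (push u y)" using sq(2) push_push[OF y(1) H(1,3) C'(3,4)] by simp
        show "push u y \<in> XT t X (tgt A j')" by (rule push_XT[OF y(1) H(1) C'(3)])
      qed
      moreover have "\<exists>y\<in>XT t X (tgt A j). cls F1 = push q y" if y: "y \<in> XT t X (tgt A j')" "cls G1 = push q' y" for y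
      proof -
        let ?E' = "tgt A j'" and ?K = "tgt A q"
        let ?pr1 = "pr1 ?E' ?K" and ?pr2 = "pr2 ?E' ?K"
        have bp: "is_biproduct A ?E' ?K (bpo ?E' ?K) (in1 ?E' ?K) (in2 ?E' ?K) ?pr1 ?pr2"
          using biprod_is C' by simp
        have mv: "conflation A C ((in1 ?E' ?K \<cdot> u) \<boxplus> (in2 ?E' ?K \<cdot> q)) ((q' \<cdot> ?pr1) \<boxplus> neg (g \<cdot> ?pr2))"
          (is "conflation A C ?m ?d")
          by (rule mayer_vietoris[OF c' u uj g _ bp]) (use sq in simp)
        have mD: "src A ?m = tgt A j" "tgt A ?m = bpo ?E' ?K" "tgt A ?d = tgt A q'" "?m \<in> Arr A"
          using u e C' g by auto
        obtain D where D: "D \<in> XT t X (bpo ?E' ?K)" "push ?pr1 D = y" "push ?pr2 D = cls F1"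
          using pair_class[OF y(1) F1X] .
        have pH: "?pr1 \<in> Hom A (bpo ?E' ?K) ?E'" "?pr2 \<in> Hom A (bpo ?E' ?K) ?K"
          "q' \<cdot> ?pr1 \<in> Hom A (bpo ?E' ?K) (tgt A q')" "g \<cdot> ?pr2 \<in> Hom A (bpo ?E' ?K) (tgt A q')"
          "neg (g \<cdot> ?pr2) \<in> Hom A (bpo ?E' ?K) (tgt A q')" using C' e g by (auto intro!: HomI)
        have 1: "push (q' \<cdot> ?pr1) D = cls G1" using push_push[OF D(1) pH(1) H(3) C'(3,4)] D(2) y by simp
        have 2: "push (g \<cdot> ?pr2) D = cls G1" using push_push[OF D(1) pH(2) H(4) C'(2,4)] D(3) gF by simp
        have "push ?d D = bsum X (tgt A q') (push (g \<cdot> ?pr2) D) (push (neg (g \<cdot> ?pr2)) D)"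
          using push_add[OF D(1) pH(3,5) C'(4)] 1 2 by simp
        also have "\<dots> = push ((g \<cdot> ?pr2) \<boxplus> neg (g \<cdot> ?pr2)) D" using push_add[OF D(1) pH(4,5) C'(4)] by simp
        also have "\<dots> = zer t X (tgt A ?d)" using push_zero[OF D(1) C'(4)] mD(3) g C' by simp
        finally obtain v where v: "v \<in> XT t X (tgt A j)" "D = push ?m v"
          using mid[OF mv] D(1) mD by auto
        have "cls F1 = push (?pr2 \<cdot> ?m) v"
          using push_push[OF v(1) _ pH(2), of ?m] D(3) v(2) mD C' by (simp add: HomI)
        also have "?pr2 \<cdot> ?m = q" using u C' e by simp
        finally show ?thesis using v by blast
      qed
      ultimately show ?thesis unfolding P_def F G using F1(2) G1(2) by auto
    qed (use emor_ends(5)[OF FG(5)] in \<open>simp add: P_def\<close>)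
  qed simp
  moreover have "P (zero_exseq A (t + 1) X ?W)"
  proof -
    let ?O = "zero_obj A"
    have ze: "zero_exseq A (t + 1) X ?W = (idm A ?W, hzero A ?W ?O) # zero_tail (t - 1) X"
      using t by (simp add: zero_exseq_Suc)
    have zt: "cls (zero_tail (t - 1) X) \<in> XT t X ?O"
      using XT_I[OF _ zero_tail_seq[OF C(1)], of "t - 1"] t by (simp add: zero_tail_def)
    have H: "hzero A ?O ?W \<in> Hom A ?O ?W" "hzero A ?W ?O \<in> Hom A ?W ?O" using C by (auto intro!: HomI)
    \<comment> \<open>The zero object is a retract of W through zero arrows, so the tail of the zero
      sequence lifts along W -> 0.\<close>
    have "hzero A ?W ?O \<cdot> hzero A ?O ?W = idm A ?O" by (rule zero_obj_unique) (use C in auto)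
    then have "push (hzero A ?W ?O) (push (hzero A ?O ?W) (cls (zero_tail (t - 1) X))) = cls (zero_tail (t - 1) X)"
      using push_push[OF zt H C(2)] push_idm[OF zt] by simp
    then show ?thesis unfolding P_def ze using push_XT[OF zt H(1) C(2)] C by force
  qed
  ultimately show ?thesis unfolding P_def using E by simp
qed

text \<open>Middle and right exactness interlock: middle exactness in degree t gives right exactness
  in degree t, and this gives middle exactness in degree t + 1. For the latter, write x = es with e
  of degree 1. From (pe)s = 0 follows s = qv, where q is the deflation of pe; since p kills eq,
  degree 1 gives eq = iw, and so x = (eq)v = i(wv).\<close>

lemma push_exact_aux:
  "t \<ge> 1 \<Longrightarrow> (\<forall>i p x. conflation A C i p \<longrightarrow> x \<in> XT t X (tgt A i) \<longrightarrow> push p x = zer t X (tgt A p) \<longrightarrow>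
      (\<exists>y\<in>XT t X (src A i). x = push i y))"
proof (induction t rule: dec_induct)
  case base
  then show ?case using push_exact_1 by metis
next
  case (step t)
  show ?case
  proof (intro allI impI)
    fix i p x assume c: "conflation A C i p" and x: "x \<in> XT (Suc t) X (tgt A i)" and z: "push p x = zer (Suc t) X (tgt A p)"
    note d = conflationD[OF c]
    obtain K e s where es: "K \<in> C" "e \<in> XT 1 K (tgt A i)" "s \<in> XT t X K" "x = splice e s"
      using XT_Suc[OF x step(1)] .
    have pH: "p \<in> Hom A (tgt A i) (tgt A p)" and iH: "i \<in> Hom A (src A i) (tgt A i)" using d by (auto intro!: HomI)
    obtain j q where jq: "conflation A C j q" "src A j = tgt A p" "tgt A q = K" "push p e = cls [(j, q)]"
      using XT_single[OF push_XT[OF es(2) pH d(7)]] .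
    note e = conflationD[OF jq(1)]
    have "splice (cls [(j, q)]) s = zer (t + 1) X (src A j)"
      using z push_splice[OF es(2,3) pH d(7)] es(4) jq by simp
    then obtain v where v: "v \<in> XT t X (tgt A j)" "s = push q v"
      using push_exact_right_step[OF _ jq(1), of t X s] step(3) es(3) jq(3) by blast
    have qH: "q \<in> Hom A (tgt A j) K" using e jq by (auto intro!: HomI)
    have eq: "pull e q \<in> XT 1 (tgt A j) (tgt A i)" using pull_XT[OF es(2) qH] e by simp
    have "push p (pull e q) = zer 1 (tgt A j) (tgt A p)"
      using push_pull[OF es(2) pH d(7) qH] jq e pull_own_deflation[OF jq(1)] by simp
    then obtain w where w: "w \<in> XT 1 (tgt A j) (src A i)" "pull e q = push i w"
      using push_exact_1[OF c eq] by metis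
    have "x = splice (pull e q) v" using splice_middle[OF es(2) v(1) qH] es(4) v(2) by simp
    also have "\<dots> = push i (splice w v)" using push_splice[OF w(1) v(1) iH] w(2) d by simp
    finally show "\<exists>y\<in>XT (Suc t) X (src A i). x = push i y" using splice_XT[OF w(1) v(1)] by auto
  qed
qed

lemma push_exact_middle:
  assumes "conflation A C i p" "x \<in> XT t X (tgt A i)" "push p x = zer t X (tgt A p)"
  obtains y where "y \<in> XT t X (src A i)" "x = push i y"
  using push_exact_aux[of t X] XT_pos[OF assms(2)] assms by blast

lemma push_exact_right:
  assumes "conflation A C i p" "x \<in> XT t X (tgt A p)" "splice (cls [(i, p)]) x = zer (t + 1) X (src A i)"
  obtains y where "y \<in> XT t X (tgt A i)" "x = push p y"
  using push_exact_right_step[OF _ assms] push_exact_aux[of t X] XT_pos[OF assms(2)] by blast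

text \<open>The splitting x = es is used as for the middle term. Here i kills eq, so degree 1 yields
  an arrow g through which eq is a pull-back of (i, p), and gv is the class sought.\<close>

lemma push_exact_left:
  assumes c: "conflation A C i p" and x: "x \<in> XT (Suc t) X (src A i)" and z: "push i x = zer (Suc t) X (tgt A i)"
    and t: "t \<ge> 1"
  obtains y where "y \<in> XT t X (tgt A p)" "x = splice (cls [(i, p)]) y"
proof -
  note d = conflationD[OF c]
  obtain K e s where es: "K \<in> C" "e \<in> XT 1 K (src A i)" "s \<in> XT t X K" "x = splice e s"
    using XT_Suc[OF x t] .
  have iH: "i \<in> Hom A (src A i) (tgt A i)" and iC: "tgt A i \<in> C" using d by (auto intro!: HomI)
  obtain j q where jq: "conflation A C j q" "src A j = tgt A i" "tgt A q = K" "push i e = cls [(j, q)]"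
    using XT_single[OF push_XT[OF es(2) iH iC]] .
  note e = conflationD[OF jq(1)]
  have "splice (cls [(j, q)]) s = zer (t + 1) X (src A j)"
    using z push_splice[OF es(2,3) iH iC] es(4) jq by simp
  then obtain v where v: "v \<in> XT t X (tgt A j)" "s = push q v"
    using push_exact_right[OF jq(1)] es(3) jq(3) by metis
  have qH: "q \<in> Hom A (tgt A j) K" using e jq by (auto intro!: HomI)
  have eq: "pull e q \<in> XT 1 (tgt A j) (src A i)" using pull_XT[OF es(2) qH] e by simp
  have "push i (pull e q) = zer 1 (tgt A j) (tgt A i)"
    using push_pull[OF es(2) iH iC qH] jq e pull_own_deflation[OF jq(1)] by simp
  then obtain g where g: "g \<in> Hom A (tgt A j) (tgt A p)" "pull e q = pull (cls [(i, p)]) g"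
    using push_exact_connecting_1[OF c eq] by metis
  have "x = splice (pull e q) v" using splice_middle[OF es(2) v(1) qH] es(4) v(2) by simp
  also have "\<dots> = splice (cls [(i, p)]) (push g v)" using splice_middle[OF cls_single[OF c] v(1) g(1)] g(2) by simp
  finally show ?thesis using that push_XT[OF v(1) g(1)] d by blast
qed

subsection \<open>Exactness in the first argument\<close>

lemma op_single: "ext_class (op_cat A) C [(p, i)] = opseq ` cls [(i, p)]"
  by (simp flip: op_ext_class)

lemma pull_exact_middle:
  assumes "conflation A C i p" "x \<in> XT t (tgt A i) Y" "pull x i = zer t (src A i) Y"
  obtains y where "y \<in> XT t (tgt A p) Y" "x = pull y p"
proof -
  interpret O: extension_closed_subcategory "op_cat A" C by (rule op_ext_closed)
  note d = conflationD[OF assms(1)]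
  have 1: "conflation (op_cat A) C p i" "opseq ` x \<in> O.XT t Y (tgt (op_cat A) p)"
    using assms(1,2) d by simp_all
  have "O.push i (opseq ` x) = O.zer t Y (tgt (op_cat A) i)"
    using op_zer[OF XT_pos[OF assms(2)], of "src A i" Y] XT_ends[OF assms(2)] assms(3) d by simp
  then obtain y where y: "y \<in> O.XT t Y (src (op_cat A) p)" "opseq ` x = O.push p y"
    using O.push_exact_middle[OF 1] by blast
  have "opseq ` y \<in> XT t (tgt A p) Y" using y(1) d op_XT[of "opseq ` y"] by simp
  moreover have "x = pull (opseq ` y) p" using y(2) op_push[of p "opseq ` y"] by simp
  ultimately show ?thesis by (rule that)
qed

lemma pull_exact_left:
  assumes "conflation A C i p" "x \<in> XT t (src A i) Y" "splice x (cls [(i, p)]) = zer (t + 1) (tgt A p) Y"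
  obtains y where "y \<in> XT t (tgt A i) Y" "x = pull y i"
proof -
  interpret O: extension_closed_subcategory "op_cat A" C by (rule op_ext_closed)
  note d = conflationD[OF assms(1)]
  have 1: "conflation (op_cat A) C p i" "opseq ` x \<in> O.XT t Y (tgt (op_cat A) i)"
    using assms(1,2) d by simp_all
  have "O.splice (O.cls [(p, i)]) (opseq ` x) = O.zer (t + 1) Y (src (op_cat A) p)"
    using op_zer[of "t + 1" "tgt A p" Y] XT_ends[OF assms(2)] assms(3) d op_splice[OF assms(2) cls_single[OF assms(1)]]
    by (simp add: op_single)
  then obtain y where y: "y \<in> O.XT t Y (tgt (op_cat A) p)" "opseq ` x = O.push i y"
    using O.push_exact_right[OF 1] by blast
  have "opseq ` y \<in> XT t (tgt A i) Y" using y(1) d op_XT[of "opseq ` y"] by simp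
  moreover have "x = pull (opseq ` y) i" using y(2) op_push[of i "opseq ` y"] by simp
  ultimately show ?thesis by (rule that)
qed

lemma pull_exact_right:
  assumes "conflation A C i p" "x \<in> XT (Suc t) (tgt A p) Y" "pull x p = zer (Suc t) (tgt A i) Y" "t \<ge> 1"
  obtains y where "y \<in> XT t (src A i) Y" "x = splice y (cls [(i, p)])"
proof -
  interpret O: extension_closed_subcategory "op_cat A" C by (rule op_ext_closed)
  note d = conflationD[OF assms(1)]
  have 1: "conflation (op_cat A) C p i" "opseq ` x \<in> O.XT (Suc t) Y (src (op_cat A) p)"
    using assms(1,2) d by simp_all
  have "O.push p (opseq ` x) = O.zer (Suc t) Y (tgt (op_cat A) p)"
    using op_zer[of "Suc t" "tgt A i" Y] XT_ends[OF assms(2)] assms(3) d by simp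
  then obtain y where y: "y \<in> O.XT t Y (tgt (op_cat A) i)" "opseq ` x = O.splice (O.cls [(p, i)]) y"
    using O.push_exact_left[OF 1 _ assms(4)] by blast
  have yX: "opseq ` y \<in> XT t (src A i) Y" using y(1) d op_XT[of "opseq ` y"] by simp
  have "x = splice (opseq ` y) (cls [(i, p)])"
    using y(2) op_splice[OF yX cls_single[OF assms(1)]] by (simp add: op_single)
  with yX show ?thesis by (rule that)
qed

end

section \<open>Dimension shifting and quasi-invertible deflations in an n-Frobenius category\<close>

section \<open>\<open>n\<close>-Frobenius categories\<close>

lemma (in group_hom) hom_mult_inv_one:
  assumes "h y = \<one>\<^bsub>H\<^esub>" "x \<in> carrier G" "y \<in> carrier G"
  shows "h (x \<otimes> inv y) = h x"
  using assms by simp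

lemma (in group_hom) kernel_coset_iff:
  assumes x: "x \<in> carrier G" and y: "y \<in> carrier G"
  shows "x \<otimes> inv y \<in> kernel G H h \<longleftrightarrow> h x = h y" "kernel G H h #> x = kernel G H h #> y \<longleftrightarrow> h x = h y"
proof -
  have "h (x \<otimes> inv y) = \<one>\<^bsub>H\<^esub> \<longleftrightarrow> h x = h y"
    using x y by (metis G.inv_closed H.inv_solve_right H.l_one H.one_closed hom_closed hom_inv hom_mult)
  then show 1: "x \<otimes> inv y \<in> kernel G H h \<longleftrightarrow> h x = h y" using x y by (simp add: kernel_def)
  show "kernel G H h #> x = kernel G H h #> y \<longleftrightarrow> h x = h y"
  proof
    assume "h x = h y"
    then have "x \<otimes> inv y \<in> kernel G H h" using 1 by simp
    moreover have "x = (x \<otimes> inv y) \<otimes> y" using x y by (simp add: G.m_assoc)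
    ultimately have "x \<in> kernel G H h #> y" unfolding r_coset_def by blast
    then show "kernel G H h #> x = kernel G H h #> y" using G.repr_independence[OF _ y subgroup_kernel] by simp
  next
    assume "kernel G H h #> x = kernel G H h #> y"
    then have "x \<in> kernel G H h #> y" using G.rcos_self[OF x subgroup_kernel] by simp
    then obtain k where "k \<in> carrier G" "h k = \<one>\<^bsub>H\<^esub>" "x = k \<otimes> y" by (auto simp: r_coset_def kernel_def)
    then show "h x = h y" using y by simp
  qed
qed

text \<open>Positivity enters where degree 2n + 1 has to exceed n + 1, as pull-back along
  quasi-invertible deflations requires; it also makes sequences of length n nonempty.\<close>

locale positive_n_frobenius_category = n_frobenius_category +
  assumes n_pos: "n \<ge> 1"
begin

abbreviation "np P \<equiv> n_projective A C n P"

lemma np_in: "np P \<Longrightarrow> P \<in> C"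
  by (simp add: n_projective_def)

lemma vanish_left:
  assumes "np P" "k > n" "c \<in> XT k P Y" shows "c = zer k P Y"
  using assms XT_ends[OF assms(3)] by (auto simp: n_projective_def)

lemma vanish_right:
  assumes "np P" "k > n" "c \<in> XT k Y P" shows "c = zer k Y P"
proof -
  have "n_injective A C n P" using assms(1) projective_iff_injective by simp
  then show ?thesis using assms(2,3) XT_ends[OF assms(3)] by (auto simp: n_injective_def)
qed

text \<open>A class of degree above n + 1 splits off a left factor of degree n + 1 with the same
  left end P. One degree on the injective side thus decides, and the Frobenius condition leads back
  to projectivity.\<close>

lemma npI:
  assumes P: "P \<in> C" and z: "\<And>Y c. c \<in> XT (Suc n) Y P \<Longrightarrow> c = zer (Suc n) Y P"
  shows "np P"
proof -
  have "c = zer i Y P" if i: "i > n" and c: "c \<in> XT i Y P" for i Y c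
  proof (cases "i = Suc n")
    case False
    then have t: "i = Suc n + (i - Suc n)" "i - Suc n > 0" using i by simp_all
    obtain K d e where "K \<in> C" "d \<in> XT (Suc n) K P" "e \<in> XT (i - Suc n) Y K" "c = splice d e"
      using splice_decompose[of c "Suc n" "i - Suc n" Y P] c t by auto
    then show ?thesis using splice_zer_left[of e "i - Suc n" Y K P "Suc n"] z P t(1) by simp
  qed (use z c in simp)
  then have "n_injective A C n P" using P zer_XT by (fastforce simp: n_injective_def)
  then show ?thesis using projective_iff_injective by simp
qed

text \<open>Injectivity handles cokernels: Ext in degree n + 1 with values in the cokernel lies
  between degree n + 1 with values in the middle term and degree n + 2 with values in the
  kernel.\<close>

lemma np_cokernel:
  assumes c: "conflation A C i p" and "np (src A i)" "np (tgt A i)"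
  shows "np (tgt A p)"
proof (rule npI)
  note d = conflationD[OF c]
  show "tgt A p \<in> C" by fact
  fix Y x assume x: "x \<in> XT (Suc n) Y (tgt A p)"
  have "splice (cls [(i, p)]) x = zer (Suc n + 1) Y (src A i)"
    using vanish_right[OF assms(2), of "Suc n + 1"] splice_XT[OF cls_single[OF c] x] by simp
  then obtain y where "y \<in> XT (Suc n) Y (tgt A i)" "x = push p y" using push_exact_right[OF c x] by metis
  then show "x = zer (Suc n) Y (tgt A p)"
    using vanish_right[OF assms(3), of "Suc n" y Y] push_zer[of "Suc n" Y p "tgt A i" "tgt A p"] XT_ends[OF x] d by (simp add: HomI)
qed

lemma np_extension:
  assumes c: "conflation A C i p" and "np (src A i)" "np (tgt A p)"
  shows "np (tgt A i)"
proof (rule npI)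
  note d = conflationD[OF c]
  show "tgt A i \<in> C" using d by simp
  fix Y x assume x: "x \<in> XT (Suc n) Y (tgt A i)"
  have pH: "p \<in> Hom A (tgt A i) (tgt A p)" using d by (auto intro!: HomI)
  have "push p x = zer (Suc n) Y (tgt A p)"
    using vanish_right[OF assms(3), of "Suc n"] push_XT[OF x pH] d by simp
  then obtain y where "y \<in> XT (Suc n) Y (src A i)" "x = push i y" using push_exact_middle[OF c x] by metis
  then show "x = zer (Suc n) Y (tgt A i)"
    using vanish_right[OF assms(2), of "Suc n" y Y] push_zer[of "Suc n" Y i "src A i" "tgt A i"] XT_ends[OF x] d by (simp add: HomI)
qed

lemma np_zero_obj: "np (zero_obj A)"
proof (rule npI)
  fix Y c assume c: "c \<in> XT (Suc n) Y (zero_obj A)"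
  have "idm A (zero_obj A) = hzero A (zero_obj A) (zero_obj A)" by (rule zero_obj_unique) simp_all
  then show "c = zer (Suc n) Y (zero_obj A)" using push_idm[OF c] push_zero[OF c zero_obj_in] by simp
qed simp

lemma np_bpo: "np P \<Longrightarrow> np Q \<Longrightarrow> np (bpo P Q)"
  using np_extension[OF bpo_conflation[OF np_in np_in], of P Q] np_in by simp

lemma enough_np_deflation:
  assumes "X \<in> C" obtains i p where "conflation A C i p" "np (src A p)" "tgt A p = X" "np (tgt A i)"
  using enough_projectives[OF assms] conflationD(3) unfolding deflation_def by metis

lemma enough_np_inflation:
  assumes "X \<in> C" obtains i p where "conflation A C i p" "np (tgt A i)" "src A i = X"
  using enough_injectives[OF assms] projective_iff_injective unfolding inflation_def by metis

subsection \<open>Unit conflations and dimension shifting\<close>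

text \<open>Unit conflations of any length, including the empty one: inductions peel off single
  conflations, and the test conflation T has length n + 1 instead of n.\<close>

definition useq :: "'b exseq \<Rightarrow> 'a \<Rightarrow> 'a \<Rightarrow> bool" where
  "useq E Y X \<longleftrightarrow> seq A C E Y X \<and> (\<forall>(i, p)\<in>set E. np (tgt A i))"

lemma useq_simps [simp]:
  "useq [] Y X \<longleftrightarrow> Y = X \<and> X \<in> C"
  "useq ((i, p) # E) Y X \<longleftrightarrow> conflation A C i p \<and> np (tgt A i) \<and> src A i = Y \<and> useq E (tgt A p) X"
  by (auto simp: useq_def)

lemma useq_append: "useq (E @ F) Z X \<longleftrightarrow> (\<exists>Y. useq E Z Y \<and> useq F Y X)"
  by (auto simp: useq_def seq_append)

lemma useq_seq: "useq E Y X \<Longrightarrow> seq A C E Y X" by (simp add: useq_def)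

lemma unit_ext_iff: "\<delta> \<in> unit_ext A C n X B \<longleftrightarrow> (\<exists>E. useq E B X \<and> length E = n \<and> E \<noteq> [] \<and> \<delta> = cls E)"
proof -
  have "unit_conflation A C n E \<and> right_end A E = X \<and> left_end A E = B \<longleftrightarrow> useq E B X \<and> length E = n \<and> E \<noteq> []" for E
    unfolding unit_conflation_def useq_def using seq_iff[of E A C B X] by auto
  then show ?thesis unfolding unit_ext_def by auto
qed

lemma unit_ext_XT: "\<delta> \<in> unit_ext A C n X B \<Longrightarrow> \<delta> \<in> XT n X B"
  by (auto simp: unit_ext_iff XT_iff useq_def)

lemma resolution_exists: "Y \<in> C \<Longrightarrow> \<exists>E Z. useq E Z Y \<and> length E = m"
proof (induction m)
  case 0 then show ?case by (auto intro!: exI[of _ "[]"])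
next
  case (Suc m)
  then obtain E Z where E: "useq E Z Y" "length E = m" by blast
  have "Z \<in> C" using seq_ends[OF useq_seq[OF E(1)]] by simp
  then obtain i p where "conflation A C i p" "tgt A p = Z" "np (tgt A i)" using enough_np_deflation by metis
  then have "useq ((i, p) # E) (src A i) Y" using E by simp
  then show ?case using E(2) by (metis length_Cons)
qed

lemma cls_Cons:
  assumes "conflation A C i p" "seq A C E (tgt A p) X" "E \<noteq> []"
  shows "cls ((i, p) # E) = splice (cls [(i, p)]) (cls E)"
  using splice_cls[of "[(i, p)]" "src A i" "tgt A p" E X] assms conflationD[OF assms(1)] by simp

lemma cls_snoc:
  assumes "conflation A C i p" "seq A C E Z (src A i)" "E \<noteq> []"
  shows "cls (E @ [(i, p)]) = splice (cls E) (cls [(i, p)])"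
  using splice_cls[of E Z "src A i" "[(i, p)]" "tgt A p"] assms conflationD[OF assms(1)] by simp

text \<open>The kernel of the connecting map comes from extensions with values in the middle term,
  and these vanish above degree n since n-projectives are n-injective.\<close>

lemma shift_step:
  assumes c: "conflation A C i p" and P: "np (tgt A i)" and k: "k > n" and x: "x \<in> XT k X (tgt A p)"
    and z: "splice (cls [(i, p)]) x = zer (k + 1) X (src A i)"
  shows "x = zer k X (tgt A p)"
proof -
  note d = conflationD[OF c]
  obtain y where y: "y \<in> XT k X (tgt A i)" "x = push p y" using push_exact_right[OF c x z] .
  have "y = zer k X (tgt A i)" using vanish_right[OF P k y(1)] .
  then show ?thesis using push_zer[of k X p "tgt A i" "tgt A p"] XT_ends[OF x] d y(2) k by (simp add: HomI)
qed

lemma shift_inj: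
  assumes "useq E Z Y" "E \<noteq> []" "k > n" "x \<in> XT k X Y" "splice (cls E) x = zer (length E + k) X Z"
  shows "x = zer k X Y"
  using assms
proof (induction E arbitrary: Z)
  case (Cons c E)
  obtain i p where c: "c = (i, p)" by force
  have ip: "conflation A C i p" "np (tgt A i)" "src A i = Z" "useq E (tgt A p) Y" using Cons.prems(1) c by auto
  show ?case
  proof (cases "E = []")
    case True
    then have "tgt A p = Y" using ip by simp
    then show ?thesis using shift_step[OF ip(1,2) Cons.prems(3), of x X] Cons.prems(4,5) True c ip(3) by simp
  next
    case False
    note s = useq_seq[OF ip(4)]
    have E: "cls E \<in> XT (length E) Y (tgt A p)" using XT_I[OF False s] .
    have "splice (cls [(i, p)]) (splice (cls E) x) = zer (length E + k + 1) X (src A i)"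
      using Cons.prems(5) splice_assoc[OF cls_single[OF ip(1)] E Cons.prems(4)] cls_Cons[OF ip(1) s False] c ip(3) by simp
    then have "splice (cls E) x = zer (length E + k) X (tgt A p)"
      using shift_step[OF ip(1,2), of "length E + k"] splice_XT[OF E Cons.prems(4)] Cons.prems(3) by simp
    then show ?thesis using Cons.IH[OF ip(4) False Cons.prems(3,4)] by simp
  qed
qed simp

text \<open>A class \<eta>h is killed because E\<eta> has an n-projective first argument and degree
  above n. Conversely, \<open>shift_inj\<close> cancels all conflations of E but the last, so x = py
  with y taking values in an n-projective, and such a y extends to an n-projective containing
  X.\<close>

lemma proj_ext_iff:
  assumes E: "useq E Z Y" "E \<noteq> []" and x: "x \<in> XT n X Y"
  shows "x \<in> proj_ext A C n X Y \<longleftrightarrow> splice (cls E) x = zer (length E + n) X Z"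
proof
  note s = useq_seq[OF E(1)]
  have Y: "Y \<in> C" "Z \<in> C" "X \<in> C" using seq_ends[OF s] XT_ends[OF x] by auto
  have EX: "cls E \<in> XT (length E) Y Z" using XT_I[OF E(2) s] .
  {
    assume "x \<in> proj_ext A C n X Y"
    then obtain \<eta> h P where P: "np P" "h \<in> Hom A X P" "\<eta> \<in> XT n P Y" "x = pull \<eta> h" by (auto simp: proj_ext_def)
    have "splice (cls E) x = pull (splice (cls E) \<eta>) h" using pull_splice[OF EX P(3,2) Y(3)] P(4) by simp
    also have "splice (cls E) \<eta> = zer (length E + n) P Z"
      using vanish_left[OF P(1) _ splice_XT[OF EX P(3)]] E(2) by simp
    also have "pull (zer (length E + n) P Z) h = zer (length E + n) X Z"
      using pull_zer[OF _ np_in[OF P(1)] P(2) Y(2,3)] n_pos by simp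
    finally show "splice (cls E) x = zer (length E + n) X Z" .
  }
  assume z: "splice (cls E) x = zer (length E + n) X Z"
  obtain F i p where F: "E = F @ [(i, p)]" using E(2) by (metis rev_exhaust surj_pair)
  then have ip: "conflation A C i p" "np (tgt A i)" "tgt A p = Y" "useq F Z (src A i)" using E(1) by (auto simp: useq_append)
  note d = conflationD[OF ip(1)]
  have t: "cls [(i, p)] \<in> XT 1 Y (src A i)" using cls_single[OF ip(1)] ip(3) by simp
  have "splice (cls [(i, p)]) x = zer (n + 1) X (src A i)"
  proof (cases "F = []")
    case False
    note sF = useq_seq[OF ip(4)]
    have FX: "cls F \<in> XT (length F) (src A i) Z" using XT_I[OF False sF] .
    have "splice (cls F) (splice (cls [(i, p)]) x) = zer (length F + (1 + n)) X Z"
      using z splice_assoc[OF FX t x] cls_snoc[OF ip(1) sF False] F by simp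
    from shift_inj[OF ip(4) False _ splice_XT[OF t x] this] show ?thesis by simp
  qed (use z F ip in simp)
  then obtain y where y: "y \<in> XT n X (tgt A i)" "x = push p y"
    using push_exact_right[OF ip(1)] x ip(3) by metis
  \<comment> \<open>The obstruction to extending y along an inflation j lies in degree n + 1 with
    values in the n-injective object \<open>tgt A i\<close>, hence vanishes.\<close>
  obtain j q where jq: "conflation A C j q" "np (tgt A j)" "src A j = X" using enough_np_inflation[OF Y(3)] .
  note e = conflationD[OF jq(1)]
  have "splice y (cls [(j, q)]) = zer (n + 1) (tgt A q) (tgt A i)"
    using vanish_right[OF ip(2), of "n + 1"] splice_XT[of y n X "tgt A i" "cls [(j, q)]" 1] y(1) cls_single[OF jq(1)] jq(3) by simp
  then obtain w where w: "w \<in> XT n (tgt A j) (tgt A i)" "y = pull w j"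
    using pull_exact_left[OF jq(1)] y(1) jq(3) by metis
  have jH: "j \<in> Hom A X (tgt A j)" and pH: "p \<in> Hom A (tgt A i) Y" using e jq d ip(3) by (auto intro!: HomI)
  have "x = pull (push p w) j" using push_pull[OF w(1) pH Y(1) jH Y(3)] y(2) w(2) by simp
  then show "x \<in> proj_ext A C n X Y"
    using jq(2) jH push_XT[OF w(1) pH Y(1)] by (auto simp: proj_ext_def)
qed

lemma splice_hom:
  assumes "c \<in> XT s Y Z" "t \<ge> 1" "X \<in> C"
  shows "group_hom (Ext A C t X Y) (Ext A C (s + t) X Z) (splice c)"
proof -
  have C: "Y \<in> C" "Z \<in> C" using XT_ends[OF assms(1)] by auto
  show ?thesis
    by (intro group_hom.intro group_hom_axioms.intro homI Ext_group)
      (use assms C splice_bsum_right[OF assms(1)] in auto)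
qed

lemma pull_hom:
  assumes "t \<ge> 1" "Y \<in> C" "h \<in> Hom A X' X" "X \<in> C" "X' \<in> C"
  shows "group_hom (Ext A C t X Y) (Ext A C t X' Y) (\<lambda>c. pull c h)"
  by (intro group_hom.intro group_hom_axioms.intro homI Ext_group)
    (use assms pull_bsum in auto)

lemma push_hom:
  assumes "t \<ge> 1" "X \<in> C" "g \<in> Hom A Y Y'" "Y \<in> C" "Y' \<in> C"
  shows "group_hom (Ext A C t X Y) (Ext A C t X Y') (push g)"
  by (intro group_hom.intro group_hom_axioms.intro homI Ext_group)
    (use assms push_bsum in auto)

lemma proj_ext_XT: "X \<in> C \<Longrightarrow> x \<in> proj_ext A C n X Y \<Longrightarrow> x \<in> XT n X Y"
  by (auto simp: proj_ext_def)

text \<open>As a kernel, P is a subgroup, and its cosets can be compared after splicing with any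
  nonempty unit conflation, whatever its length.\<close>

lemma proj_ext_kernel:
  assumes E: "useq E Z Y" "E \<noteq> []" and X: "X \<in> C"
  shows "proj_ext A C n X Y = kernel (Ext A C n X Y) (Ext A C (length E + n) X Z) (splice (cls E))"
  using proj_ext_iff[OF E] proj_ext_XT[OF X] by (auto simp: kernel_def)

lemma ext_bar_eq_iff:
  assumes E: "useq E Z Y" "E \<noteq> []" and x: "x \<in> XT n X Y" "y \<in> XT n X Y"
  shows "ext_bar A C n X Y x = ext_bar A C n X Y y \<longleftrightarrow> splice (cls E) x = splice (cls E) y"
proof -
  have X: "X \<in> C" using XT_ends[OF x(1)] by simp
  interpret group_hom "Ext A C n X Y" "Ext A C (length E + n) X Z" "splice (cls E)"
    using splice_hom[OF XT_I[OF E(2) useq_seq[OF E(1)]] n_pos X] .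
  show ?thesis using kernel_coset_iff(2)[of x y] x unfolding ext_bar_def proj_ext_kernel[OF E X] by simp
qed

lemma pull_inverse_iff:
  assumes E: "useq E T Y" "E \<noteq> []" and x: "x \<in> XT n Z Y" and b: "b \<in> Hom A Z X'"
  shows "is_pull_inverse A C n Z X' Y x b y \<longleftrightarrow> y \<in> XT n X' Y \<and> splice (cls E) x = pull (splice (cls E) y) b"
proof -
  have Z: "Z \<in> C" using XT_ends[OF x] by simp
  have EX: "cls E \<in> XT (length E) Y T" using XT_I[OF E(2) useq_seq[OF E(1)]] .
  interpret group_hom "Ext A C n Z Y" "Ext A C (length E + n) Z T" "splice (cls E)"
    using splice_hom[OF EX n_pos Z] .
  show ?thesis
  proof (cases "y \<in> XT n X' Y")
    case True
    then show ?thesis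
      using kernel_coset_iff(1)[of x "pull y b"] x pull_XT[OF True b Z] pull_splice[OF EX True b Z]
      unfolding is_pull_inverse_def proj_ext_kernel[OF E Z] by simp
  qed (simp add: is_pull_inverse_def)
qed

text \<open>Conflations are peeled off at the right end: z has degree above n, so its pull-back to
  the n-projective middle term vanishes and z comes from the kernel. The bound on k keeps this true
  down to the last conflation.\<close>

lemma coshift_surj:
  assumes "useq E B K" "E \<noteq> []" "k \<ge> n" "z \<in> XT (k + length E) K T"
  shows "\<exists>x\<in>XT k B T. z = splice x (cls E)"
  using assms
proof (induction E arbitrary: K z rule: rev_induct)
  case (snoc c E)
  obtain i p where c: "c = (i, p)" by force
  have ip: "conflation A C i p" "np (tgt A i)" "tgt A p = K" "useq E B (src A i)" using snoc.prems(1) c by (auto simp: useq_append)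
  note d = conflationD[OF ip(1)]
  let ?t = "k + length E"
  have t: "?t \<ge> 1" "Suc ?t > n" using snoc.prems(3) n_pos by simp_all
  have z: "z \<in> XT (Suc ?t) (tgt A p) T" using snoc.prems(4) ip(3) by simp
  have pH: "p \<in> Hom A (tgt A i) (tgt A p)" using d by (auto intro!: HomI)
  have "pull z p = zer (Suc ?t) (tgt A i) T"
    using vanish_left[OF ip(2) t(2)] pull_XT[OF z pH] d by simp
  then obtain y where y: "y \<in> XT ?t (src A i) T" "z = splice y (cls [(i, p)])"
    using pull_exact_right[OF ip(1) z _ t(1)] by metis
  show ?case
  proof (cases "E = []")
    case True
    then show ?thesis using y c ip by auto
  next
    case False
    obtain x where x: "x \<in> XT k B T" "y = splice x (cls E)"
      using snoc.IH[OF ip(4) False snoc.prems(3) y(1)] by blast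
    note s = useq_seq[OF ip(4)]
    have "z = splice x (cls (E @ [c]))"
      using y(2) x(2) splice_assoc[OF x(1) XT_I[OF False s] cls_single[OF ip(1)]] cls_snoc[OF ip(1) s False] c by simp
    then show ?thesis using x(1) by blast
  qed
qed simp

subsection \<open>Quasi-invertible deflations\<close>

text \<open>For deflations this is a reformulation of quasi-invertibility. In this form it is
  visibly stable under composition and can be produced by the 3x3 lemma.\<close>

definition np_deflation :: "'b \<Rightarrow> bool" where
  "np_deflation b \<longleftrightarrow> (\<exists>w. conflation A C w b \<and> np (src A w))"

text \<open>Extensions with values in the kernel vanish in degrees n + 1 and n + 2, which gives
  injectivity and surjectivity respectively.\<close>

lemma np_deflation_quasi_invertible:
  assumes "np_deflation b" shows "quasi_invertible A C n b" "deflation A C b"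
proof -
  obtain w where w: "conflation A C w b" "np (src A w)" using assms by (auto simp: np_deflation_def)
  note d = conflationD[OF w(1)]
  show "deflation A C b" using w by (auto simp: deflation_def)
  have bH: "b \<in> Hom A (src A b) (tgt A b)" and wH: "w \<in> Hom A (src A w) (src A b)" using d by (auto intro!: HomI)
  have "push b \<in> iso (Ext A C (n + 1) X (src A b)) (Ext A C (n + 1) X (tgt A b))" if X: "X \<in> C" for X
  proof -
    interpret group_hom "Ext A C (n + 1) X (src A b)" "Ext A C (n + 1) X (tgt A b)" "push b"
      using push_hom[OF _ X bH d(6,7)] by simp
    have "x = zer (n + 1) X (src A b)" if x: "x \<in> XT (n + 1) X (src A b)" "push b x = zer (n + 1) X (tgt A b)" for x
    proof -
      obtain y where y: "y \<in> XT (n + 1) X (src A w)" "x = push w y"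
        using push_exact_middle[OF w(1)] x d(3) by metis
      then show ?thesis using vanish_right[OF w(2) _ y(1)] push_zer[OF _ X wH d(5,6)] by simp
    qed
    moreover have "\<exists>y\<in>XT (n + 1) X (src A b). x = push b y" if x: "x \<in> XT (n + 1) X (tgt A b)" for x
    proof -
      have "splice (cls [(w, b)]) x = zer (n + 1 + 1) X (src A w)"
        using vanish_right[OF w(2), of "n + 1 + 1"] splice_XT[OF cls_single[OF w(1)] x] by simp
      then show ?thesis using push_exact_right[OF w(1) x] d(3) by metis
    qed
    ultimately show ?thesis unfolding iso_iff by (auto simp: image_iff)
  qed
  then show "quasi_invertible A C n b" using d by (simp add: quasi_invertible_def)
qed

text \<open>A class c of degree n + 1 with values in the kernel of b dies in \<open>src A b\<close>
  by injectivity, so c = (w, b)y. After splicing with an embedding conflation of its first argument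
  X, surjectivity makes it a multiple of the pull-back of (w, b) along b, which is zero. So c
  extends to an n-projective first argument, where it vanishes.\<close>

lemma quasi_invertible_np_deflation:
  assumes q: "quasi_invertible A C n b" and b: "deflation A C b"
  shows "np_deflation b"
proof -
  obtain w where w: "conflation A C w b" using b by (auto simp: deflation_def)
  note d = conflationD[OF w]
  have bH: "b \<in> Hom A (src A b) (tgt A b)" and wH: "w \<in> Hom A (src A w) (src A b)" using d by (auto intro!: HomI)
  have i: "push b \<in> iso (Ext A C (n + 1) X (src A b)) (Ext A C (n + 1) X (tgt A b))" if X: "X \<in> C" for X
    using q X by (simp add: quasi_invertible_def)
  have "np (src A w)"
  proof (rule npI)
    show "src A w \<in> C" by fact
    fix X c assume c: "c \<in> XT (Suc n) X (src A w)"
    have X: "X \<in> C" using XT_ends[OF c] by simp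
    have "push b (push w c) = zer (n + 1) X (tgt A b)"
      using push_push[OF c wH bH d(6,7)] push_zero[OF c d(7)] d(4) by simp
    also have "\<dots> = push b (zer (n + 1) X (src A b))" using push_zer[OF _ X bH d(6,7)] by simp
    finally have "push w c = zer (n + 1) X (src A b)"
      using i[OF X] push_XT[OF c wH d(6)] zer_XT[OF _ X d(6), of "n + 1"] by (auto simp: iso_def bij_betw_def dest: inj_onD)
    then obtain y where y: "y \<in> XT n X (tgt A b)" "c = splice (cls [(w, b)]) y"
      using push_exact_left[OF w c _ n_pos] d(3) by auto
    \<comment> \<open>Surjectivity of b is known in degree n + 1 while y has degree n; splicing with
      (j, q) closes the gap of one.\<close>
    obtain j q where jq: "conflation A C j q" "np (tgt A j)" "src A j = X" using enough_np_inflation[OF X] .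
    note e = conflationD[OF jq(1)]
    have k: "cls [(j, q)] \<in> XT 1 (tgt A q) X" using cls_single[OF jq(1)] jq(3) by simp
    have "splice y (cls [(j, q)]) \<in> XT (n + 1) (tgt A q) (tgt A b)" using splice_XT[OF y(1) k] by simp
    then obtain z where z: "z \<in> XT (n + 1) (tgt A q) (src A b)" "splice y (cls [(j, q)]) = push b z"
      using i[OF e(7)] by (auto simp: iso_def bij_betw_def)
    have "splice c (cls [(j, q)]) = splice (cls [(w, b)]) (push b z)"
      using splice_assoc[OF cls_single[OF w] y(1) k] y(2) z(2) by simp
    also have "\<dots> = splice (pull (cls [(w, b)]) b) z" using splice_middle[OF cls_single[OF w] z(1) bH] by simp
    also have "\<dots> = zer (Suc n + 1) (tgt A q) (src A w)"
      using pull_own_deflation[OF w] splice_zer_left[OF z(1) d(5), of 1] by simp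
    finally obtain v where v: "v \<in> XT (Suc n) (tgt A j) (src A w)" "c = pull v j"
      using pull_exact_left[OF jq(1)] c jq(3) by metis
    have jH: "j \<in> Hom A X (tgt A j)" using e jq by (auto intro!: HomI)
    show "c = zer (Suc n) X (src A w)"
      using vanish_left[OF jq(2) _ v(1)] v(2) pull_zer[OF _ _ jH d(5) X] np_in[OF jq(2)] by simp
  qed
  with w show ?thesis by (auto simp: np_deflation_def)
qed

text \<open>The kernel in degree t + 1 comes from degree t on the n-projective kernel of b, whence
  the strict bound t > n.\<close>

lemma np_deflation_pull_inj:
  assumes b: "np_deflation b" and t: "t > n" and x: "x \<in> XT (Suc t) (tgt A b) Y" "y \<in> XT (Suc t) (tgt A b) Y"
    and eq: "pull x b = pull y b"
  shows "x = y"
proof -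
  obtain w where w: "conflation A C w b" "np (src A w)" using b by (auto simp: np_deflation_def)
  note d = conflationD[OF w(1)]
  have Y: "Y \<in> C" using XT_ends[OF x(1)] by simp
  have bH: "b \<in> Hom A (src A b) (tgt A b)" using d by (auto intro!: HomI)
  interpret group_hom "Ext A C (Suc t) (tgt A b) Y" "Ext A C (Suc t) (src A b) Y" "\<lambda>c. pull c b"
    using pull_hom[OF _ Y bH d(7,6)] by simp
  have "z = zer (Suc t) (tgt A b) Y" if z: "z \<in> XT (Suc t) (tgt A b) Y" "pull z b = zer (Suc t) (src A b) Y" for z
  proof -
    obtain v where v: "v \<in> XT t (src A w) Y" "z = splice v (cls [(w, b)])"
      using pull_exact_right[OF w(1) z(1)] z(2) d(3) t n_pos by auto
    then show ?thesis
      using vanish_left[OF w(2) t v(1)] splice_zer_left[OF cls_single[OF w(1)] Y, of t] t by simp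
  qed
  then have "inj_on (\<lambda>c. pull c b) (XT (Suc t) (tgt A b) Y)" using inj_on_one_iff by simp
  then show ?thesis using x eq by (auto dest: inj_onD)
qed

text \<open>x is corrected by some \<eta> in P that has the same restriction to the kernel of b; the
  difference vanishes on this kernel and therefore descends along b.\<close>

lemma pull_inverse_exists:
  assumes b: "np_deflation b" and x: "x \<in> XT n (src A b) Y"
  shows "\<exists>y. is_pull_inverse A C n (src A b) (tgt A b) Y x b y"
proof -
  obtain w where w: "conflation A C w b" "np (src A w)" using b by (auto simp: np_deflation_def)
  note d = conflationD[OF w(1)]
  let ?Z = "src A b"
  have Y: "Y \<in> C" using XT_ends[OF x] by simp
  have bH: "b \<in> Hom A ?Z (tgt A b)" and wH: "w \<in> Hom A (src A w) ?Z" using d by (auto intro!: HomI)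
  obtain j q where jq: "conflation A C j q" "np (tgt A j)" "src A j = ?Z" using enough_np_inflation[OF d(6)] .
  note e = conflationD[OF jq(1)]
  have jH: "j \<in> Hom A ?Z (tgt A j)" using e jq by (auto intro!: HomI)
  have "tgt A w = src A j" using d jq by simp
  \<comment> \<open>The kernel of b also embeds into the n-projective \<open>tgt A j\<close>, with
    n-projective cokernel. Hence the restriction of x extends to \<open>tgt A j\<close>, and
    restricting that extension along j gives \<eta>.\<close>
  then obtain r where r: "conflation A C (j \<cdot> w) r" using noether_conflation[OF w(1) jq(1)] by metis
  have jw: "src A (j \<cdot> w) = src A w" "tgt A (j \<cdot> w) = tgt A j" using d e jq by simp_all
  have V: "np (tgt A r)" using np_cokernel[OF r] w(2) jq(2) jw by simp
  have wx: "pull x w \<in> XT n (src A w) Y" using pull_XT[OF x wH d(5)] .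
  have "splice (pull x w) (cls [(j \<cdot> w, r)]) \<in> XT (n + 1) (tgt A r) Y"
    using splice_XT[OF wx, of "cls [(j \<cdot> w, r)]" 1 "tgt A r"] cls_single[OF r] jw by simp
  then have "splice (pull x w) (cls [(j \<cdot> w, r)]) = zer (n + 1) (tgt A r) Y" using vanish_left[OF V] by simp
  then obtain v where v: "v \<in> XT n (tgt A j) Y" "pull x w = pull v (j \<cdot> w)"
    using pull_exact_left[OF r] wx jw by metis
  let ?\<eta> = "pull v j"
  have \<eta>: "?\<eta> \<in> XT n ?Z Y" using pull_XT[OF v(1) jH d(6)] .
  have \<eta>w: "pull ?\<eta> w = pull x w" using pull_pull[OF v(1) jH wH d(6,5)] v(2) by simp
  have \<eta>P: "?\<eta> \<in> proj_ext A C n ?Z Y" using v(1) jH jq(2) by (auto simp: proj_ext_def)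
  interpret W: group_hom "Ext A C n ?Z Y" "Ext A C n (src A w) Y" "\<lambda>c. pull c w"
    using pull_hom[OF n_pos Y wH d(6,5)] .
  \<comment> \<open>Any nonempty unit conflation detects P, so length 1 suffices here.\<close>
  obtain E T where E: "useq E T Y" "length E = 1" using resolution_exists[OF Y] by blast
  then have En: "E \<noteq> []" by auto
  interpret K: group_hom "Ext A C n ?Z Y" "Ext A C (length E + n) ?Z T" "splice (cls E)"
    using splice_hom[OF XT_I[OF En useq_seq[OF E(1)]] n_pos d(6)] .
  define D where "D = x \<otimes>\<^bsub>Ext A C n ?Z Y\<^esub> inv\<^bsub>Ext A C n ?Z Y\<^esub> ?\<eta>"
  have DX: "D \<in> XT n ?Z Y" using W.G.m_closed[of x "inv\<^bsub>Ext A C n ?Z Y\<^esub> ?\<eta>"] W.G.inv_closed[of ?\<eta>] x \<eta>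
    unfolding D_def by simp
  have "D \<in> kernel (Ext A C n ?Z Y) (Ext A C n (src A w) Y) (\<lambda>c. pull c w)"
    unfolding D_def using W.kernel_coset_iff(1)[of x ?\<eta>] x \<eta> \<eta>w by simp
  then have "pull D w = zer n (src A w) Y" by (simp add: kernel_def)
  then obtain y where y: "y \<in> XT n (tgt A b) Y" "D = pull y b"
    using pull_exact_middle[OF w(1)] DX d(3) by metis
  have "splice (cls E) ?\<eta> = \<one>\<^bsub>Ext A C (length E + n) ?Z T\<^esub>" using proj_ext_iff[OF E(1) En \<eta>] \<eta>P by simp
  then have "splice (cls E) D = splice (cls E) x"
    unfolding D_def by (rule K.hom_mult_inv_one) (use x \<eta> in simp_all)
  then show ?thesis
    using pull_inverse_iff[OF E(1) En x bH, of y] y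
      pull_splice[OF XT_I[OF En useq_seq[OF E(1)]] y(1) bH d(6)] by auto
qed

end

section \<open>Construction of right unit factorizations and co-angled pairs\<close>

section \<open>Unit factorizations and co-angled pairs\<close>

context positive_n_frobenius_category
begin

text \<open>After a push-out along g the middle term is embedded into an n-projective, and the
  induced arrow k of cokernels is passed on to the next conflation. The statement allows arbitrary g
  because k is no identity even if g is one.\<close>

lemma unit_factorization:
  assumes "seq A C E Y M" "g \<in> Hom A Y Y'" "Y' \<in> C"
  shows "\<exists>D N f. useq D Y' N \<and> length D = length E \<and> emor A C E D g f"
  using assms
proof (induction E arbitrary: Y g Y')
  case Nil
  then show ?case by (intro exI[of _ "[]"] exI[of _ Y'] exI[of _ g]) (auto intro!: emor.Nil simp: Hom_def)
next
  case (Cons c E)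
  obtain i p where c: "c = (i, p)" by force
  have ip: "conflation A C i p" "src A i = Y" "seq A C E (tgt A p) M" using Cons.prems c by auto
  note d = conflationD[OF ip(1)] and g = HomD[OF Cons.prems(2)]
  obtain i1 p1 g1 where po: "conflation A C i1 p1" "is_pushout A i g g1 i1" "p1 \<cdot> g1 = p" "tgt A p1 = tgt A p"
    using pushout_conflation[OF ip(1) g(1)] g ip(2) Cons.prems(3) by metis
  note po2 = pushoutD[OF po(2)] and d1 = conflationD[OF po(1)]
  obtain j q where jq: "conflation A C j q" "np (tgt A j)" "src A j = tgt A i1"
    using enough_np_inflation[OF conflationE(3)[OF po(1)]] .
  note e = conflationD[OF jq(1)]
  obtain r k where r: "conflation A C (j \<cdot> i1) r" "r \<cdot> j = k \<cdot> p1" "src A k = tgt A p1" "tgt A k = tgt A r" "k \<in> Arr A"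
    using noether_conflation[OF po(1) jq(1)] jq(3) conflationD(1) by metis
  note dr = conflationD[OF r(1)]
  have "k \<in> Hom A (tgt A p) (tgt A r)" using r po(4) by (auto intro!: HomI)
  then obtain D N f where D: "useq D (tgt A r) N" "length D = length E" "emor A C E D k f"
    using Cons.IH[OF ip(3)] dr(7) by blast
  have ends: "src A (j \<cdot> i1) = Y'" "tgt A (j \<cdot> i1) = tgt A j" using po2 g e jq d1 by auto
  have "(j \<cdot> g1) \<cdot> i = (j \<cdot> i1) \<cdot> g" using po2 e jq by simp
  moreover have "k \<cdot> p = r \<cdot> (j \<cdot> g1)"
  proof -
    have "k \<cdot> p = (k \<cdot> p1) \<cdot> g1" unfolding po(3)[symmetric] using r d1 po2 by simp
    also have "\<dots> = r \<cdot> (j \<cdot> g1)" unfolding r(2)[symmetric] using dr(2,3) ends(2) e jq(3) po2 by simp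
    finally show ?thesis .
  qed
  ultimately have "emor A C ((i, p) # E) ((j \<cdot> i1, r) # D) g f"
    by (intro emor.Cons[OF ip(1) r(1) _ _ _ _ _ D(3), where u = "j \<cdot> g1"])
      (use g ip(2) ends po2 e jq(3) d r po(4) in \<open>auto intro!: HomI\<close>)
  moreover have "useq ((j \<cdot> i1, r) # D) Y' N" using r(1) jq(2) ends D(1) by simp
  ultimately show ?case using D(2) c by (metis length_Cons)
qed

text \<open>The kernel of the composite is an extension of the two kernels, by
  \<open>noether\<close> in the opposite category.\<close>

lemma np_deflation_comp:
  assumes "np_deflation e" "np_deflation a" "tgt A e = src A a"
  shows "np_deflation (a \<cdot> e)"
proof -
  interpret O: extension_closed_subcategory "op_cat A" C by (rule op_ext_closed)
  obtain w2 where w2: "conflation A C w2 e" "np (src A w2)" using assms(1) by (auto simp: np_deflation_def)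
  obtain w1 where w1: "conflation A C w1 a" "np (src A w1)" using assms(2) by (auto simp: np_deflation_def)
  have "conflation (op_cat A) C a w1" "conflation (op_cat A) C e w2" "tgt (op_cat A) a = src (op_cat A) e"
    using w1 w2 assms(3) by simp_all
  then obtain r k s where "conflation (op_cat A) C (e \<cdot>\<^bsub>op_cat A\<^esub> a) r" "conflation (op_cat A) C k s"
    "src (op_cat A) k = tgt (op_cat A) w1" "tgt (op_cat A) k = tgt (op_cat A) r" "tgt (op_cat A) s = tgt (op_cat A) w2"
    using O.noether_conflation by metis
  then have *: "conflation A C r (a \<cdot> e)" "conflation A C s k" "tgt A k = src A w1" "src A k = src A r" "src A s = src A w2"
    by simp_all
  then have "np (src A r)" using np_extension[OF *(2)] w1(2) w2(2) conflationD[OF *(2)] by simp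
  then show ?thesis using *(1) by (auto simp: np_deflation_def)
qed

lemma np_deflation_arr: "np_deflation a \<Longrightarrow> a \<in> Arr A \<and> src A a \<in> C \<and> tgt A a \<in> C"
  by (auto simp: np_deflation_def dest: conflationD(2,6,7))

lemma np_deflation_idm: "X \<in> C \<Longrightarrow> np_deflation (idm A X)"
  using idm_zero_conflation(2)[of X] np_zero_obj by (auto simp: np_deflation_def intro!: exI[of _ "hzero A (zero_obj A) X"])

text \<open>The composite \<open>x \<cdot> a\<close> need not be an inflation; adding the component
  z0 makes it one, and the second projection still covers x. By the 3x3 lemma the kernel of the
  induced arrow a2 is the cokernel of \<open>z0 \<cdot> w\<close>, which is n-projective by
  \<open>np_cokernel\<close>.\<close>

lemma unit_step:
  assumes a: "np_deflation a" "tgt A a = src A x" and xp: "conflation A C x p" "np (tgt A x)"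
    and z0: "conflation A C z0 c0" "np (tgt A z0)" "src A z0 = src A a"
  defines "z \<equiv> (in1 (tgt A z0) (tgt A x) \<cdot> z0) \<boxplus> (in2 (tgt A z0) (tgt A x) \<cdot> (x \<cdot> a))"
  shows "\<exists>q a2. conflation A C z q \<and> np_deflation a2 \<and> src A a2 = tgt A q \<and> tgt A a2 = tgt A p \<and>
    a2 \<cdot> q = p \<cdot> pr2 (tgt A z0) (tgt A x)"
proof -
  obtain w where w: "conflation A C w a" "np (src A w)" using a by (auto simp: np_deflation_def)
  note dw = conflationD[OF w(1)] and dx = conflationD[OF xp(1)] and dz0 = conflationD[OF z0(1)]
  let ?Q = "tgt A z0" and ?P = "tgt A x"
  have QP: "?Q \<in> C" "?P \<in> C" using np_in z0 xp by auto
  have bp: "is_biproduct A ?Q (tgt A (x \<cdot> a)) (bpo ?Q ?P) (in1 ?Q ?P) (in2 ?Q ?P) (pr1 ?Q ?P) (pr2 ?Q ?P)"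
    using biprod_is[of ?Q ?P] QP dx dw a by simp
  obtain q where q: "conflation A C z q"
    using inflation_pair[OF z0(1) _ _ _ bp] dx dw a z0(3) unfolding z_def by auto
  note dq = conflationD[OF q]
  have zD: "src A z = src A a" "tgt A z = bpo ?Q ?P" using dz0 dx dw a z0(3) QP unfolding z_def by auto
  obtain v where v: "conflation A C (z0 \<cdot> w) v"
    using noether_conflation[OF w(1) z0(1)] dw z0(3) by metis
  have zw: "src A (z0 \<cdot> w) = src A w" "tgt A (z0 \<cdot> w) = ?Q" using dw dz0 z0(3) by simp_all
  have V: "np (tgt A v)" using np_cokernel[OF v] w(2) z0(2) zw by simp
  note dv = conflationD[OF v]
  have sq1: "in1 ?Q ?P \<cdot> (z0 \<cdot> w) = z \<cdot> w"
    using dz0 dx dw a z0(3) QP unfolding z_def by simp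
  have sq2: "pr2 ?Q ?P \<cdot> z = x \<cdot> a"
    using dz0 dx dw a z0(3) QP unfolding z_def by simp
  obtain v2 a2 where v2: "short_exact A v2 a2" "a2 \<cdot> q = p \<cdot> pr2 ?Q ?P" "src A v2 = tgt A v" "tgt A a2 = tgt A p" "src A a2 = tgt A q"
    by (rule nine[OF conflationE(1)[OF w(1)] conflationE(1)[OF bpo_conflation[OF QP]] conflationE(1)[OF q] conflationE(1)[OF xp(1)]
          conflationE(1)[OF v] _ _ _ _ _ sq1 sq2])
      (use dw dx dz0 zD zw a z0(3) QP in auto)
  have "conflation A C v2 a2" using v2 dv dx by (intro conflationI) auto
  then have "np_deflation a2" using v2 V by (auto simp: np_deflation_def)
  with q v2 show ?thesis by auto
qed

text \<open>Enlarging the middle term by a summand enlarges the cokernel by a kernel isomorphic to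
  that summand: this is the 3x3 lemma with the trivial conflation 0 -> X -> X as first row.\<close>

lemma unit_step_enlarge:
  assumes z: "conflation A C z q" and y: "y \<in> Arr A" "src A y = src A z" "np (tgt A y)"
    and z': "conflation A C ((in1 (tgt A z) (tgt A y) \<cdot> z) \<boxplus> (in2 (tgt A z) (tgt A y) \<cdot> y)) q'"
  shows "\<exists>e. np_deflation e \<and> src A e = tgt A q' \<and> tgt A e = tgt A q \<and> e \<cdot> q' = q \<cdot> pr1 (tgt A z) (tgt A y)"
proof -
  let ?Q = "tgt A z" and ?P = "tgt A y" and ?O = "zero_obj A" and ?X = "src A z"
  let ?z = "(in1 ?Q ?P \<cdot> z) \<boxplus> (in2 ?Q ?P \<cdot> y)"
  note d = conflationD[OF z] and d' = conflationD[OF z']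
  have QP: "?Q \<in> C" "?P \<in> C" using d np_in y by auto
  have zD: "src A ?z = ?X" "tgt A ?z = bpo ?Q ?P" using d y QP by auto
  have bp: "short_exact A (in2 ?Q ?P) (pr1 ?Q ?P)"
    using biproduct_short_exact[OF biproduct_swap[OF biprod_is]] QP by simp
  have sq1: "in2 ?Q ?P \<cdot> hzero A ?O ?P = ?z \<cdot> hzero A ?O ?X" using QP d y by simp
  have sq2: "pr1 ?Q ?P \<cdot> ?z = z \<cdot> idm A ?X" using QP d y by simp
  have dd: "?X \<in> C" using d by simp
  obtain v2 a2 where v2: "short_exact A v2 a2" "a2 \<cdot> q' = q \<cdot> pr1 ?Q ?P" "src A v2 = tgt A (idm A ?P)" "tgt A a2 = tgt A q" "src A a2 = tgt A q'"
    by (rule nine[OF conflationE(1)[OF idm_zero_conflation(2)[OF dd]] bp conflationE(1)[OF z'] conflationE(1)[OF z]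
          conflationE(1)[OF idm_zero_conflation(2)[OF QP(2)]] _ _ _ _ _ sq1 sq2])
      (use d zD QP in auto)
  have "conflation A C v2 a2" using v2 d QP by (intro conflationI) auto
  moreover have "np (src A v2)" using v2(3) y(3) QP by simp
  ultimately have "np_deflation a2" unfolding np_deflation_def by blast
  then show ?thesis using v2 by blast
qed

text \<open>Each conflation of the common sequence needs a middle term covering those of both D and
  D'. The left arrows a and b are general because the recursion continues with the induced arrows on
  the cokernels.\<close>

lemma coangled_exists:
  assumes "useq D X0 X" "useq D' X0' X'" "length D' = length D"
    "np_deflation a" "src A a = Z0" "tgt A a = X0" "np_deflation b" "src A b = Z0" "tgt A b = X0'"
  shows "\<exists>E Z a' b'. useq E Z0 Z \<and> length E = length D \<and> emor A C E D a a' \<and> emor A C E D' b b' \<and>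
    np_deflation a' \<and> np_deflation b'"
  using assms
proof (induction D arbitrary: D' X0 X0' a b Z0)
  case Nil
  then show ?case using np_deflation_arr[of a] np_deflation_arr[of b]
    by (intro exI[of _ "[]"] exI[of _ Z0] exI[of _ a] exI[of _ b]) (auto intro!: emor.Nil)
next
  case (Cons c D)
  obtain x p where c: "c = (x, p)" by force
  obtain x' p' D1' where D': "D' = (x', p') # D1'" using Cons.prems(3) by (cases D') auto
  have xp: "conflation A C x p" "np (tgt A x)" "src A x = X0" "useq D (tgt A p) X" using Cons.prems(1) c by auto
  have xp': "conflation A C x' p'" "np (tgt A x')" "src A x' = X0'" "useq D1' (tgt A p') X'" "length D1' = length D"
    using Cons.prems(2,3) D' by auto
  note dx = conflationD[OF xp(1)] and dx' = conflationD[OF xp'(1)]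
  note na = np_deflation_arr[OF Cons.prems(4)] and nb = np_deflation_arr[OF Cons.prems(7)]
  have Z0: "Z0 \<in> C" using na Cons.prems(5) by simp
  obtain z0 c0 where z0: "conflation A C z0 c0" "np (tgt A z0)" "src A z0 = Z0" using enough_np_inflation[OF Z0] .
  note dz0 = conflationD[OF z0(1)]
  let ?Q0 = "tgt A z0" and ?P = "tgt A x" and ?P' = "tgt A x'"
  define z where "z = (in1 ?Q0 ?P \<cdot> z0) \<boxplus> (in2 ?Q0 ?P \<cdot> (x \<cdot> a))"
  have C: "?Q0 \<in> C" "?P \<in> C" "?P' \<in> C" using np_in z0 xp xp' by auto
  obtain q a2 where qa: "conflation A C z q" "np_deflation a2" "src A a2 = tgt A q" "tgt A a2 = tgt A p" "a2 \<cdot> q = p \<cdot> pr2 ?Q0 ?P"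
    using unit_step[OF Cons.prems(4) _ xp(1,2) z0(1,2)] Cons.prems(5,6) xp(3) z0(3) unfolding z_def by metis
  note dq = conflationD[OF qa(1)]
  have zD: "z \<in> Arr A" "src A z = Z0" "tgt A z = bpo ?Q0 ?P" "pr2 ?Q0 ?P \<cdot> z = x \<cdot> a"
    unfolding z_def using dz0 z0(3) na Cons.prems(5,6) dx xp(3) C by auto
  \<comment> \<open>The middle term that already serves D receives the summand P' for D';
    \<open>unit_step\<close> then treats z as the auxiliary inflation for the second
    sequence.\<close>
  define z' where "z' = (in1 (tgt A z) ?P' \<cdot> z) \<boxplus> (in2 (tgt A z) ?P' \<cdot> (x' \<cdot> b))"
  have npz: "np (tgt A z)" using np_bpo z0(2) xp(2) zD(3) by simp
  have Cz: "tgt A z \<in> C" using np_in[OF npz] .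
  have z'D: "z' \<in> Arr A" "src A z' = Z0" "tgt A z' = bpo (tgt A z) ?P'" "pr2 (tgt A z) ?P' \<cdot> z' = x' \<cdot> b"
      "pr1 (tgt A z) ?P' \<cdot> z' = z"
    unfolding z'_def using zD(1,2) nb Cons.prems(8,9) dx' xp'(3) C Cz by auto
  obtain q' b2 where qb: "conflation A C z' q'" "np_deflation b2" "src A b2 = tgt A q'" "tgt A b2 = tgt A p'"
      "b2 \<cdot> q' = p' \<cdot> pr2 (tgt A z) ?P'"
    using unit_step[OF Cons.prems(7) _ xp'(1,2) qa(1) npz] Cons.prems(8,9) xp'(3) zD(2) unfolding z'_def by metis
  note dq' = conflationD[OF qb(1)]
  have xb: "x' \<cdot> b \<in> Arr A" "src A (x' \<cdot> b) = src A z" "tgt A (x' \<cdot> b) = ?P'"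
    using nb Cons.prems(8,9) dx' xp'(3) zD(2) by auto
  obtain e where e: "np_deflation e" "src A e = tgt A q'" "tgt A e = tgt A q" "e \<cdot> q' = q \<cdot> pr1 (tgt A z) ?P'"
    using unit_step_enlarge[OF qa(1) xb(1,2), unfolded xb(3), OF xp'(2), of q'] qb(1) unfolding z'_def by metis
  note ne = np_deflation_arr[OF e(1)] and na2 = np_deflation_arr[OF qa(2)] and nb2 = np_deflation_arr[OF qb(2)]
  have ae: "np_deflation (a2 \<cdot> e)" "src A (a2 \<cdot> e) = tgt A q'" "tgt A (a2 \<cdot> e) = tgt A p"
    using np_deflation_comp[OF e(1) qa(2)] e qa ne na2 by auto
  obtain E Z a' b' where E: "useq E (tgt A q') Z" "length E = length D" "emor A C E D (a2 \<cdot> e) a'" "emor A C E D1' b2 b'"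
      "np_deflation a'" "np_deflation b'"
    using Cons.IH[OF xp(4) xp'(4,5) ae qb(2,3,4)] by blast
  let ?u = "pr2 ?Q0 ?P \<cdot> pr1 (tgt A z) ?P'"
  have "?u \<cdot> z' = x \<cdot> a" using z'D zD Cz C by simp
  moreover have "(a2 \<cdot> e) \<cdot> q' = p \<cdot> ?u"
  proof -
    have "(a2 \<cdot> e) \<cdot> q' = a2 \<cdot> (q \<cdot> pr1 (tgt A z) ?P')" using e ne na2 qa(3) dq' by simp
    also have "\<dots> = p \<cdot> ?u"
      using reassoc[OF qa(5), of "pr1 (tgt A z) ?P'"] na2 qa(3) dq dx zD(3) Cz C by simp
    finally show ?thesis .
  qed
  ultimately have m: "emor A C ((z', q') # E) ((x, p) # D) a a'"
    by (intro emor.Cons[OF qb(1) xp(1) _ _ _ _ _ E(3), where u = ?u])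
      (use na Cons.prems(5,6) xp(3) z'D Cz C zD(3) ae np_deflation_arr[OF ae(1)] in \<open>auto intro!: HomI\<close>)
  have m': "emor A C ((z', q') # E) ((x', p') # D1') b b'"
    by (rule emor.Cons[OF qb(1) xp'(1) _ _ _ _ _ E(4), where u = "pr2 (tgt A z) ?P'"])
      (use nb Cons.prems(8,9) xp'(3) z'D Cz C qb(3,4,5) nb2 in \<open>auto intro!: HomI\<close>)
  have "useq ((z', q') # E) Z0 Z" using qb(1) z'D E(1) np_bpo[OF npz xp'(2)] by simp
  then show ?case using m m' E c D' by (metis length_Cons)
qed

section \<open>The composition modulo P and its associativity\<close>

section \<open>The composition\<close>

text \<open>Both constructions start from the identity of B; the right-hand components of the
  resulting morphisms are f, a and b, since such morphisms compute pull-backs.\<close>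

lemma factorization_exists:
  assumes \<delta>: "\<delta> \<in> unit_ext A C n N B" and x: "x \<in> XT n M B"
  obtains N' \<delta>' f Z a b where "right_unit_factorization A C n M B x N' \<delta>' f"
    "coangled_pair A C n N N' B Z \<delta> \<delta>' a b"
proof -
  obtain D where D: "useq D B N" "length D = n" "D \<noteq> []" "\<delta> = cls D" using \<delta> by (auto simp: unit_ext_iff)
  obtain E where E: "E \<noteq> []" "seq A C E B M" "length E = n" "x = cls E" using XT_E[OF x] by metis
  have B: "B \<in> C" "M \<in> C" using seq_ends[OF E(2)] by auto
  then have "idm A B \<in> Hom A B B" by (auto intro!: HomI)
  then obtain D' N' f where D': "useq D' B N'" "length D' = length E" "emor A C E D' (idm A B) f"
    using unit_factorization[OF E(2)] B by blast
  have D'n: "D' \<noteq> []" "length D' = length D" using D'(2) E D by auto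
  have f: "f \<in> Hom A M N'" 
    using emor_ends[OF D'(3)] seq_unique[OF E(2) _ E(1)] seq_unique[OF useq_seq[OF D'(1)] _ D'n(1)] by (metis HomI)
  have "pull (cls D') f = x" using pull_cls[OF D'(3) useq_seq[OF D'(1)] D'n(1)] E(4) by simp
  moreover have D'u: "cls D' \<in> unit_ext A C n N' B" using D' D'n E(3) by (auto simp: unit_ext_iff)
  ultimately have fac: "right_unit_factorization A C n M B x N' (cls D') f"
    using f by (simp add: right_unit_factorization_def)
  obtain G Z a b where G: "useq G B Z" "length G = length D" "emor A C G D (idm A B) a" "emor A C G D' (idm A B) b"
      "np_deflation a" "np_deflation b"
    using coangled_exists[OF D(1) D'(1) D'n(2), of "idm A B" B "idm A B"] np_deflation_idm[OF B(1)] B by auto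
  have Gn: "G \<noteq> []" using G(2) D by auto
  have a: "a \<in> Hom A Z N"
    using emor_ends[OF G(3)] seq_unique[OF useq_seq[OF G(1)] _ Gn] seq_unique[OF useq_seq[OF D(1)] _ D(3)] by (metis HomI)
  have b: "b \<in> Hom A Z N'"
    using emor_ends[OF G(4)] seq_unique[OF useq_seq[OF G(1)] _ Gn] seq_unique[OF useq_seq[OF D'(1)] _ D'n(1)] by (metis HomI)
  have "pull \<delta> a = cls G" "pull (cls D') b = cls G"
    using pull_cls[OF G(3) useq_seq[OF D(1)] D(3)] pull_cls[OF G(4) useq_seq[OF D'(1)] D'n(1)] D(4) by simp_all
  moreover have "cls G \<in> unit_ext A C n Z B" using G(1,2) D(2) Gn by (auto simp: unit_ext_iff)
  ultimately have "coangled_pair A C n N N' B Z \<delta> (cls D') a b"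
    using \<delta> D'u a b np_deflation_quasi_invertible[OF G(5)] np_deflation_quasi_invertible[OF G(6)]
    by (simp add: coangled_pair_def)
  with fac show ?thesis by (rule that)
qed

text \<open>For \<eta> with n-projective first argument, x\<eta> has degree above n and vanishes.
  Thus every x of positive degree acts on classes modulo P, though only unit conflations are known
  to act injectively.\<close>

lemma splice_ext_bar:
  assumes x: "x \<in> XT t B W" "t \<ge> 1" and c: "c \<in> XT n M B" "d \<in> XT n M B"
    and eq: "ext_bar A C n M B c = ext_bar A C n M B d"
  shows "splice x c = splice x d"
proof -
  have C: "M \<in> C" "B \<in> C" "W \<in> C" using XT_ends[OF c(1)] XT_ends[OF x(1)] by auto
  obtain E T where E: "useq E T B" "length E = 1" using resolution_exists[OF C(2)] by blast
  then have En: "E \<noteq> []" by auto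
  interpret K: group_hom "Ext A C n M B" "Ext A C (length E + n) M T" "splice (cls E)"
    using splice_hom[OF XT_I[OF En useq_seq[OF E(1)]] n_pos C(1)] .
  have "c \<in> ext_bar A C n M B d"
    using K.G.rcos_self[OF _ K.subgroup_kernel, of c] c(1) eq unfolding ext_bar_def proj_ext_kernel[OF E(1) En C(1)] by simp
  then obtain e where e: "e \<in> proj_ext A C n M B" "c = bsum M B e d" by (auto simp: ext_bar_def r_coset_def)
  obtain \<eta> h P where P: "np P" "h \<in> Hom A M P" "\<eta> \<in> XT n P B" "e = pull \<eta> h" using e(1) by (auto simp: proj_ext_def)
  have "splice x \<eta> = zer (t + n) P W" using vanish_left[OF P(1) _ splice_XT[OF x(1) P(3)]] x(2) by simp
  then have "splice x e = zer (t + n) M W"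
    using pull_splice[OF x(1) P(3,2) C(1)] P(4) pull_zer[OF _ np_in[OF P(1)] P(2) C(3,1)] n_pos by simp
  then show ?thesis
    using e(2) splice_bsum_right[OF x(1) proj_ext_XT[OF C(1) e(1)] c(2)] bsum_zer_left[OF splice_XT[OF x(1) c(2)]] by simp
qed

lemma coangled_pairD:
  assumes "coangled_pair A C n X X' B Z \<delta> \<delta>' a b"
  shows "\<delta> \<in> XT n X B" "\<delta>' \<in> XT n X' B" "a \<in> Hom A Z X" "b \<in> Hom A Z X'" "np_deflation b" "Z \<in> C" "X \<in> C" "X' \<in> C"
    "pull \<delta> a = pull \<delta>' b" "src A b = Z" "tgt A b = X'"
proof -
  show \<delta>: "\<delta> \<in> XT n X B" "\<delta>' \<in> XT n X' B" "a \<in> Hom A Z X" "b \<in> Hom A Z X'" "pull \<delta> a = pull \<delta>' b"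
    using assms unit_ext_XT by (auto simp: coangled_pair_def)
  show "np_deflation b" using assms quasi_invertible_np_deflation by (auto simp: coangled_pair_def)
  then show "Z \<in> C" "X \<in> C" "X' \<in> C" "src A b = Z" "tgt A b = X'"
    using np_deflation_arr HomD[OF \<delta>(4)] XT_ends[OF \<delta>(1)] XT_ends[OF \<delta>(2)] by auto
qed

text \<open>Splicing with a unit conflation \<open>T\<close> of length \<open>n + 1\<close> ending in \<open>Y\<close> embeds
  \<open>Ext\<^sup>n(M, Y)/\<P>\<close> into \<open>Ext\<^sup>2\<^sup>n\<^sup>+\<^sup>1(M, W)\<close>. If \<open>T\<beta> = x\<delta>\<close>, then \<open>\<beta> \<circ> \<gamma>\<close> is the
  class \<open>\<rho>\<close> with \<open>T\<rho> = x\<gamma>\<close>, so it depends on no choice. With length \<open>n\<close> instead,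
  the pull-back along a quasi-invertible deflation could fail to be injective for \<open>n = 1\<close> by the
  exact sequence alone: the relevant kernel comes from \<open>Ext\<^sup>2\<^sup>n\<^sup>-\<^sup>1\<close> of an
  \<open>n\<close>-projective object.\<close>

lemma pull_inverse_splice:
  assumes T: "useq T W Y" "length T = n + 1" and x: "x \<in> XT (n + 1) B W"
    and \<beta>: "\<beta> \<in> XT n N Y" "splice (cls T) \<beta> = splice x \<delta>"
    and co: "coangled_pair A C n N N' B Z \<delta> \<delta>' a b"
    and \<epsilon>: "\<epsilon> \<in> XT n N' Y" "splice (cls T) (pull \<beta> a) = pull (splice (cls T) \<epsilon>) b"
  shows "splice (cls T) \<epsilon> = splice x \<delta>'"
proof (rule np_deflation_pull_inj)
  note c = coangled_pairD[OF co]
  have Tn: "T \<noteq> []" using T by auto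
  have TX: "cls T \<in> XT (n + 1) Y W" using XT_I[OF Tn useq_seq[OF T(1)]] T(2) by simp
  show "np_deflation b" by fact
  show "n + n > n" using n_pos by simp
  show "splice (cls T) \<epsilon> \<in> XT (Suc (n + n)) (tgt A b) W" "splice x \<delta>' \<in> XT (Suc (n + n)) (tgt A b) W"
    using splice_XT[OF TX \<epsilon>(1)] splice_XT[OF x c(2)] c(11) by simp_all
  have "pull (splice (cls T) \<epsilon>) b = pull (splice x \<delta>) a" using \<epsilon>(2) pull_splice[OF TX \<beta>(1) c(3,6)] \<beta>(2) by simp
  also have "\<dots> = splice x (pull \<delta>' b)" using pull_splice[OF x c(1,3,6)] c(9) by simp
  also have "\<dots> = pull (splice x \<delta>') b" using pull_splice[OF x c(2,4,6)] by simp
  finally show "pull (splice (cls T) \<epsilon>) b = pull (splice x \<delta>') b" .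
qed

text \<open>Every admissible choice gives T\<epsilon> = x\<delta>' by
  \<open>pull_inverse_splice\<close>; pulling back along f yields T(\<epsilon>f) = x\<gamma>, in
  which no choice is left. Since T detects P, all values coincide with the class of \<rho>. The
  definite description also asks for one admissible choice, supplied by
  \<open>factorization_exists\<close> and \<open>pull_inverse_exists\<close>.\<close>

lemma ext_comp_eqI:
  assumes M: "M \<in> C" and T: "useq T W Y" "length T = n + 1" and x: "x \<in> XT (n + 1) B W"
    and \<delta>: "\<delta> \<in> unit_ext A C n N B"
    and \<beta>: "\<beta> \<in> XT n N Y" "splice (cls T) \<beta> = splice x \<delta>" and \<gamma>: "\<gamma> \<in> XT n M B"
    and \<rho>: "\<rho> \<in> XT n M Y" "splice (cls T) \<rho> = splice x \<gamma>"
  shows "ext_comp A C n M N B Y \<delta> (ext_bar A C n N Y \<beta>) (ext_bar A C n M B \<gamma>) = ext_bar A C n M Y \<rho>"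
proof -
  have Tn: "T \<noteq> []" using T by auto
  have TX: "cls T \<in> XT (n + 1) Y W" using XT_I[OF Tn useq_seq[OF T(1)]] T(2) by simp
  have unique: "ext_bar A C n M Y (pull \<epsilon> f) = ext_bar A C n M Y \<rho>"
    if \<beta>': "\<beta>' \<in> XT n N Y" "ext_bar A C n N Y \<beta> = ext_bar A C n N Y \<beta>'"
      and \<gamma>': "\<gamma>' \<in> XT n M B" "ext_bar A C n M B \<gamma> = ext_bar A C n M B \<gamma>'"
      and fac: "right_unit_factorization A C n M B \<gamma>' N' \<delta>' f"
      and co: "coangled_pair A C n N N' B Z \<delta> \<delta>' a b"
      and inv: "is_pull_inverse A C n Z N' Y (pull \<beta>' a) b \<epsilon>" for \<beta>' \<gamma>' N' \<delta>' f Z a b \<epsilon>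
  proof -
    note c = coangled_pairD[OF co]
    have T\<beta>': "splice (cls T) \<beta>' = splice x \<delta>" using ext_bar_eq_iff[OF T(1) Tn \<beta>(1) \<beta>'(1)] \<beta>'(2) \<beta>(2) by simp
    have \<epsilon>: "\<epsilon> \<in> XT n N' Y" "splice (cls T) (pull \<beta>' a) = pull (splice (cls T) \<epsilon>) b"
      using pull_inverse_iff[OF T(1) Tn pull_XT[OF \<beta>'(1) c(3,6)] c(4)] inv by simp_all
    note \<epsilon>' = pull_inverse_splice[OF T x \<beta>'(1) T\<beta>' co \<epsilon>]
    have f: "f \<in> Hom A M N'" "\<gamma>' = pull \<delta>' f" using fac by (auto simp: right_unit_factorization_def)
    have "splice (cls T) (pull \<epsilon> f) = pull (splice x \<delta>') f" using pull_splice[OF TX \<epsilon>(1) f(1) M] \<epsilon>' by simp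
    also have "\<dots> = splice x \<gamma>'" using pull_splice[OF x c(2) f(1) M] f(2) by simp
    also have "\<dots> = splice x \<gamma>" using splice_ext_bar[OF x _ \<gamma> \<gamma>'(1) \<gamma>'(2)] by simp
    finally show ?thesis using ext_bar_eq_iff[OF T(1) Tn pull_XT[OF \<epsilon>(1) f(1) M] \<rho>(1)] \<rho>(2) by simp
  qed
  obtain N' \<delta>' f Z a b where fac: "right_unit_factorization A C n M B \<gamma> N' \<delta>' f"
    and co: "coangled_pair A C n N N' B Z \<delta> \<delta>' a b"
    using factorization_exists[OF \<delta> \<gamma>] .
  note c = coangled_pairD[OF co]
  obtain \<epsilon> where inv: "is_pull_inverse A C n Z N' Y (pull \<beta> a) b \<epsilon>"
    using pull_inverse_exists[OF c(5), of "pull \<beta> a" Y] pull_XT[OF \<beta>(1) c(3,6)] c(10,11) by auto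
  show ?thesis unfolding ext_comp_def
  proof (rule the_equality)
    show "\<exists>\<beta>' \<gamma>' N' \<delta>' f Z a b \<epsilon>. \<beta>' \<in> carrier (Ext A C n N Y) \<and> ext_bar A C n N Y \<beta> = ext_bar A C n N Y \<beta>' \<and>
        \<gamma>' \<in> carrier (Ext A C n M B) \<and> ext_bar A C n M B \<gamma> = ext_bar A C n M B \<gamma>' \<and>
        right_unit_factorization A C n M B \<gamma>' N' \<delta>' f \<and>
        coangled_pair A C n N N' B Z \<delta> \<delta>' a b \<and>
        is_pull_inverse A C n Z N' Y (pull \<beta>' a) b \<epsilon> \<and>
        ext_bar A C n M Y \<rho> = ext_bar A C n M Y (pull \<epsilon> f)"
      by (rule exI[of _ \<beta>], rule exI[of _ \<gamma>], rule exI[of _ N'], rule exI[of _ \<delta>'], rule exI[of _ f],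
        rule exI[of _ Z], rule exI[of _ a], rule exI[of _ b], rule exI[of _ \<epsilon>])
        (use \<beta>(1) \<gamma> fac co inv unique[OF \<beta>(1) refl \<gamma> refl fac co inv] in simp)
  next
    fix r assume "\<exists>\<beta>' \<gamma>' N' \<delta>' f Z a b \<epsilon>. \<beta>' \<in> carrier (Ext A C n N Y) \<and> ext_bar A C n N Y \<beta> = ext_bar A C n N Y \<beta>' \<and>
        \<gamma>' \<in> carrier (Ext A C n M B) \<and> ext_bar A C n M B \<gamma> = ext_bar A C n M B \<gamma>' \<and>
        right_unit_factorization A C n M B \<gamma>' N' \<delta>' f \<and>
        coangled_pair A C n N N' B Z \<delta> \<delta>' a b \<and>
        is_pull_inverse A C n Z N' Y (pull \<beta>' a) b \<epsilon> \<and> r = ext_bar A C n M Y (pull \<epsilon> f)"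
    then show "r = ext_bar A C n M Y \<rho>" using unique by auto
  qed
qed

text \<open>T\<beta> has degree (n + 1) + n; stripping a unit conflation of length n leaves degree n
  + 1, within the range of \<open>coshift_surj\<close>.\<close>

lemma connecting_exists:
  assumes T: "useq T W Y" "length T = n + 1" and \<delta>: "\<delta> \<in> unit_ext A C n N B" and \<beta>: "\<beta> \<in> XT n N Y"
  obtains x where "x \<in> XT (n + 1) B W" "splice (cls T) \<beta> = splice x \<delta>"
proof -
  have Tn: "T \<noteq> []" using T by auto
  have TX: "cls T \<in> XT (n + 1) Y W" using XT_I[OF Tn useq_seq[OF T(1)]] T(2) by simp
  obtain D where D: "useq D B N" "length D = n" "D \<noteq> []" "\<delta> = cls D" using \<delta> by (auto simp: unit_ext_iff)
  have "splice (cls T) \<beta> \<in> XT (n + 1 + length D) N W" using splice_XT[OF TX \<beta>] D(2) by simp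
  then show ?thesis using coshift_surj[OF D(1,3), of "n + 1"] D(4) that by auto
qed

text \<open>T ends in Y and tests the two bracketings; T' ends in B' and controls the inner
  composite of \<beta> and \<alpha>.\<close>

lemma ext_comp_assoc:
  assumes C: "M \<in> C" "N \<in> C" "Y \<in> C"
    and \<delta>: "\<delta>N \<in> unit_ext A C n N B" "\<delta>K \<in> unit_ext A C n K B'"
    and \<alpha>: "\<alpha> \<in> XT n M B" and \<beta>: "\<beta> \<in> XT n N B'" and \<gamma>: "\<gamma> \<in> XT n K Y"
  shows "ext_comp A C n M N B Y \<delta>N (ext_comp A C n N K B' Y \<delta>K (ext_bar A C n K Y \<gamma>) (ext_bar A C n N B' \<beta>)) (ext_bar A C n M B \<alpha>)
    = ext_comp A C n M K B' Y \<delta>K (ext_bar A C n K Y \<gamma>) (ext_comp A C n M N B B' \<delta>N (ext_bar A C n N B' \<beta>) (ext_bar A C n M B \<alpha>))"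
proof -
  \<comment> \<open>The ingredients f, \<delta>' and \<epsilon> are handed out along with the
    characterising equation, because \<open>splice x \<rho>2\<close> has to be evaluated on
    them.\<close>
  have comp: "\<exists>\<rho>\<in>XT n M Y. \<exists>N' \<delta>' f Z a b \<epsilon>. splice (cls T) \<rho> = splice x \<gamma> \<and> \<epsilon> \<in> XT n N' Y \<and> f \<in> Hom A M N' \<and>
      coangled_pair A C n N N' B Z \<delta> \<delta>' a b \<and> \<gamma> = pull \<delta>' f \<and> \<rho> = pull \<epsilon> f \<and>
      splice (cls T) (pull \<beta> a) = pull (splice (cls T) \<epsilon>) b"
    if M: "M \<in> C" and T: "useq T W Y" "length T = n + 1" and x: "x \<in> XT (n + 1) B W" and \<delta>: "\<delta> \<in> unit_ext A C n N B"
      and \<beta>: "\<beta> \<in> XT n N Y" "splice (cls T) \<beta> = splice x \<delta>" and \<gamma>: "\<gamma> \<in> XT n M B" for M T W Y x B \<delta> N \<beta> \<gamma>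
  proof -
    have Tn: "T \<noteq> []" using T by auto
    have TX: "cls T \<in> XT (n + 1) Y W" using XT_I[OF Tn useq_seq[OF T(1)]] T(2) by simp
    obtain N' \<delta>' f Z a b where fac: "right_unit_factorization A C n M B \<gamma> N' \<delta>' f"
      and co: "coangled_pair A C n N N' B Z \<delta> \<delta>' a b"
      using factorization_exists[OF \<delta> \<gamma>] .
    note c = coangled_pairD[OF co]
    obtain \<epsilon> where "is_pull_inverse A C n Z N' Y (pull \<beta> a) b \<epsilon>"
      using pull_inverse_exists[OF c(5), of "pull \<beta> a" Y] pull_XT[OF \<beta>(1) c(3,6)] c(10,11) by auto
    then have \<epsilon>: "\<epsilon> \<in> XT n N' Y" "splice (cls T) (pull \<beta> a) = pull (splice (cls T) \<epsilon>) b"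
      using pull_inverse_iff[OF T(1) Tn pull_XT[OF \<beta>(1) c(3,6)] c(4)] by simp_all
    have f: "f \<in> Hom A M N'" "\<gamma> = pull \<delta>' f" using fac by (auto simp: right_unit_factorization_def)
    have "splice (cls T) (pull \<epsilon> f) = splice x \<gamma>"
      using pull_splice[OF TX \<epsilon>(1) f(1) M] pull_inverse_splice[OF T x \<beta> co \<epsilon>] pull_splice[OF x c(2) f(1) M] f(2) by simp
    then show ?thesis using pull_XT[OF \<epsilon>(1) f(1) M] \<epsilon> f co by blast
  qed
  have B': "B' \<in> C" using XT_ends[OF \<beta>] by simp
  obtain T W where T: "useq T W Y" "length T = n + 1" using resolution_exists[OF C(3)] by blast
  obtain T' W' where T': "useq T' W' B'" "length T' = n + 1" using resolution_exists[OF B'] by blast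
  have TX: "cls T \<in> XT (n + 1) Y W" using XT_I[OF _ useq_seq[OF T(1)]] T(2) by force
  have T'n: "T' \<noteq> []" using T' by auto
  obtain x where x: "x \<in> XT (n + 1) B' W" "splice (cls T) \<gamma> = splice x \<delta>K" using connecting_exists[OF T \<delta>(2) \<gamma>] .
  obtain y where y: "y \<in> XT (n + 1) B W'" "splice (cls T') \<beta> = splice y \<delta>N" using connecting_exists[OF T' \<delta>(1) \<beta>] .
  obtain \<rho>1 where \<rho>1: "\<rho>1 \<in> XT n N Y" "splice (cls T) \<rho>1 = splice x \<beta>" using comp[OF C(2) T x(1) \<delta>(2) \<gamma> x(2) \<beta>] by blast
  \<comment> \<open>x1 plays for \<rho>1 and \<open>\<delta>N\<close> the role that x plays for
    \<gamma> and \<open>\<delta>K\<close>; consequently x\<beta> = x1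
    \<open>\<delta>N\<close>.\<close>
  obtain x1 where x1: "x1 \<in> XT (n + 1) B W" "splice (cls T) \<rho>1 = splice x1 \<delta>N" using connecting_exists[OF T \<delta>(1) \<rho>1(1)] .
  obtain \<rho>2 N' \<delta>' f Z a b \<epsilon> where \<rho>2: "\<rho>2 \<in> XT n M B'" "splice (cls T') \<rho>2 = splice y \<alpha>"
    and \<epsilon>: "\<epsilon> \<in> XT n N' B'" "splice (cls T') (pull \<beta> a) = pull (splice (cls T') \<epsilon>) b"
    and f: "f \<in> Hom A M N'" "\<alpha> = pull \<delta>' f" "\<rho>2 = pull \<epsilon> f"
    and co: "coangled_pair A C n N N' B Z \<delta>N \<delta>' a b"
    using comp[OF C(1) T' y(1) \<delta>(1) \<beta> y(2) \<alpha>] by blast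
  note c = coangled_pairD[OF co]
  have T'X: "cls T' \<in> XT (n + 1) B' W'" using XT_I[OF T'n useq_seq[OF T'(1)]] T'(2) by simp
  \<comment> \<open>\<beta>a and \<epsilon>b agree modulo P, which T' detects; splicing with x then
    removes the difference.\<close>
  have "ext_bar A C n Z B' (pull \<beta> a) = ext_bar A C n Z B' (pull \<epsilon> b)"
    using ext_bar_eq_iff[OF T'(1) T'n pull_XT[OF \<beta> c(3,6)] pull_XT[OF \<epsilon>(1) c(4,6)]] \<epsilon>(2) pull_splice[OF T'X \<epsilon>(1) c(4,6)] by simp
  then have ab: "splice x (pull \<beta> a) = splice x (pull \<epsilon> b)"
    using splice_ext_bar[OF x(1) _ pull_XT[OF \<beta> c(3,6)] pull_XT[OF \<epsilon>(1) c(4,6)]] by simp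
  have "splice x \<epsilon> = splice x1 \<delta>'"
  proof (rule np_deflation_pull_inj)
    show "np_deflation b" by fact
    show "n + n > n" using n_pos by simp
    show "splice x \<epsilon> \<in> XT (Suc (n + n)) (tgt A b) W" "splice x1 \<delta>' \<in> XT (Suc (n + n)) (tgt A b) W"
      using splice_XT[OF x(1) \<epsilon>(1)] splice_XT[OF x1(1) c(2)] c(11) by simp_all
    have "pull (splice x \<epsilon>) b = pull (splice x \<beta>) a"
      using pull_splice[OF x(1) \<epsilon>(1) c(4,6)] pull_splice[OF x(1) \<beta> c(3,6)] ab by simp
    also have "\<dots> = pull (splice x1 \<delta>N) a" using \<rho>1(2) x1(2) by simp
    also have "\<dots> = pull (splice x1 \<delta>') b"
      using pull_splice[OF x1(1) c(1,3,6)] pull_splice[OF x1(1) c(2,4,6)] c(9) by simp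
    finally show "pull (splice x \<epsilon>) b = pull (splice x1 \<delta>') b" .
  qed
  then have x\<rho>2: "splice x \<rho>2 = splice x1 \<alpha>"
    using pull_splice[OF x(1) \<epsilon>(1) f(1) C(1)] pull_splice[OF x1(1) c(2) f(1) C(1)] f(2,3) by simp
  \<comment> \<open>One class represents both outer composites: T\<rho>3 equals x1\<alpha>, hence
    also x\<rho>2.\<close>
  obtain \<rho>3 where \<rho>3: "\<rho>3 \<in> XT n M Y" "splice (cls T) \<rho>3 = splice x1 \<alpha>"
    using comp[OF C(1) T x1(1) \<delta>(1) \<rho>1(1) x1(2) \<alpha>] by blast
  have 1: "ext_comp A C n N K B' Y \<delta>K (ext_bar A C n K Y \<gamma>) (ext_bar A C n N B' \<beta>) = ext_bar A C n N Y \<rho>1"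
    by (rule ext_comp_eqI[OF C(2) T x(1) \<delta>(2) \<gamma> x(2) \<beta> \<rho>1])
  have 2: "ext_comp A C n M N B B' \<delta>N (ext_bar A C n N B' \<beta>) (ext_bar A C n M B \<alpha>) = ext_bar A C n M B' \<rho>2"
    by (rule ext_comp_eqI[OF C(1) T' y(1) \<delta>(1) \<beta> y(2) \<alpha> \<rho>2])
  have 3: "ext_comp A C n M N B Y \<delta>N (ext_bar A C n N Y \<rho>1) (ext_bar A C n M B \<alpha>) = ext_bar A C n M Y \<rho>3"
    by (rule ext_comp_eqI[OF C(1) T x1(1) \<delta>(1) \<rho>1(1) x1(2) \<alpha> \<rho>3])
  have 4: "ext_comp A C n M K B' Y \<delta>K (ext_bar A C n K Y \<gamma>) (ext_bar A C n M B' \<rho>2) = ext_bar A C n M Y \<rho>3"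
    by (rule ext_comp_eqI[OF C(1) T x(1) \<delta>(2) \<gamma> x(2) \<rho>2(1) \<rho>3(1)]) (use \<rho>3(2) x\<rho>2 in simp)
  show ?thesis unfolding 1 2 3 4 ..
qed

lemma ext_mod_projE:
  assumes "\<alpha> \<in> carrier (ext_mod_proj A C n X Y)"
  obtains c where "c \<in> XT n X Y" "\<alpha> = ext_bar A C n X Y c"
  using assms by (auto simp: ext_mod_proj_def FactGroup_def RCOSETS_def ext_bar_def)

end

theorem proposition7p9:
  fixes A :: "('o, 'm) additive_data" and C :: "'o set" and n :: nat
    and M N K L \<Omega>N \<Omega>K \<Omega>L :: 'o
    and \<delta>N \<delta>K :: "'m exseq set"
    and \<alpha> \<beta> \<gamma> :: "'m exseq set set"
  assumes "n \<ge> 1"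
    and "n_frobenius_category A C n"
    and "M \<in> C" and "N \<in> C" and "K \<in> C" and "L \<in> C"
    and "\<delta>N \<in> unit_ext A C n N \<Omega>N"
    and "\<delta>K \<in> unit_ext A C n K \<Omega>K"
    and "is_syzygy A C n L \<Omega>L"
    and "\<alpha> \<in> carrier (ext_mod_proj A C n M \<Omega>N)"
    and "\<beta> \<in> carrier (ext_mod_proj A C n N \<Omega>K)"
    and "\<gamma> \<in> carrier (ext_mod_proj A C n K \<Omega>L)"
  shows "ext_comp A C n M N \<Omega>N \<Omega>L \<delta>N (ext_comp A C n N K \<Omega>K \<Omega>L \<delta>K \<gamma> \<beta>) \<alpha>
       = ext_comp A C n M K \<Omega>K \<Omega>L \<delta>K \<gamma> (ext_comp A C n M N \<Omega>N \<Omega>K \<delta>N \<beta> \<alpha>)"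
proof -
  interpret positive_n_frobenius_category A C n
    using assms(1,2) by (intro positive_n_frobenius_category.intro positive_n_frobenius_category_axioms.intro)
  obtain a where a: "a \<in> XT n M \<Omega>N" "\<alpha> = ext_bar A C n M \<Omega>N a" using ext_mod_projE[OF assms(10)] .
  obtain b where b: "b \<in> XT n N \<Omega>K" "\<beta> = ext_bar A C n N \<Omega>K b" using ext_mod_projE[OF assms(11)] .
  obtain c where c: "c \<in> XT n K \<Omega>L" "\<gamma> = ext_bar A C n K \<Omega>L c" using ext_mod_projE[OF assms(12)] .
  have "\<Omega>L \<in> C" using XT_ends[OF c(1)] by simp
  then show ?thesis unfolding a(2) b(2) c(2) by (rule ext_comp_assoc[OF assms(3,4) _ assms(7,8) a(1) b(1) c(1)])
qed

end
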